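(* The map $\psi^\sharp$ (pullback of modules via $\psi$) gives a bijection between the following two sets: (i) the isomorphism classes of finite-dimensional irreducible $U_q(L(\mathfrak{sl}_2))$-modules $V$ of type $1$ such that $P_V(1)\neq0$; (ii) the isomorphism classes of finite-dimensional irreducible $\square_q$-modules of type $1$.
   Context: $\mathbb{F}$ is an algebraically closed field of characteristic $0$, and $0\neq q\in\mathbb{F}$ is not a root of unity. $[n]_q=(q^n-q^{-n})/(q-q^{-1})$, $[n]_q^!=\prod_{i=1}^n[i]_q$, $[0]_q^!=1$. All algebras are associative with $1$. $\mathbb{Z}_4=\mathbb{Z}/4\mathbb{Z}$. **The algebra $\square_q$**: the $\mathbb{F}$-algebra with generators $\{x_i\}_{i\in\mathbb{Z}_4}$ and relations, for $i\in\mathbb{Z}_4$, $$\frac{qx_ix_{i+1}-q^{-1}x_{i+1}x_i}{q-q^{-1}}=1,\qquad x_i^3x_{i+2}-[3]_qx_i^2x_{i+2}x_i+[3]_qx_ix_{i+2}x_i^2-x_{i+2}x_i^3=0.$$ On a finite-dimensional irreducible $\square_q$-module $V$ every $x_i$ is semisimple, and there are an integer $d\ge0$ (the diameter) and nonzero $\gamma\in\mathbb{F}$ (the type) such that the set of distinct eigenvalues of $x_0$ and of $x_2$ is $\{\gamma q^{d-2n}\}_{n=0}^d$, and that of $x_1$ and of $x_3$ is $\{\gamma^{-1}q^{d-2n}\}_{n=0}^d$. Type $1$ means $\gamma=1$. **The algebra $U_q(L(\mathfrak{sl}_2))$**: the $\mathbb{F}$-algebra with generators $e_i^{\pm},K_i^{\pm1}$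 ($i\in\{0,1\}$) and relations $K_iK_i^{-1}=K_i^{-1}K_i=1$; $K_0K_1=K_1K_0=1$; $K_ie_i^{\pm}K_i^{-1}=q^{\pm2}e_i^{\pm}$; $K_ie_j^{\pm}K_i^{-1}=q^{\mp2}e_j^{\pm}$ ($i\ne j$); $e_i^+e_i^--e_i^-e_i^+=(K_i-K_i^{-1})/(q-q^{-1})$; $e_0^{\pm}e_1^{\mp}=e_1^{\mp}e_0^{\pm}$; $(e_i^{\pm})^3e_j^{\pm}-[3]_q(e_i^{\pm})^2e_j^{\pm}e_i^{\pm}+[3]_qe_i^{\pm}e_j^{\pm}(e_i^{\pm})^2-e_j^{\pm}(e_i^{\pm})^3=0$ ($i\neq j$). A finite-dimensional irreducible $U_q(L(\mathfrak{sl}_2))$-module $V$ has type $1$ and diameter $d$ if $V=\bigoplus_{i=0}^dU_i$ with all $U_i\neq0$, $K_0=q^{2i-d}$ and $K_1=q^{d-2i}$ on $U_i$. Then $e_0^+,e_1^-$ map $U_i$ into $U_{i+1}$, $e_0^-,e_1^+$ map $U_i$ into $U_{i-1}$ ($U_{-1}=U_{d+1}=0$), and $\dim U_0=1$. For $j\ge0$ let $\sigma_j$ be the eigenvalue of $(e_1^+)^j(e_0^+)^j$ on $U_0$. The Drinfel'd polynomial of $V$ is $P_V=\sum_{i=0}^d(-1)^i\sigma_iz^i/([i]_q^!)^2\in\mathbb{F}[z]$. **The map $\psi$**: $\psi:\square_q\to U_q(L(\mathfrak{sl}_2))$ is the algebra homomorphism $x_0\mapsto K_0+q(q-q^{-1})K_0e_0^-$,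 $x_1\mapsto K_1-(q-q^{-1})e_1^+$, $x_2\mapsto K_1+q(q-q^{-1})K_1e_1^-$, $x_3\mapsto K_0-(q-q^{-1})e_0^+$. $\psi^\sharp$ sends each $U_q(L(\mathfrak{sl}_2))$-module to its pullback via $\psi$ (same space, $a\in\square_q$ acting as $\psi(a)$). *)

theory Defs
  imports
    "HOL-Library.Poly_Mapping"
    "HOL-Library.Numeral_Type"
    "HOL-Computational_Algebra.Polynomial"
    "HOL-Algebra.Module"
    "HOL-Algebra.QuotRing"
begin

section \<open>Algebras given by generators and relations\<close>

text \<open>
  Words under concatenation form the free monoid, so the monoid algebra
  \<open>'x list \<Rightarrow>\<^sub>0 'f\<close>, with the convolution product of
  \<^theory>\<open>HOL-Library.Poly_Mapping\<close>, is the free associative unital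
  \<open>'f\<close>-algebra on the generators \<open>'x\<close>.
\<close>

instantiation list :: (type) monoid_add
begin
definition zero_list :: "'a list" where "zero_list = []"
definition plus_list :: "'a list \<Rightarrow> 'a list \<Rightarrow> 'a list" where "plus_list = append"
instance by standard (simp_all add: zero_list_def plus_list_def)
end

definition free_gen :: "'x \<Rightarrow> 'x list \<Rightarrow>\<^sub>0 'f::comm_ring_1" where
  "free_gen x = Poly_Mapping.single [x] 1"

definition free_const :: "'f \<Rightarrow> 'x list \<Rightarrow>\<^sub>0 'f::comm_ring_1" where
  "free_const c = Poly_Mapping.single [] c"

definition free_ring :: "('x list \<Rightarrow>\<^sub>0 'f::comm_ring_1) ring" where
  "free_ring = \<lparr>carrier = UNIV, mult = (*), one = 1, zero = 0, add = (+)\<rparr>"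

text \<open>
  The homomorphism from the free algebra to a free algebra that sends each generator \<open>x\<close>
  to \<open>g x\<close>.
\<close>

definition free_ext ::
    "('x \<Rightarrow> 'y list \<Rightarrow>\<^sub>0 'f::comm_ring_1) \<Rightarrow> ('x list \<Rightarrow>\<^sub>0 'f) \<Rightarrow> ('y list \<Rightarrow>\<^sub>0 'f)" where
  "free_ext g p =
     (\<Sum>w\<in>Poly_Mapping.keys p. free_const (Poly_Mapping.lookup p w) * prod_list (map g w))"

text \<open>
  The quotient of the free algebra by the two-sided ideal generated by \<open>R\<close>; a relation
  \<open>l = r\<close> is encoded as the element \<open>l - r\<close> of \<open>R\<close>. The record \<open>module\<close> of
  \<^theory>\<open>HOL-Algebra.Module\<close> only serves to carry a ring together with a scalar multiplication.
\<close>

definition rel_class ::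
    "('x list \<Rightarrow>\<^sub>0 'f::comm_ring_1) set \<Rightarrow> ('x list \<Rightarrow>\<^sub>0 'f) \<Rightarrow> ('x list \<Rightarrow>\<^sub>0 'f) set" where
  "rel_class R p = Idl\<^bsub>free_ring\<^esub> R +>\<^bsub>free_ring\<^esub> p"

definition presented_algebra ::
    "('x list \<Rightarrow>\<^sub>0 'f::comm_ring_1) set \<Rightarrow> ('f, ('x list \<Rightarrow>\<^sub>0 'f) set) module" where
  "presented_algebra R =
     (let Q = free_ring Quot (Idl\<^bsub>free_ring\<^esub> R) in
      \<lparr>carrier = carrier Q, mult = mult Q, one = one Q, zero = zero Q, add = add Q,
       smult = (\<lambda>c X. rel_class R (free_const c) \<otimes>\<^bsub>Q\<^esub> X)\<rparr>)"


section \<open>Modules over an algebra\<close>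

text \<open>
  A module is a pair of an underlying space, a linear subspace of the ambient vector space
  \<open>'b\<close>, and an action of the algebra. Values of the action outside the carriers are
  unconstrained; all notions below, isomorphism included, ignore them. Every
  finite-dimensional vector space has an isomorphic copy in any infinite-dimensional \<open>'b\<close>,
  so isomorphism classes of such pairs are the isomorphism classes of finite-dimensional modules.
\<close>

type_synonym ('c, 'b) alg_mod = "'b set \<times> ('c \<Rightarrow> 'b \<Rightarrow> 'b)"

definition pullback :: "('c \<Rightarrow> 'd) \<Rightarrow> ('d, 'b) alg_mod \<Rightarrow> ('c, 'b) alg_mod" where
  "pullback h M = (fst M, \<lambda>a. snd M (h a))"

locale ambient_space = vector_space scale
  for scale :: "'a::field \<Rightarrow> 'b::ab_group_add \<Rightarrow> 'b"
begin

definition alg_module :: "('a, 'c) module \<Rightarrow> ('c, 'b) alg_mod \<Rightarrow> bool" where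
  "alg_module A M \<longleftrightarrow> (case M of (V, act) \<Rightarrow>
     subspace V \<and>
     (\<forall>a\<in>carrier A. \<forall>v\<in>V. act a v \<in> V) \<and>
     (\<forall>a\<in>carrier A. \<forall>u\<in>V. \<forall>v\<in>V. act a (u + v) = act a u + act a v) \<and>
     (\<forall>a\<in>carrier A. \<forall>c. \<forall>v\<in>V. act a (scale c v) = scale c (act a v)) \<and>
     (\<forall>a\<in>carrier A. \<forall>b\<in>carrier A. \<forall>v\<in>V. act (a \<oplus>\<^bsub>A\<^esub> b) v = act a v + act b v) \<and>
     (\<forall>c. \<forall>a\<in>carrier A. \<forall>v\<in>V. act (c \<odot>\<^bsub>A\<^esub> a) v = scale c (act a v)) \<and>
     (\<forall>a\<in>carrier A. \<forall>b\<in>carrier A. \<forall>v\<in>V. act (a \<otimes>\<^bsub>A\<^esub> b) v = act a (act b v)) \<and>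
     (\<forall>v\<in>V. act \<one>\<^bsub>A\<^esub> v = v))"

definition fin_dim :: "('c, 'b) alg_mod \<Rightarrow> bool" where
  "fin_dim M \<longleftrightarrow> (\<exists>B. finite B \<and> span B = fst M)"

definition irreducible_module :: "('a, 'c) module \<Rightarrow> ('c, 'b) alg_mod \<Rightarrow> bool" where
  "irreducible_module A M \<longleftrightarrow> (case M of (V, act) \<Rightarrow>
     alg_module A M \<and> V \<noteq> {0} \<and>
     (\<forall>W. subspace W \<and> W \<subseteq> V \<and> (\<forall>a\<in>carrier A. \<forall>w\<in>W. act a w \<in> W) \<longrightarrow> W = {0} \<or> W = V))"

definition module_iso :: "('a, 'c) module \<Rightarrow> ('c, 'b) alg_mod \<Rightarrow> ('c, 'b) alg_mod \<Rightarrow> bool" where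
  "module_iso A M N \<longleftrightarrow> (\<exists>f. bij_betw f (fst M) (fst N) \<and>
     (\<forall>u\<in>fst M. \<forall>v\<in>fst M. f (u + v) = f u + f v) \<and>
     (\<forall>c. \<forall>v\<in>fst M. f (scale c v) = scale c (f v)) \<and>
     (\<forall>a\<in>carrier A. \<forall>v\<in>fst M. f (snd M a v) = snd N a (f v)))"

definition iso_rel ::
    "('a, 'c) module \<Rightarrow> ('c, 'b) alg_mod set \<Rightarrow> (('c, 'b) alg_mod \<times> ('c, 'b) alg_mod) set" where
  "iso_rel A S = {(M, N). M \<in> S \<and> N \<in> S \<and> module_iso A M N}"

definition eigenvalues_on :: "('c, 'b) alg_mod \<Rightarrow> 'c \<Rightarrow> 'a set" where
  "eigenvalues_on M a = {c. \<exists>v\<in>fst M. v \<noteq> 0 \<and> snd M a v = scale c v}"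

end


section \<open>The algebra \<open>\<box>\<^sub>q\<close>\<close>

definition qnum :: "'f::field \<Rightarrow> nat \<Rightarrow> 'f" where
  "qnum q n = (q powi int n - q powi (- int n)) / (q - inverse q)"

definition qfact :: "'f::field \<Rightarrow> nat \<Rightarrow> 'f" where
  "qfact q n = (\<Prod>i=1..n. qnum q i)"

definition serre :: "'f::field \<Rightarrow> ('x list \<Rightarrow>\<^sub>0 'f) \<Rightarrow> ('x list \<Rightarrow>\<^sub>0 'f) \<Rightarrow> ('x list \<Rightarrow>\<^sub>0 'f)" where
  "serre q x y = x^3 * y - free_const (qnum q 3) * (x^2 * y * x)
                 + free_const (qnum q 3) * (x * y * x^2) - y * x^3"

text \<open>The generators are indexed by the four-element type \<open>4\<close>, whose arithmetic is modulo 4.\<close>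

abbreviation xg :: "4 \<Rightarrow> 4 list \<Rightarrow>\<^sub>0 'f::field" where
  "xg \<equiv> free_gen"

definition box_rels :: "'f::field \<Rightarrow> (4 list \<Rightarrow>\<^sub>0 'f) set" where
  "box_rels q =
     {free_const (1 / (q - inverse q)) *
        (free_const q * (xg i * xg (i + 1)) - free_const (inverse q) * (xg (i + 1) * xg i)) - 1 | i. True}
     \<union> {serre q (xg i) (xg (i + 2)) | i. True}"

definition box_alg :: "'f::field \<Rightarrow> ('f, (4 list \<Rightarrow>\<^sub>0 'f) set) module" where
  "box_alg q = presented_algebra (box_rels q)"

definition box_x :: "'f::field \<Rightarrow> 4 \<Rightarrow> (4 list \<Rightarrow>\<^sub>0 'f) set" where
  "box_x q i = rel_class (box_rels q) (xg i)"

context ambient_space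
begin

definition box_type_diam :: "'a \<Rightarrow> ((4 list \<Rightarrow>\<^sub>0 'a) set, 'b) alg_mod \<Rightarrow> 'a \<Rightarrow> nat \<Rightarrow> bool" where
  "box_type_diam q M \<gamma> d \<longleftrightarrow>
     (\<forall>i\<in>{0, 2}. eigenvalues_on M (box_x q i) = {\<gamma> * q powi (int d - 2 * int n) | n. n \<le> d}) \<and>
     (\<forall>i\<in>{1, 3}. eigenvalues_on M (box_x q i) = {inverse \<gamma> * q powi (int d - 2 * int n) | n. n \<le> d})"

definition box_type :: "'a \<Rightarrow> ((4 list \<Rightarrow>\<^sub>0 'a) set, 'b) alg_mod \<Rightarrow> 'a \<Rightarrow> bool" where
  "box_type q M \<gamma> \<longleftrightarrow> \<gamma> \<noteq> 0 \<and> (\<exists>d. box_type_diam q M \<gamma> d)"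

definition box_modules :: "'a \<Rightarrow> ((4 list \<Rightarrow>\<^sub>0 'a) set, 'b) alg_mod set" where
  "box_modules q = {M. irreducible_module (box_alg q) M \<and> fin_dim M \<and> box_type q M 1}"

end


section \<open>The algebra \<open>U\<^sub>q(L(sl\<^sub>2))\<close>\<close>

text \<open>The index set \<open>{0, 1}\<close> is the two-element type \<open>2\<close>; \<open>KInv i\<close> is the generator \<open>K\<^sub>i\<^sup>-\<^sup>1\<close>.\<close>

datatype uq_gen = EPlus 2 | EMinus 2 | KGen 2 | KInv 2

abbreviation ep :: "2 \<Rightarrow> uq_gen list \<Rightarrow>\<^sub>0 'f::field" where "ep i \<equiv> free_gen (EPlus i)"
abbreviation em :: "2 \<Rightarrow> uq_gen list \<Rightarrow>\<^sub>0 'f::field" where "em i \<equiv> free_gen (EMinus i)"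
abbreviation kk :: "2 \<Rightarrow> uq_gen list \<Rightarrow>\<^sub>0 'f::field" where "kk i \<equiv> free_gen (KGen i)"
abbreviation ki :: "2 \<Rightarrow> uq_gen list \<Rightarrow>\<^sub>0 'f::field" where "ki i \<equiv> free_gen (KInv i)"

definition uq_rels :: "'f::field \<Rightarrow> (uq_gen list \<Rightarrow>\<^sub>0 'f) set" where
  "uq_rels q =
     {kk i * ki i - 1 | i. True} \<union> {ki i * kk i - 1 | i. True}
     \<union> {kk 0 * kk 1 - 1, kk 1 * kk 0 - 1}
     \<union> {kk i * ep i * ki i - free_const (q powi 2) * ep i | i. True}
     \<union> {kk i * em i * ki i - free_const (q powi (-2)) * em i | i. True}
     \<union> {kk i * ep j * ki i - free_const (q powi (-2)) * ep j | i j. i \<noteq> j}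
     \<union> {kk i * em j * ki i - free_const (q powi 2) * em j | i j. i \<noteq> j}
     \<union> {ep i * em i - em i * ep i - free_const (1 / (q - inverse q)) * (kk i - ki i) | i. True}
     \<union> {ep 0 * em 1 - em 1 * ep 0, em 0 * ep 1 - ep 1 * em 0}
     \<union> {serre q (ep i) (ep j) | i j. i \<noteq> j} \<union> {serre q (em i) (em j) | i j. i \<noteq> j}"

definition uq_alg :: "'f::field \<Rightarrow> ('f, (uq_gen list \<Rightarrow>\<^sub>0 'f) set) module" where
  "uq_alg q = presented_algebra (uq_rels q)"

definition uq_class :: "'f::field \<Rightarrow> (uq_gen list \<Rightarrow>\<^sub>0 'f) \<Rightarrow> (uq_gen list \<Rightarrow>\<^sub>0 'f) set" where
  "uq_class q = rel_class (uq_rels q)"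

context ambient_space
begin

text \<open>
  \<open>uq_decomp q M d U\<close>: the underlying space of \<open>M\<close> is the direct sum of the nonzero subspaces
  \<open>U 0, \<dots>, U d\<close>, on which \<open>K\<^sub>0\<close> and \<open>K\<^sub>1\<close> act as prescribed for type 1 and diameter \<open>d\<close>.
  Setting \<open>U i = {0}\<close> for \<open>i > d\<close> makes \<open>U\<close> unique as a function.
\<close>

definition uq_decomp ::
    "'a \<Rightarrow> ((uq_gen list \<Rightarrow>\<^sub>0 'a) set, 'b) alg_mod \<Rightarrow> nat \<Rightarrow> (nat \<Rightarrow> 'b set) \<Rightarrow> bool" where
  "uq_decomp q M d U \<longleftrightarrow>
     (\<forall>i. subspace (U i) \<and> U i \<subseteq> fst M) \<and>
     (\<forall>i\<le>d. U i \<noteq> {0}) \<and> (\<forall>i>d. U i = {0}) \<and>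
     (\<forall>v\<in>fst M. \<exists>!u. (\<forall>i. u i \<in> U i) \<and> v = (\<Sum>i\<le>d. u i)) \<and>
     (\<forall>i\<le>d. \<forall>u\<in>U i.
        snd M (uq_class q (kk 0)) u = scale (q powi (2 * int i - int d)) u \<and>
        snd M (uq_class q (kk 1)) u = scale (q powi (int d - 2 * int i)) u)"

definition uq_type1 :: "'a \<Rightarrow> ((uq_gen list \<Rightarrow>\<^sub>0 'a) set, 'b) alg_mod \<Rightarrow> bool" where
  "uq_type1 q M \<longleftrightarrow> (\<exists>d U. uq_decomp q M d U)"

definition uq_diam :: "'a \<Rightarrow> ((uq_gen list \<Rightarrow>\<^sub>0 'a) set, 'b) alg_mod \<Rightarrow> nat" where
  "uq_diam q M = (THE d. \<exists>U. uq_decomp q M d U)"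

definition uq_wt :: "'a \<Rightarrow> ((uq_gen list \<Rightarrow>\<^sub>0 'a) set, 'b) alg_mod \<Rightarrow> nat \<Rightarrow> 'b set" where
  "uq_wt q M = (THE U. uq_decomp q M (uq_diam q M) U)"

definition drinfeld_sigma :: "'a \<Rightarrow> ((uq_gen list \<Rightarrow>\<^sub>0 'a) set, 'b) alg_mod \<Rightarrow> nat \<Rightarrow> 'a" where
  "drinfeld_sigma q M j =
     (THE s. \<forall>u\<in>uq_wt q M 0. snd M (uq_class q (ep 1 ^ j * ep 0 ^ j)) u = scale s u)"

definition drinfeld_poly :: "'a \<Rightarrow> ((uq_gen list \<Rightarrow>\<^sub>0 'a) set, 'b) alg_mod \<Rightarrow> 'a poly" where
  "drinfeld_poly q M =
     (\<Sum>i\<le>uq_diam q M. monom ((-1) ^ i * drinfeld_sigma q M i / (qfact q i)\<^sup>2) i)"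

definition uq_modules :: "'a \<Rightarrow> ((uq_gen list \<Rightarrow>\<^sub>0 'a) set, 'b) alg_mod set" where
  "uq_modules q = {M. irreducible_module (uq_alg q) M \<and> fin_dim M \<and> uq_type1 q M \<and>
                      poly (drinfeld_poly q M) 1 \<noteq> 0}"

end


section \<open>The homomorphism \<open>\<psi>\<close> and the induced map on isomorphism classes\<close>

definition psi_gen :: "'f::field \<Rightarrow> 4 \<Rightarrow> (uq_gen list \<Rightarrow>\<^sub>0 'f)" where
  "psi_gen q i =
     (if i = 0 then kk 0 + free_const (q * (q - inverse q)) * (kk 0 * em 0)
      else if i = 1 then kk 1 - free_const (q - inverse q) * ep 1
      else if i = 2 then kk 1 + free_const (q * (q - inverse q)) * (kk 1 * em 1)
      else kk 0 - free_const (q - inverse q) * ep 0)"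

text \<open>
  \<open>\<psi>\<close> sends the coset of \<open>p\<close> to the coset of \<open>free_ext (psi_gen q) p\<close>, which does not depend on
  the representative \<open>p\<close>.
\<close>

definition psi :: "'f::field \<Rightarrow> (4 list \<Rightarrow>\<^sub>0 'f) set \<Rightarrow> (uq_gen list \<Rightarrow>\<^sub>0 'f) set" where
  "psi q X = the_elem ((\<lambda>p. uq_class q (free_ext (psi_gen q) p)) ` X)"

context ambient_space
begin

text \<open>
  The isomorphism class (within \<open>box_modules q\<close>) of the pullbacks of the members of an
  isomorphism class \<open>C\<close>.
\<close>

definition psi_sharp :: "'a \<Rightarrow> ((uq_gen list \<Rightarrow>\<^sub>0 'a) set, 'b) alg_mod set
    \<Rightarrow> ((4 list \<Rightarrow>\<^sub>0 'a) set, 'b) alg_mod set" where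
  "psi_sharp q C = iso_rel (box_alg q) (box_modules q) `` (pullback (psi q) ` C)"

end

end

theory Submission
  imports Defs
begin

text \<open>
  A module over either algebra is a family of linear operators that satisfies the defining relations
  (\<open>acts_by\<close>), so the theorem is a statement about operators. Write \<open>K\<close>, \<open>Ki\<close>, \<open>A\<close>, \<open>a\<close>, \<open>B\<close>, \<open>b\<close> for the
  action of \<open>K\<^sub>0\<close>, \<open>K\<^sub>1\<close>, \<open>e\<^sub>0\<^sup>+\<close>, \<open>e\<^sub>1\<^sup>+\<close>, \<open>e\<^sub>1\<^sup>-\<close>, \<open>e\<^sub>0\<^sup>-\<close>, and \<open>X i\<close> for that of \<open>\<psi>(x\<^sub>i)\<close>. If \<open>Ki\<close> is inverse
  to \<open>K\<close> and the other four operators shift the eigenspaces of \<open>K\<close> in the prescribed way, then each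
  remaining relation of \<open>U\<^sub>q(L(sl\<^sub>2))\<close> is equivalent to one of the eight relations of \<open>\<box>\<^sub>q\<close> for the \<open>X i\<close>
  (\<open>box_relations\<close>, \<open>uq_ops_if_box_relations\<close>). Pulling back along \<open>\<psi>\<close> is therefore the same as forgetting \<open>K\<close>,
  and three things have to be shown.

  \<^item> \<open>K\<close> can be recovered. On an irreducible \<open>\<box>\<^sub>q\<close>-module of type 1 the relations say how each generator
    moves the flag of partial sums of eigenspaces of \<open>x\<^sub>i\<close>. The flags of \<open>x\<^sub>i\<close> and \<open>x\<^sub>i\<^sub>+\<^sub>2\<close> run in opposite
    directions, and irreducibility forces them to be in general position (\<open>opposite_flags\<close>). Hence
    the flags of \<open>x\<^sub>0\<close> and \<open>x\<^sub>2\<close> induce a direct sum decomposition, whose summands are declared to be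
    the eigenspaces of \<open>K\<close> (\<open>U_decomposition\<close>, \<open>exists_uq_ops\<close>). Conversely the weight spaces of a
    \<open>U\<^sub>q(L(sl\<^sub>2))\<close>-module are cut out by \<open>X 0\<close> and \<open>X 2\<close> (\<open>wt_iff_X\<close>), so an isomorphism of
    pullbacks commutes with \<open>K\<close> and is an isomorphism of \<open>U\<^sub>q(L(sl\<^sub>2))\<close>-modules (\<open>iso_of_pullbacks\<close>).

  \<^item> The Drinfel'd polynomial makes sense: the lowest weight space of an irreducible
    \<open>U\<^sub>q(L(sl\<^sub>2))\<close>-module is a line (\<open>lowest_weight_line\<close>). A subspace stable under \<open>K\<close>, \<open>A\<close> and \<open>a\<close> is stable
    under \<open>B\<close> and \<open>b\<close> too, by an argument of hard Lefschetz type (\<open>stable_under_b\<close>), so the module is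
    generated from any lowest weight vector by words in \<open>A\<close> and \<open>a\<close>. The higher \<open>q\<close>-Serre
    relations (\<open>kline_serre\<close>) show that the operators \<open>a\<^sup>jA\<^sup>j\<close> commute on the lowest weight space and
    that words of weight 0 preserve every common eigenvector of them up to scalars (\<open>\<sigma>_commute\<close>, \<open>balanced_word\<close>).

  \<^item> The pullback is irreducible if and only if \<open>P\<^sub>V(1) \<noteq> 0\<close>. Up to scalars there is one linear form that is an
    eigenvector of \<open>X 1\<close> for \<open>q\<^sup>d\<close> (\<open>lead\<close>) and one vector that is an eigenvector of \<open>X 3\<close> for \<open>q\<^sup>-\<^sup>d\<close>
    (\<open>corner\<close>); in weight components the coefficients of both are explicit products, and the value of the form on the
    vector is exactly \<open>P\<^sub>V(1)\<close> (\<open>lead_corner\<close>). On an irreducible \<open>\<box>\<^sub>q\<close>-module the value cannot vanish, since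
    otherwise the vector would lie in two members of the flags of \<open>x\<^sub>1\<close> and \<open>x\<^sub>3\<close> that are in general position
    (\<open>drinfeld_nonzero_if_X_irreducible\<close>). Conversely every proper submodule of the pullback is contained in the
    kernel of the form, and if the vector is outside that kernel, then the largest such submodule is
    stable under \<open>K\<close> and therefore zero (\<open>X_irreducible_if_drinfeld_nonzero\<close>).
\<close>


section \<open>Lagrange interpolation\<close>

definition root_poly :: "'i set \<Rightarrow> ('i \<Rightarrow> 'f::field) \<Rightarrow> 'f poly" where
  "root_poly J \<theta> = (\<Prod>k\<in>J. [:- \<theta> k, 1:])"

definition lagrange_poly :: "'i set \<Rightarrow> ('i \<Rightarrow> 'f::field) \<Rightarrow> 'i \<Rightarrow> 'f poly" where
  "lagrange_poly J \<theta> k = Polynomial.smult (inverse (\<Prod>i\<in>J-{k}. \<theta> k - \<theta> i)) (root_poly (J - {k}) \<theta>)"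

lemma poly_root_poly: "poly (root_poly J \<theta>) x = (\<Prod>k\<in>J. x - \<theta> k)"
  by (simp add: root_poly_def poly_prod)

lemma degree_root_poly: "degree (root_poly J \<theta>) = card J"
  unfolding root_poly_def by (subst degree_prod_eq_sum_degree) auto

lemma root_poly_insert: "finite J \<Longrightarrow> k \<notin> J \<Longrightarrow> root_poly (insert k J) \<theta> = [:- \<theta> k, 1:] * root_poly J \<theta>"
  by (simp add: root_poly_def)

lemma poly_lagrange:
  assumes "finite J" "inj_on \<theta> J" "i \<in> J" "k \<in> J"
  shows "poly (lagrange_poly J \<theta> k) (\<theta> i) = (if i = k then 1 else 0)"
proof (cases "i = k")
  case True
  have "(\<Prod>i\<in>J-{k}. \<theta> k - \<theta> i) \<noteq> 0"
    using assms by (auto simp: inj_on_def)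
  then show ?thesis using True by (simp add: lagrange_poly_def poly_root_poly)
next
  case False
  have "(\<Prod>l\<in>J-{k}. \<theta> i - \<theta> l) = 0"
    using assms False by (intro prod_zero) auto
  then show ?thesis using False by (simp add: lagrange_poly_def poly_root_poly)
qed

lemma degree_lagrange: "degree (lagrange_poly J \<theta> k) \<le> card (J - {k})"
  unfolding lagrange_poly_def by (metis degree_smult_le degree_root_poly)

lemma lagrange_interpolation:
  assumes fin: "finite J" and inj: "inj_on \<theta> J" and deg: "degree p < card J"
  shows "(\<Sum>k\<in>J. Polynomial.smult (poly p (\<theta> k)) (lagrange_poly J \<theta> k)) = p"
proof (rule poly_eqI_degree[where A = "\<theta> ` J"])
  fix x assume "x \<in> \<theta> ` J"
  then obtain i where i: "i \<in> J" "x = \<theta> i" by auto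
  have "poly (\<Sum>k\<in>J. Polynomial.smult (poly p (\<theta> k)) (lagrange_poly J \<theta> k)) x
      = (\<Sum>k\<in>J. poly p (\<theta> k) * (if i = k then 1 else 0))"
    using i fin inj by (simp add: poly_sum poly_lagrange)
  also have "\<dots> = (\<Sum>k\<in>J. if k = i then poly p (\<theta> k) else 0)"
    by (intro sum.cong) auto
  also have "\<dots> = poly p x" using i fin by simp
  finally show "poly (\<Sum>k\<in>J. Polynomial.smult (poly p (\<theta> k)) (lagrange_poly J \<theta> k)) x = poly p x" .
next
  have "degree (\<Sum>k\<in>J. Polynomial.smult (poly p (\<theta> k)) (lagrange_poly J \<theta> k)) \<le> card J - 1"
  proof (rule degree_sum_le[OF fin])
    fix k assume "k \<in> J"
    then show "degree (Polynomial.smult (poly p (\<theta> k)) (lagrange_poly J \<theta> k)) \<le> card J - 1"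
      using degree_lagrange[of J \<theta> k] fin by (metis degree_smult_le card_Diff_singleton le_trans)
  qed
  then show "degree (\<Sum>k\<in>J. Polynomial.smult (poly p (\<theta> k)) (lagrange_poly J \<theta> k)) < card (\<theta> ` J)"
    using deg inj by (simp add: card_image)
  show "degree p < card (\<theta> ` J)" using deg inj by (simp add: card_image)
qed


section \<open>Polynomials in a linear map\<close>

context ambient_space
begin

definition lin :: "('b \<Rightarrow> 'b) \<Rightarrow> bool" where
  "lin f \<longleftrightarrow> (\<forall>x y. f (x + y) = f x + f y) \<and> (\<forall>c x. f (scale c x) = scale c (f x))"

lemma lin_add: "lin f \<Longrightarrow> f (x + y) = f x + f y"
  and lin_scale: "lin f \<Longrightarrow> f (scale c x) = scale c (f x)"
  by (auto simp: lin_def)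

lemma lin_zero: "lin f \<Longrightarrow> f 0 = 0"
  using lin_scale[of f 0 0] by simp

lemma lin_neg: "lin f \<Longrightarrow> f (- x) = - f x"
  using lin_scale[of f "-1" x] by simp

lemma lin_diff: "lin f \<Longrightarrow> f (x - y) = f x - f y"
  using lin_add[of f x "- y"] by (simp add: lin_neg)

lemma lin_sum: "lin f \<Longrightarrow> f (sum g A) = (\<Sum>a\<in>A. f (g a))"
  by (induction A rule: infinite_finite_induct) (auto simp: lin_zero lin_add)

lemmas lin_simps = lin_add lin_scale lin_zero lin_neg lin_diff lin_sum

lemma lin_ident: "lin (\<lambda>v. v)" and lin_const_zero: "lin (\<lambda>v. 0)"
  by (auto simp: lin_def)

lemma lin_comp: "lin f \<Longrightarrow> lin g \<Longrightarrow> lin (\<lambda>v. f (g v))"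
  by (simp add: lin_def)

lemma lin_plus: "lin f \<Longrightarrow> lin g \<Longrightarrow> lin (\<lambda>v. f v + g v)"
  by (simp add: lin_def scale_right_distrib)

lemma lin_scaled: "lin f \<Longrightarrow> lin (\<lambda>v. scale c (f v))"
  by (simp add: lin_def scale_right_distrib mult.commute)

lemma lin_minus: "lin f \<Longrightarrow> lin g \<Longrightarrow> lin (\<lambda>v. f v - g v)"
  by (simp add: lin_def scale_right_diff_distrib)

lemma lin_setsum: "(\<And>i. i \<in> I \<Longrightarrow> lin (f i)) \<Longrightarrow> lin (\<lambda>v. \<Sum>i\<in>I. f i v)"
  by (induction I rule: infinite_finite_induct) (auto intro: lin_plus lin_const_zero)

lemma lin_pow: "lin f \<Longrightarrow> lin (f ^^ n)"
  by (induction n) (simp_all add: lin_def)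

definition maps_into :: "'b set \<Rightarrow> ('b \<Rightarrow> 'b) \<Rightarrow> bool" where
  "maps_into S f \<longleftrightarrow> (\<forall>v\<in>S. f v \<in> S)"

lemma maps_into_pow: "maps_into S f \<Longrightarrow> v \<in> S \<Longrightarrow> (f ^^ n) v \<in> S"
  by (induction n) (auto simp: maps_into_def)

lemma subspace_vimage: "lin f \<Longrightarrow> subspace Z \<Longrightarrow> subspace {v. f v \<in> Z}"
  by (simp add: subspace_def lin_simps)

lemma span_image_subset:
  assumes "lin f" "subspace Z" "\<And>v. v \<in> S \<Longrightarrow> f v \<in> Z" "v \<in> span S"
  shows "f v \<in> Z"
  using span_minimal[OF _ subspace_vimage[OF assms(1,2)], of S] assms(3,4) by auto

text \<open>
  The value \<open>p(T)v\<close> of a polynomial in \<open>T\<close>. Combined with Lagrange polynomials it extracts components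
  of sums of eigenvectors without any matrix or basis.
\<close>

definition papp :: "('b \<Rightarrow> 'b) \<Rightarrow> 'a poly \<Rightarrow> 'b \<Rightarrow> 'b" where
  "papp T p v = (\<Sum>i\<le>degree p. scale (coeff p i) ((T ^^ i) v))"

lemma papp_eq: "degree p \<le> n \<Longrightarrow> papp T p v = (\<Sum>i\<le>n. scale (coeff p i) ((T ^^ i) v))"
  unfolding papp_def by (rule sum.mono_neutral_left) (auto simp: coeff_eq_0)

lemma papp_0 [simp]: "papp T 0 v = 0"
  by (simp add: papp_def)

lemma papp_add: "papp T (p + r) v = papp T p v + papp T r v"
proof -
  let ?n = "max (degree p) (degree r)"
  have "degree (p + r) \<le> ?n" by (rule degree_add_le_max)
  then show ?thesis
    by (simp add: papp_eq[of _ ?n] scale_left_distrib sum.distrib)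
qed

lemma papp_smult: "papp T (Polynomial.smult c p) v = scale c (papp T p v)"
  using papp_eq[OF degree_smult_le[of c p], of T v]
  by (simp add: papp_def scale_sum_right)

lemma papp_diff: "papp T (p - r) v = papp T p v - papp T r v"
  using papp_add[of T "p - r" r v] by simp

lemma papp_setsum: "papp T (\<Sum>i\<in>I. f i) v = (\<Sum>i\<in>I. papp T (f i) v)"
  by (induction I rule: infinite_finite_induct) (auto simp: papp_add)

lemma papp_pCons:
  assumes "lin T"
  shows "papp T (pCons a p) v = scale a v + T (papp T p v)"
proof -
  have "papp T (pCons a p) v = (\<Sum>i\<le>Suc (degree p). scale (coeff (pCons a p) i) ((T ^^ i) v))"
    by (rule papp_eq) (simp add: degree_pCons_le)
  also have "\<dots> = scale a v + (\<Sum>i\<le>degree p. scale (coeff p i) ((T ^^ Suc i) v))"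
    by (subst sum.atMost_Suc_shift) simp
  also have "\<dots> = scale a v + T (papp T p v)"
    by (simp add: papp_def lin_simps[OF assms])
  finally show ?thesis .
qed

lemma papp_1 [simp]: "papp T 1 v = v"
  by (simp add: papp_def)

lemma lin_papp: "lin T \<Longrightarrow> lin (papp T p)"
  unfolding papp_def[abs_def] by (intro lin_setsum lin_scaled lin_pow)

lemma papp_mult: "lin T \<Longrightarrow> papp T (p * r) v = papp T p (papp T r v)"
proof (induction p)
  case (pCons a p)
  then show ?case
    by (simp add: papp_add papp_smult papp_pCons lin_simps)
qed simp

lemma papp_linear_factor: "lin T \<Longrightarrow> papp T [:- \<theta>, 1:] v = T v - scale \<theta> v"
  by (simp add: papp_pCons lin_zero)

lemma papp_closed: "lin T \<Longrightarrow> subspace S \<Longrightarrow> maps_into S T \<Longrightarrow> v \<in> S \<Longrightarrow> papp T p v \<in> S"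
  unfolding papp_def by (intro subspace_sum subspace_scale maps_into_pow) auto

lemma papp_eigen: "lin T \<Longrightarrow> T v = scale \<theta> v \<Longrightarrow> papp T p v = scale (poly p \<theta>) v"
  by (induction p) (auto simp: papp_pCons lin_simps scale_left_distrib)

lemma papp_intertwine:
  assumes "lin T" "lin T'" and V: "maps_into V T" "v \<in> V"
    and add: "\<And>u v. u \<in> V \<Longrightarrow> v \<in> V \<Longrightarrow> f (u + v) = f u + f v"
    and sc: "\<And>c v. v \<in> V \<Longrightarrow> f (scale c v) = scale c (f v)"
    and com: "\<And>v. v \<in> V \<Longrightarrow> f (T v) = T' (f v)" and sub: "subspace V"
  shows "f (papp T p v) = papp T' p (f v)"
proof (induction p)
  case 0
  have "f 0 = 0" using sc[OF subspace_0[OF sub], of 0] by simp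
  then show ?case by simp
next
  case (pCons a p)
  have 1: "papp T p v \<in> V" by (rule papp_closed) (use assms in auto)
  then have "T (papp T p v) \<in> V" using V by (auto simp: maps_into_def)
  then show ?case
    using pCons 1 assms by (simp add: papp_pCons subspace_scale)
qed

lemma papp_component:
  assumes T: "lin T" and J: "finite J" "inj_on \<theta> J" "j \<in> J"
    and u: "\<And>i. i \<in> J \<Longrightarrow> T (u i) = scale (\<theta> i) (u i)"
  shows "papp T (lagrange_poly J \<theta> j) (\<Sum>i\<in>J. u i) = u j"
proof -
  have "papp T (lagrange_poly J \<theta> j) (\<Sum>i\<in>J. u i)
      = (\<Sum>i\<in>J. scale (if i = j then 1 else 0) (u i))"
    using J by (simp add: lin_sum[OF lin_papp[OF T]] papp_eigen[OF T u] poly_lagrange)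
  also have "\<dots> = (\<Sum>i\<in>J. if i = j then u i else 0)"
    by (intro sum.cong) auto
  also have "\<dots> = u j" using J by simp
  finally show ?thesis .
qed

text \<open>
  A linear map annihilated by a polynomial with simple roots is diagonalizable: the Lagrange
  polynomials at the roots are the projections to the eigenspaces.
\<close>

lemma kernel_root_poly_eigenvector:
  assumes T: "lin T" and J: "finite J" "k \<in> J" and w: "papp T (root_poly J \<theta>) w = 0"
  shows "T (papp T (lagrange_poly J \<theta> k) w) = scale (\<theta> k) (papp T (lagrange_poly J \<theta> k) w)"
proof -
  have "root_poly J \<theta> = [:- \<theta> k, 1:] * root_poly (J - {k}) \<theta>"
    using root_poly_insert[of "J - {k}" k \<theta>] J by (simp add: insert_absorb)
  then have "papp T [:- \<theta> k, 1:] (papp T (root_poly (J - {k}) \<theta>) w) = 0"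
    using w by (simp add: papp_mult[OF T, symmetric])
  then show ?thesis
    unfolding lagrange_poly_def
    by (simp add: papp_smult papp_linear_factor[OF T] lin_scale[OF T] mult.commute scale_left_commute)
qed

lemma kernel_root_poly_sum:
  assumes "lin T" "finite J" "J \<noteq> {}" "inj_on \<theta> J"
  shows "w = (\<Sum>k\<in>J. papp T (lagrange_poly J \<theta> k) w)"
proof -
  have "(\<Sum>k\<in>J. lagrange_poly J \<theta> k) = 1"
    using lagrange_interpolation[of J \<theta> 1] assms by (simp add: card_gt_0_iff)
  then show ?thesis by (simp add: papp_setsum[symmetric])
qed


section \<open>Finite-dimensional subspaces\<close>

lemma annihilating_poly:
  assumes T: "lin T" "maps_into S T" and B: "finite B" "S \<subseteq> span B" and v: "v \<in> S"
  shows "\<exists>p. p \<noteq> 0 \<and> papp T p v = 0"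
proof (cases "inj_on (\<lambda>i. (T ^^ i) v) {..card B}")
  case True
  let ?W = "(\<lambda>i. (T ^^ i) v) ` {..card B}"
  have sub: "?W \<subseteq> span B" using maps_into_pow[OF T(2) v] B(2) by blast
  have "card ?W = Suc (card B)" using True by (simp add: card_image)
  then have "dependent ?W"
    using independent_span_bound[OF B(1) _ sub] by auto
  then obtain u where u: "\<exists>w\<in>?W. u w \<noteq> 0" "(\<Sum>w\<in>?W. scale (u w) w) = 0"
    using dependent_finite[of ?W] by auto
  define p where "p = (\<Sum>i\<le>card B. monom (u ((T ^^ i) v)) i)"
  have cf: "coeff p i = (if i \<le> card B then u ((T ^^ i) v) else 0)" for i
    by (simp add: p_def coeff_sum)
  have "p \<noteq> 0"
  proof
    assume "p = 0"
    then have "\<forall>i\<le>card B. u ((T ^^ i) v) = 0" using cf by (metis coeff_0)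
    then show False using u(1) by auto
  qed
  moreover have "degree p \<le> card B" by (rule degree_le) (simp add: cf)
  then have "papp T p v = (\<Sum>i\<le>card B. scale (u ((T ^^ i) v)) ((T ^^ i) v))"
    by (simp add: papp_eq cf)
  then have "papp T p v = 0" using u(2) by (simp add: sum.reindex[OF True])
  ultimately show ?thesis by blast
next
  case False
  then obtain i j where ij: "i \<noteq> j" "(T ^^ i) v = (T ^^ j) v" by (auto simp: inj_on_def)
  have m: "papp T (monom 1 n) v = (T ^^ n) v" for n
    by (induction n) (auto simp: papp_pCons[OF T(1)] monom_Suc monom_0 lin_zero[OF T(1)])
  have "monom 1 i - monom 1 j \<noteq> (0::'a poly)"
    using ij by (metis coeff_monom eq_iff_diff_eq_0 zero_neq_one)
  moreover have "papp T (monom 1 i - monom 1 j) v = 0" by (simp add: papp_diff m ij)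
  ultimately show ?thesis by blast
qed

text \<open>
  The constant coefficient of the annihilating polynomial of \<open>w\<close> of least degree is nonzero by injectivity, so
  \<open>w\<close> can be solved for as the image of a vector.
\<close>

lemma injective_imp_surjective:
  assumes T: "lin T" "maps_into S T" and S: "subspace S" and B: "finite B" "S \<subseteq> span B"
    and inj: "\<And>v. v \<in> S \<Longrightarrow> T v = 0 \<Longrightarrow> v = 0" and w: "w \<in> S"
  shows "\<exists>v\<in>S. T v = w"
proof -
  have "\<exists>p. p \<noteq> 0 \<and> papp T p w = 0" using annihilating_poly[OF T B w] .
  then obtain p where p: "p \<noteq> 0" "papp T p w = 0"
    and min: "\<And>r. r \<noteq> 0 \<Longrightarrow> papp T r w = 0 \<Longrightarrow> degree p \<le> degree r"
    using exists_least_iff[of "\<lambda>n. \<exists>p. degree p = n \<and> p \<noteq> 0 \<and> papp T p w = 0"]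
    by (metis not_le_imp_less)
  obtain a r where pr: "p = pCons a r" by (cases p)
  have rS: "papp T r w \<in> S" by (rule papp_closed[OF T(1) S T(2) w])
  have eq: "scale a w + T (papp T r w) = 0" using p(2) by (simp add: pr papp_pCons[OF T(1)])
  have "a \<noteq> 0"
  proof
    assume a: "a = 0"
    then have "r \<noteq> 0" using p(1) pr by auto
    moreover have "papp T r w = 0" using inj[OF rS] eq a by simp
    ultimately have "degree p \<le> degree r" by (rule min)
    then show False using pr \<open>r \<noteq> 0\<close> by simp
  qed
  have "T (scale (- inverse a) (papp T r w)) = w"
  proof -
    have "T (papp T r w) = - scale a w" using eq by (metis add_eq_0_iff)
    then have "T (scale (- inverse a) (papp T r w)) = scale (- inverse a) (- scale a w)"
      by (simp only: lin_scale[OF T(1)])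
    then show ?thesis using \<open>a \<noteq> 0\<close> by simp
  qed
  then show ?thesis using subspace_scale[OF S rS] by blast
qed

lemma exists_eigenvector:
  assumes closed: "\<And>p::'a poly. 0 < degree p \<Longrightarrow> \<exists>x. poly p x = 0"
    and T: "lin T" "maps_into S T" and S: "subspace S" "S \<noteq> {0}" and B: "finite B" "S \<subseteq> span B"
  shows "\<exists>\<theta>. \<exists>v\<in>S. v \<noteq> 0 \<and> T v = scale \<theta> v"
proof -
  obtain w where w: "w \<in> S" "w \<noteq> 0" using S subspace_0 by blast
  have "\<exists>p. p \<noteq> 0 \<and> papp T p w = 0" using annihilating_poly[OF T B w(1)] .
  then obtain p where p: "p \<noteq> 0" "papp T p w = 0"
    and min: "\<And>r. r \<noteq> 0 \<Longrightarrow> papp T r w = 0 \<Longrightarrow> degree p \<le> degree r"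
    using exists_least_iff[of "\<lambda>n. \<exists>p. degree p = n \<and> p \<noteq> 0 \<and> papp T p w = 0"]
    by (metis not_le_imp_less)
  have "degree p \<noteq> 0"
  proof
    assume "degree p = 0"
    then obtain c where "p = [:c:]" using degree_eq_zeroE by blast
    then show False using p w by (simp add: papp_pCons[OF T(1)] lin_zero[OF T(1)])
  qed
  then obtain x where "poly p x = 0" using closed by blast
  then obtain r where r: "p = [:- x, 1:] * r" by (metis poly_eq_0_iff_dvd dvdE)
  have rn: "r \<noteq> 0" using p r by auto
  have "degree p = Suc (degree r)" unfolding r using rn by (subst degree_mult_eq) auto
  then have "papp T r w \<noteq> 0" using min[OF rn] by auto
  moreover have "T (papp T r w) = scale x (papp T r w)"
    using p(2) by (simp only: r papp_mult[OF T(1)] papp_linear_factor[OF T(1)]) simp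
  moreover have "papp T r w \<in> S" by (rule papp_closed[OF T(1) S(1) T(2) w(1)])
  ultimately show ?thesis by blast
qed

lemma common_eigenvector:
  assumes closed: "\<And>p::'a poly. 0 < degree p \<Longrightarrow> \<exists>x. poly p x = 0"
    and T: "\<And>i. lin (T i)" "\<And>i. maps_into S (T i)"
    and com: "\<And>i j v. v \<in> S \<Longrightarrow> T i (T j v) = T j (T i v)"
    and S: "subspace S" "S \<noteq> {0}" and B: "finite B" "S \<subseteq> span B"
  shows "\<exists>v\<in>S. v \<noteq> 0 \<and> (\<forall>i<n::nat. \<exists>\<theta>. T i v = scale \<theta> v)"
proof -
  have "\<exists>S'. subspace S' \<and> S' \<noteq> {0} \<and> S' \<subseteq> S \<and> (\<forall>i. maps_into S' (T i)) \<and>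
          (\<forall>i<n. \<exists>\<theta>. \<forall>v\<in>S'. T i v = scale \<theta> v)"
  proof (induction n)
    case 0
    show ?case using S T by (intro exI[of _ S]) auto
  next
    case (Suc n)
    then obtain S' where S': "subspace S'" "S' \<noteq> {0}" "S' \<subseteq> S" "\<And>i. maps_into S' (T i)"
      "\<And>i. i < n \<Longrightarrow> \<exists>\<theta>. \<forall>v\<in>S'. T i v = scale \<theta> v" by blast
    have "\<exists>\<theta>. \<exists>v\<in>S'. v \<noteq> 0 \<and> T n v = scale \<theta> v"
      using exists_eigenvector[OF closed T(1) S'(4) S'(1,2) B(1)] S'(3) B(2) by blast
    then obtain \<theta> w where w: "w \<in> S'" "w \<noteq> 0" "T n w = scale \<theta> w" by blast
    define S'' where "S'' = {v\<in>S'. T n v = scale \<theta> v}"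
    have "subspace S''"
      using S'(1) unfolding S''_def subspace_def
      by (auto simp: lin_simps[OF T(1)] scale_right_distrib mult.commute)
    moreover have "S'' \<noteq> {0}" using w by (auto simp: S''_def)
    moreover have "maps_into S'' (T i)" for i
      using S'(3,4) com[of _ n i] unfolding S''_def maps_into_def
      by (auto simp: lin_simps[OF T(1)])
    moreover have "\<exists>\<theta>. \<forall>v\<in>S''. T i v = scale \<theta> v" if "i < Suc n" for i
      using that S'(5)[of i] by (cases "i = n") (auto simp: S''_def less_Suc_eq)
    ultimately show ?case using S'(3) by (intro exI[of _ S'']) (auto simp: S''_def)
  qed
  then obtain S' where S': "subspace S'" "S' \<noteq> {0}" "S' \<subseteq> S"
    "\<And>i. i < n \<Longrightarrow> \<exists>\<theta>. \<forall>v\<in>S'. T i v = scale \<theta> v" by blast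
  then obtain w where "w \<in> S'" "w \<noteq> 0" using subspace_0 by blast
  then show ?thesis using S' by blast
qed

text \<open>
  Projections turn maps defined on a subspace into maps that are linear on the whole ambient space.
\<close>

lemma exists_projection:
  assumes "subspace V"
  shows "\<exists>\<pi>. lin \<pi> \<and> (\<forall>v. \<pi> v \<in> V) \<and> (\<forall>v\<in>V. \<pi> v = v)"
proof -
  interpret vector_space_pair scale scale by unfold_locales
  have "Vector_Spaces.linear scale scale (\<lambda>v. v)"
    by unfold_locales (auto simp: scale_right_distrib)
  from linear_exists_left_inverse_on[OF this assms] obtain g
    where g: "g ` UNIV \<subseteq> V" "Vector_Spaces.linear scale scale g" "\<forall>v\<in>V. g v = v"
    by auto
  interpret g: Vector_Spaces.linear scale scale g by (rule g(2))
  have "lin g" by (simp add: lin_def g.add g.scale)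
  then show ?thesis using g by blast
qed

lemma exists_map_with_eigenspaces:
  assumes V: "subspace V" and J: "finite J"
    and U: "\<And>j. j \<in> J \<Longrightarrow> subspace (U j)" "\<And>j. j \<in> J \<Longrightarrow> U j \<subseteq> V"
    and gen: "\<And>v. v \<in> V \<Longrightarrow> \<exists>u. (\<forall>j\<in>J. u j \<in> U j) \<and> v = (\<Sum>j\<in>J. u j)"
    and indep: "\<And>u j. (\<forall>j\<in>J. u j \<in> U j) \<Longrightarrow> (\<Sum>j\<in>J. u j) = 0 \<Longrightarrow> j \<in> J \<Longrightarrow> u j = 0"
  shows "\<exists>K. lin K \<and> (\<forall>v. K v \<in> V) \<and> (\<forall>j\<in>J. \<forall>u\<in>U j. K u = scale (\<theta> j) u)"
proof -
  obtain \<pi> where \<pi>: "lin \<pi>" "\<And>v. \<pi> v \<in> V" "\<And>v. v \<in> V \<Longrightarrow> \<pi> v = v"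
    using exists_projection[OF V] by blast
  have "\<exists>u. (\<forall>j\<in>J. u j \<in> U j) \<and> \<pi> v = (\<Sum>j\<in>J. u j)" for v using gen \<pi>(2) by blast
  then obtain D where D: "\<And>v j. j \<in> J \<Longrightarrow> D v j \<in> U j" "\<And>v. \<pi> v = (\<Sum>j\<in>J. D v j)"
    by metis
  have uniq: "D v j = u j" if "\<forall>j\<in>J. u j \<in> U j" "\<pi> v = (\<Sum>j\<in>J. u j)" "j \<in> J" for u v j
  proof -
    have "(\<Sum>j\<in>J. D v j - u j) = 0" using D(2)[of v] that(2) by (simp add: sum_subtractf)
    then have "D v j - u j = 0"
      using indep[of "\<lambda>j. D v j - u j"] D(1) that U(1) by (simp add: subspace_diff)
    then show ?thesis by simp
  qed
  have Dadd: "D (x + y) j = D x j + D y j" if "j \<in> J" for x y j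
  proof (rule uniq[of "\<lambda>j. D x j + D y j"])
    show "\<pi> (x + y) = (\<Sum>j\<in>J. D x j + D y j)"
      by (simp add: lin_add[OF \<pi>(1)] sum.distrib flip: D(2))
  qed (use that D(1) U(1) in \<open>auto simp: subspace_add\<close>)
  have Dscale: "D (scale c x) j = scale c (D x j)" if "j \<in> J" for c x j
  proof (rule uniq[of "\<lambda>j. scale c (D x j)"])
    show "\<pi> (scale c x) = (\<Sum>j\<in>J. scale c (D x j))"
      by (simp add: lin_scale[OF \<pi>(1)] flip: D(2) scale_sum_right)
  qed (use that D(1) U(1) in \<open>auto simp: subspace_scale\<close>)
  define K where "K v = (\<Sum>j\<in>J. scale (\<theta> j) (D v j))" for v
  have "lin K"
    by (simp add: lin_def K_def Dadd Dscale scale_right_distrib sum.distrib scale_sum_right mult.commute)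
  moreover have "K v \<in> V" for v
    unfolding K_def using subsetD[OF U(2) D(1)] V by (intro subspace_sum subspace_scale) auto
  moreover have "K u = scale (\<theta> j) u" if j: "j \<in> J" and u: "u \<in> U j" for j u
  proof -
    have "D u i = (if i = j then u else 0)" if "i \<in> J" for i
      using that j u U J
      by (intro uniq[of "\<lambda>i. if i = j then u else 0"])
         (auto simp: subspace_0 \<pi>(3)[OF subsetD[OF U(2)[OF j] u]])
    then have "K u = (\<Sum>i\<in>J. if i = j then scale (\<theta> j) u else 0)"
      unfolding K_def by (intro sum.cong) auto
    then show ?thesis using j J by simp
  qed
  ultimately show ?thesis by blast
qed

end


section \<open>Modules over a presented algebra\<close>

lemma poly_mapping_as_sum: "p = (\<Sum>w\<in>Poly_Mapping.keys p. Poly_Mapping.single w (Poly_Mapping.lookup p w))"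
proof (rule poly_mapping_eqI)
  fix k
  have "Poly_Mapping.lookup (\<Sum>w\<in>Poly_Mapping.keys p. Poly_Mapping.single w (Poly_Mapping.lookup p w)) k
      = (\<Sum>w\<in>Poly_Mapping.keys p. if w = k then Poly_Mapping.lookup p k else 0)"
    unfolding lookup_sum by (intro sum.cong) (auto simp: lookup_single)
  also have "\<dots> = Poly_Mapping.lookup p k" by (simp add: in_keys_iff)
  finally show "Poly_Mapping.lookup p k
      = Poly_Mapping.lookup (\<Sum>w\<in>Poly_Mapping.keys p. Poly_Mapping.single w (Poly_Mapping.lookup p w)) k"
    by simp
qed

lemma list_monoid: "(v :: 'x list) + w = v @ w" "(0 :: 'x list) = []"
  by (simp_all add: plus_list_def zero_list_def)

lemma single_Nil: "Poly_Mapping.single [] 1 = (1 :: 'x list \<Rightarrow>\<^sub>0 'f::comm_ring_1)"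
  by (metis list_monoid(2) single_one)

lemma free_const_mult_single:
  "free_const c * Poly_Mapping.single w d = Poly_Mapping.single w (c * d)"
  by (simp add: free_const_def mult_single list_monoid)

lemma ring_free: "ring (free_ring :: ('x list \<Rightarrow>\<^sub>0 'f::comm_ring_1) ring)"
proof (rule ringI)
  show "abelian_group (free_ring :: ('x list \<Rightarrow>\<^sub>0 'f) ring)"
  proof (rule abelian_groupI)
    show "\<And>x. x \<in> carrier free_ring \<Longrightarrow> \<exists>y\<in>carrier free_ring. y \<oplus>\<^bsub>free_ring\<^esub> x = \<zero>\<^bsub>free_ring :: ('x list \<Rightarrow>\<^sub>0 'f) ring\<^esub>"
      unfolding free_ring_def by (simp, metis add.left_inverse)
  qed (auto simp: free_ring_def algebra_simps)
  show "Group.monoid (free_ring :: ('x list \<Rightarrow>\<^sub>0 'f) ring)"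
    by (rule monoidI) (auto simp: free_ring_def mult.assoc)
qed (auto simp: free_ring_def algebra_simps)

lemma free_ring_minus: "p \<ominus>\<^bsub>free_ring\<^esub> r = p - (r :: 'x list \<Rightarrow>\<^sub>0 'f::comm_ring_1)"
proof -
  interpret F: ring "free_ring :: ('x list \<Rightarrow>\<^sub>0 'f) ring" by (rule ring_free)
  have "\<ominus>\<^bsub>free_ring\<^esub> r = - r"
    by (rule F.minus_equality) (auto simp: free_ring_def)
  then show ?thesis by (simp add: a_minus_def) (simp add: free_ring_def)
qed

lemma ideal_Idl: "ideal (Idl\<^bsub>free_ring\<^esub> (R :: ('x list \<Rightarrow>\<^sub>0 'f::comm_ring_1) set)) free_ring"
  by (rule ring.genideal_ideal[OF ring_free]) (simp add: free_ring_def)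

lemma Idl_generators: "R \<subseteq> Idl\<^bsub>free_ring\<^esub> (R :: ('x list \<Rightarrow>\<^sub>0 'f::comm_ring_1) set)"
  by (rule ring.genideal_self[OF ring_free]) (simp add: free_ring_def)

lemma rel_class_eq_iff:
  "rel_class R p = rel_class R r \<longleftrightarrow> p - r \<in> Idl\<^bsub>free_ring\<^esub> (R :: ('x list \<Rightarrow>\<^sub>0 'f::comm_ring_1) set)"
  using ring.quotient_eq_iff_same_a_r_cos[OF ring_free ideal_Idl[of R], of p r]
  by (simp add: rel_class_def free_ring_minus) (simp add: free_ring_def)

lemma rel_class_hom:
  "rel_class R \<in> ring_hom free_ring (free_ring Quot (Idl\<^bsub>free_ring\<^esub> (R :: ('x list \<Rightarrow>\<^sub>0 'f::comm_ring_1) set)))"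
  using ideal.rcos_ring_hom[OF ideal_Idl[of R]] unfolding rel_class_def .

lemma carrier_presented: "carrier (presented_algebra R) = range (rel_class R)"
  by (auto simp: presented_algebra_def Let_def FactRing_def A_RCOSETS_def RCOSETS_def
      rel_class_def a_r_coset_def free_ring_def)

lemma presented_ops:
  fixes R :: "('x list \<Rightarrow>\<^sub>0 'f::comm_ring_1) set"
  shows presented_mult: "rel_class R p \<otimes>\<^bsub>presented_algebra R\<^esub> rel_class R r = rel_class R (p * r)"
    and presented_add: "rel_class R p \<oplus>\<^bsub>presented_algebra R\<^esub> rel_class R r = rel_class R (p + r)"
    and presented_one: "\<one>\<^bsub>presented_algebra R\<^esub> = rel_class R 1"
    and presented_smult: "c \<odot>\<^bsub>presented_algebra R\<^esub> rel_class R p = rel_class R (free_const c * p)"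
proof -
  have F: "carrier (free_ring :: ('x list \<Rightarrow>\<^sub>0 'f) ring) = UNIV" "p \<otimes>\<^bsub>free_ring\<^esub> r = p * r"
    "p \<oplus>\<^bsub>free_ring\<^esub> r = p + r" "\<one>\<^bsub>free_ring\<^esub> = (1 :: 'x list \<Rightarrow>\<^sub>0 'f)" for p r :: "'x list \<Rightarrow>\<^sub>0 'f"
    by (simp_all add: free_ring_def)
  show "rel_class R p \<otimes>\<^bsub>presented_algebra R\<^esub> rel_class R r = rel_class R (p * r)"
    using ring_hom_mult[OF rel_class_hom[of R], of p r] by (simp add: presented_algebra_def Let_def F)
  show "rel_class R p \<oplus>\<^bsub>presented_algebra R\<^esub> rel_class R r = rel_class R (p + r)"
    using ring_hom_add[OF rel_class_hom[of R], of p r] by (simp add: presented_algebra_def Let_def F)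
  show "\<one>\<^bsub>presented_algebra R\<^esub> = rel_class R 1"
    using ring_hom_one[OF rel_class_hom[of R]] by (simp add: presented_algebra_def Let_def F)
  show "c \<odot>\<^bsub>presented_algebra R\<^esub> rel_class R p = rel_class R (free_const c * p)"
    using ring_hom_mult[OF rel_class_hom[of R], of "free_const c" p] by (simp add: presented_algebra_def Let_def F)
qed

lemma Idl_minimal:
  fixes R :: "('x list \<Rightarrow>\<^sub>0 'f::comm_ring_1) set"
  assumes "R \<subseteq> I" and "0 \<in> I" and "\<And>p r. p \<in> I \<Longrightarrow> r \<in> I \<Longrightarrow> p + r \<in> I" and "\<And>p. p \<in> I \<Longrightarrow> - p \<in> I"
    and "\<And>p r. p \<in> I \<Longrightarrow> r * p \<in> I" and "\<And>p r. p \<in> I \<Longrightarrow> p * r \<in> I"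
  shows "Idl\<^bsub>free_ring\<^esub> R \<subseteq> I"
proof (rule ring.genideal_minimal[OF ring_free _ assms(1)], rule idealI[OF ring_free])
  interpret F: ring "free_ring :: ('x list \<Rightarrow>\<^sub>0 'f) ring" by (rule ring_free)
  show "subgroup I (add_monoid (free_ring :: ('x list \<Rightarrow>\<^sub>0 'f) ring))"
  proof (rule F.add.subgroupI)
    fix p assume "p \<in> I"
    have "\<ominus>\<^bsub>free_ring\<^esub> p = - p" by (rule F.minus_equality) (auto simp: free_ring_def)
    then show "\<ominus>\<^bsub>free_ring\<^esub> p \<in> I" using assms(4) \<open>p \<in> I\<close> by simp
  qed (use assms in \<open>auto simp: free_ring_def\<close>)
qed (use assms in \<open>auto simp: free_ring_def\<close>)

lemma Idl_closed:
  fixes R :: "('x list \<Rightarrow>\<^sub>0 'f::comm_ring_1) set"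
  shows Idl_add: "p \<in> Idl\<^bsub>free_ring\<^esub> R \<Longrightarrow> r \<in> Idl\<^bsub>free_ring\<^esub> R \<Longrightarrow> p + r \<in> Idl\<^bsub>free_ring\<^esub> R"
    and Idl_mult_left: "p \<in> Idl\<^bsub>free_ring\<^esub> R \<Longrightarrow> s * p \<in> Idl\<^bsub>free_ring\<^esub> R"
    and Idl_mult_right: "p \<in> Idl\<^bsub>free_ring\<^esub> R \<Longrightarrow> p * s \<in> Idl\<^bsub>free_ring\<^esub> R"
    and Idl_zero: "0 \<in> Idl\<^bsub>free_ring\<^esub> R"
  using additive_subgroup.a_closed[OF ideal.axioms(1)[OF ideal_Idl[of R]], of p r]
    ideal.I_l_closed[OF ideal_Idl[of R], of p s] ideal.I_r_closed[OF ideal_Idl[of R], of p s]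
    additive_subgroup.zero_closed[OF ideal.axioms(1)[OF ideal_Idl[of R]]]
  by (simp_all add: free_ring_def)

context ambient_space
begin

text \<open>Evaluation of a noncommutative polynomial at a family of operators; its leftmost letter acts last.\<close>

definition ev :: "('x \<Rightarrow> 'b \<Rightarrow> 'b) \<Rightarrow> ('x list \<Rightarrow>\<^sub>0 'a) \<Rightarrow> 'b \<Rightarrow> 'b" where
  "ev g p v = (\<Sum>w\<in>Poly_Mapping.keys p. scale (Poly_Mapping.lookup p w) (foldr g w v))"

lemma ev_eq: "finite W \<Longrightarrow> Poly_Mapping.keys p \<subseteq> W \<Longrightarrow>
    ev g p v = (\<Sum>w\<in>W. scale (Poly_Mapping.lookup p w) (foldr g w v))"
  unfolding ev_def by (rule sum.mono_neutral_left) (auto simp: in_keys_iff)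

lemma ev_single: "ev g (Poly_Mapping.single w c) v = scale c (foldr g w v)"
  by (subst ev_eq[of "{w}"]) auto

lemma ev_add: "ev g (p + r) v = ev g p v + ev g r v"
proof -
  let ?W = "Poly_Mapping.keys p \<union> Poly_Mapping.keys r"
  have "Poly_Mapping.keys (p + r) \<subseteq> ?W" by (rule Poly_Mapping.keys_add)
  then show ?thesis
    by (simp add: ev_eq[of ?W] lookup_add scale_left_distrib sum.distrib)
qed

lemma ev_0: "ev g 0 v = 0"
  by (simp add: ev_def)

lemma ev_uminus: "ev g (- p) v = - ev g p v"
  using ev_add[of g p "- p" v] by (simp add: ev_0 eq_neg_iff_add_eq_0 add.commute)

lemma ev_diff: "ev g (p - r) v = ev g p v - ev g r v"
  using ev_add[of g p "- r" v] by (simp add: ev_uminus)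

lemma ev_sum: "ev g (sum f I) v = (\<Sum>i\<in>I. ev g (f i) v)"
  by (induction I rule: infinite_finite_induct) (auto simp: ev_0 ev_add)

lemma ev_1: "ev g 1 v = v"
  using ev_single[of g "[]" 1 v] by (simp add: single_Nil)

lemma ev_free_gen: "ev g (free_gen x) v = g x v"
  by (simp add: free_gen_def ev_single)

lemma ev_free_const: "ev g (free_const c) v = scale c v"
  by (simp add: free_const_def ev_single)

lemma lin_foldr: "(\<And>x. lin (g x)) \<Longrightarrow> lin (foldr g w)"
proof (induction w)
  case Nil
  show ?case by (simp add: id_def lin_ident)
next
  case (Cons x w)
  then show ?case by (simp add: lin_comp comp_def)
qed

lemma lin_ev: "(\<And>x. lin (g x)) \<Longrightarrow> lin (ev g p)"
  unfolding ev_def[abs_def] by (intro lin_setsum lin_scaled lin_foldr) auto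

lemma ev_mult:
  assumes g: "\<And>x. lin (g x)"
  shows "ev g (p * r) v = ev g p (ev g r v)"
proof -
  have single: "ev g (Poly_Mapping.single w c * r) v = scale c (foldr g w (ev g r v))" for w c
  proof -
    have "ev g (Poly_Mapping.single w c * (\<Sum>u\<in>Poly_Mapping.keys r. Poly_Mapping.single u (Poly_Mapping.lookup r u))) v
        = (\<Sum>u\<in>Poly_Mapping.keys r. scale c (scale (Poly_Mapping.lookup r u) (foldr g w (foldr g u v))))"
      by (simp add: sum_distrib_left ev_sum mult_single ev_single list_monoid foldr_append)
    also have "\<dots> = scale c (foldr g w (ev g r v))"
      by (simp add: ev_def lin_simps[OF lin_foldr[of g, OF g]] scale_sum_right)
    finally show ?thesis by (simp add: poly_mapping_as_sum[of r, symmetric])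
  qed
  have "ev g ((\<Sum>u\<in>Poly_Mapping.keys p. Poly_Mapping.single u (Poly_Mapping.lookup p u)) * r) v
      = (\<Sum>u\<in>Poly_Mapping.keys p. scale (Poly_Mapping.lookup p u) (foldr g u (ev g r v)))"
    by (simp add: sum_distrib_right ev_sum single)
  then show ?thesis by (simp add: ev_def poly_mapping_as_sum[of p, symmetric])
qed

lemma ev_power: "(\<And>x. lin (g x)) \<Longrightarrow> ev g (p ^ n) v = ((ev g p) ^^ n) v"
  by (induction n arbitrary: v) (simp_all add: ev_1 ev_mult)

lemma ev_free_ext:
  assumes g: "\<And>x. lin (g x)"
  shows "ev g (free_ext h p) v = ev (\<lambda>x. ev g (h x)) p v"
proof -
  have "ev g (prod_list (map h w)) v = foldr (\<lambda>x. ev g (h x)) w v" for w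
    by (induction w) (simp_all add: ev_1 ev_mult[OF g])
  then show ?thesis
    by (simp add: free_ext_def ev_sum ev_mult[OF g] ev_free_const ev_def[of "\<lambda>x. ev g (h x)"])
qed

lemma foldr_closed: "(\<And>x. maps_into W (g x)) \<Longrightarrow> v \<in> W \<Longrightarrow> foldr g w v \<in> W"
  by (induction w) (auto simp: maps_into_def)

lemma ev_closed: "subspace W \<Longrightarrow> (\<And>x. maps_into W (g x)) \<Longrightarrow> v \<in> W \<Longrightarrow> ev g p v \<in> W"
  unfolding ev_def by (intro subspace_sum subspace_scale foldr_closed) auto

lemma ev_intertwine:
  assumes V: "subspace V" "\<And>x. maps_into V (g x)" "v \<in> V"
    and add: "\<And>u v. u \<in> V \<Longrightarrow> v \<in> V \<Longrightarrow> f (u + v) = f u + f v"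
    and sc: "\<And>c v. v \<in> V \<Longrightarrow> f (scale c v) = scale c (f v)"
    and com: "\<And>x v. v \<in> V \<Longrightarrow> f (g x v) = g' x (f v)"
  shows "f (ev g p v) = ev g' p (f v)"
proof -
  have f0: "f 0 = 0" using sc[OF subspace_0[OF V(1)], of 0] by simp
  have fsum: "f (\<Sum>i\<in>I. h i) = (\<Sum>i\<in>I. f (h i))" if "\<And>i. i \<in> I \<Longrightarrow> h i \<in> V" for I :: "'c list set" and h
    using that by (induction I rule: infinite_finite_induct) (auto simp: f0 add subspace_sum[OF V(1)])
  have fold: "f (foldr g w v) = foldr g' w (f v)" for w
    by (induction w) (auto simp: com foldr_closed[OF V(2,3)])
  show ?thesis
    unfolding ev_def
    by (subst fsum) (auto simp: sc fold foldr_closed[OF V(2,3)] subspace_scale[OF V(1)])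
qed

text \<open>
  A family of linear maps for the generators determines a module. The maps are linear on the
  whole ambient space and take values in the underlying space, so that no membership conditions
  arise in computations.
\<close>

definition acts_by ::
    "('x list \<Rightarrow>\<^sub>0 'a) set \<Rightarrow> (('x list \<Rightarrow>\<^sub>0 'a) set, 'b) alg_mod \<Rightarrow> ('x \<Rightarrow> 'b \<Rightarrow> 'b) \<Rightarrow> bool" where
  "acts_by R M g \<longleftrightarrow> subspace (fst M) \<and> (\<forall>x. lin (g x)) \<and> (\<forall>x v. g x v \<in> fst M) \<and>
     (\<forall>r\<in>R. \<forall>v\<in>fst M. ev g r v = 0) \<and> (\<forall>p. \<forall>v\<in>fst M. snd M (rel_class R p) v = ev g p v)"

lemma acts_byD:
  assumes "acts_by R M g"
  shows "subspace (fst M)" "lin (g x)" "g x v \<in> fst M" "maps_into (fst M) (g x)"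
    "r \<in> R \<Longrightarrow> u \<in> fst M \<Longrightarrow> ev g r u = 0"
    "u \<in> fst M \<Longrightarrow> snd M (rel_class R p) u = ev g p u"
    "u \<in> fst M \<Longrightarrow> ev g p u \<in> fst M"
  using assms ev_closed[of "fst M" g u p] by (auto simp: acts_by_def maps_into_def)

lemma ev_Idl:
  assumes sub: "subspace V" and lin: "\<And>x. lin (g x)" and cl: "\<And>x. maps_into V (g x)"
    and rel: "\<And>r v. r \<in> R \<Longrightarrow> v \<in> V \<Longrightarrow> ev g r v = 0"
    and p: "p \<in> Idl\<^bsub>free_ring\<^esub> R" and v: "v \<in> V"
  shows "ev g p v = 0"
proof -
  have "Idl\<^bsub>free_ring\<^esub> R \<subseteq> {p. \<forall>v\<in>V. ev g p v = 0}"
    by (rule Idl_minimal)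
       (auto simp: rel ev_0 ev_add ev_uminus ev_mult[OF lin] lin_zero[OF lin_ev[of g, OF lin]] ev_closed[OF sub cl])
  then show ?thesis using p v by auto
qed

lemma acts_by_imp_alg_module:
  assumes "acts_by R M g"
  shows "alg_module (presented_algebra R) M"
proof -
  obtain V act where M: "M = (V, act)" by (cases M)
  note D = acts_byD[OF assms, unfolded M fst_conv snd_conv]
  note L = lin_simps[OF lin_ev[of g, OF D(2)]]
  show ?thesis
    unfolding alg_module_def M carrier_presented
    using D(1) by (auto simp: D(6,7) L presented_ops ev_add ev_mult[OF D(2)] ev_free_const ev_1
        subspace_add subspace_scale)
qed

text \<open>
  The action of a module is given only on its underlying space; composing it with a projection onto
  that space yields operators on the ambient space.
\<close>

lemma alg_module_imp_acts_by:
  assumes "alg_module (presented_algebra R) M"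
  shows "\<exists>g. acts_by R M g"
proof -
  obtain V act where M: "M = (V, act)" by (cases M)
  define \<rho> where "\<rho> p = act (rel_class R p)" for p
  have V: "subspace V" and cl: "\<And>p v. v \<in> V \<Longrightarrow> \<rho> p v \<in> V"
    and vadd: "\<And>p u v. u \<in> V \<Longrightarrow> v \<in> V \<Longrightarrow> \<rho> p (u + v) = \<rho> p u + \<rho> p v"
    and vscale: "\<And>p c v. v \<in> V \<Longrightarrow> \<rho> p (scale c v) = scale c (\<rho> p v)"
    and padd: "\<And>p r v. v \<in> V \<Longrightarrow> \<rho> (p + r) v = \<rho> p v + \<rho> r v"
    and pmult: "\<And>p r v. v \<in> V \<Longrightarrow> \<rho> (p * r) v = \<rho> p (\<rho> r v)"
    and pone: "\<And>v. v \<in> V \<Longrightarrow> \<rho> 1 v = v"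
    using assms unfolding alg_module_def M carrier_presented \<rho>_def
    by (auto simp flip: presented_add presented_mult presented_one)
  have pscale: "\<rho> (free_const c * p) v = scale c (\<rho> p v)" if "v \<in> V" for c p v
    using assms that unfolding alg_module_def M carrier_presented \<rho>_def by (auto simp: presented_smult)
  obtain \<pi> where \<pi>: "lin \<pi>" "\<And>v. \<pi> v \<in> V" "\<And>v. v \<in> V \<Longrightarrow> \<pi> v = v"
    using exists_projection[OF V] by blast
  define g where "g x v = \<rho> (free_gen x) (\<pi> v)" for x v
  have lin: "lin (g x)" for x
    by (simp add: lin_def g_def lin_simps[OF \<pi>(1)] vadd vscale \<pi>(2))
  have gV: "g x v \<in> V" for x v by (simp add: g_def cl \<pi>(2))
  have word: "\<rho> (Poly_Mapping.single w 1) v = foldr g w v" if "v \<in> V" for w v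
    using that
  proof (induction w)
    case Nil
    then show ?case using pone by (simp add: single_Nil)
  next
    case (Cons x w)
    have "Poly_Mapping.single (x # w) (1::'a) = free_gen x * Poly_Mapping.single w 1"
      by (simp add: free_gen_def mult_single list_monoid)
    moreover have "foldr g w v \<in> V"
      using Cons gV by (intro foldr_closed) (auto simp: maps_into_def)
    ultimately show ?case using Cons by (simp add: pmult g_def[of x] \<pi>(3))
  qed
  have zero: "\<rho> 0 v = 0" if "v \<in> V" for v
    using padd[OF that, of 0 0] by simp
  have \<rho>sum: "\<rho> (sum f I) v = (\<Sum>i\<in>I. \<rho> (f i) v)" if "v \<in> V" for f and I :: "'c list set" and v
    by (induction I rule: infinite_finite_induct) (auto simp: zero padd that)
  have ev: "\<rho> p v = ev g p v" if "v \<in> V" for p v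
  proof -
    have "\<rho> p v = (\<Sum>w\<in>Poly_Mapping.keys p. \<rho> (free_const (Poly_Mapping.lookup p w) * Poly_Mapping.single w 1) v)"
      by (subst poly_mapping_as_sum[of p]) (simp add: \<rho>sum that free_const_mult_single)
    then show ?thesis by (simp add: ev_def pscale word that)
  qed
  have "ev g r v = 0" if "r \<in> R" "v \<in> V" for r v
  proof -
    have "r - 0 \<in> Idl\<^bsub>free_ring\<^esub> R" using Idl_generators that by auto
    then have "rel_class R r = rel_class R 0" by (simp only: rel_class_eq_iff)
    then show ?thesis using ev[OF that(2), of r] zero[OF that(2)] by (simp add: \<rho>_def)
  qed
  then have "acts_by R M g"
    unfolding acts_by_def M using V lin gV ev by (auto simp: \<rho>_def)
  then show ?thesis by blast
qed

lemma irreducible_iff: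
  assumes "acts_by R M g"
  shows "irreducible_module (presented_algebra R) M \<longleftrightarrow> fst M \<noteq> {0} \<and>
    (\<forall>W. subspace W \<and> W \<subseteq> fst M \<and> (\<forall>x. maps_into W (g x)) \<longrightarrow> W = {0} \<or> W = fst M)"
proof -
  obtain V act where M: "M = (V, act)" by (cases M)
  note D = acts_byD[OF assms, unfolded M fst_conv snd_conv]
  have "(\<forall>a\<in>carrier (presented_algebra R). \<forall>w\<in>W. act a w \<in> W) \<longleftrightarrow> (\<forall>x. maps_into W (g x))"
    if W: "subspace W" "W \<subseteq> V" for W
  proof
    assume L: "\<forall>a\<in>carrier (presented_algebra R). \<forall>w\<in>W. act a w \<in> W"
    show "\<forall>x. maps_into W (g x)"
      unfolding maps_into_def
    proof (intro allI ballI)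
      fix x v assume v: "v \<in> W"
      then have "act (rel_class R (free_gen x)) v = g x v" using W D(6) by (auto simp: ev_free_gen)
      moreover have "act (rel_class R (free_gen x)) v \<in> W" using L v by (auto simp: carrier_presented)
      ultimately show "g x v \<in> W" by simp
    qed
  next
    assume "\<forall>x. maps_into W (g x)"
    then show "\<forall>a\<in>carrier (presented_algebra R). \<forall>w\<in>W. act a w \<in> W"
      using W D(6) ev_closed[OF W(1), of g] by (auto simp: carrier_presented subset_iff)
  qed
  then have "(subspace W \<and> W \<subseteq> V \<and> (\<forall>a\<in>carrier (presented_algebra R). \<forall>w\<in>W. act a w \<in> W) \<longrightarrow> W = {0} \<or> W = V)
      \<longleftrightarrow> (subspace W \<and> W \<subseteq> V \<and> (\<forall>x. maps_into W (g x)) \<longrightarrow> W = {0} \<or> W = V)" for W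
    by metis
  then show ?thesis
    using acts_by_imp_alg_module[OF assms] unfolding irreducible_module_def M by simp
qed

lemma module_iso_iff:
  assumes M: "acts_by R M g" and N: "acts_by R N g'"
  shows "module_iso (presented_algebra R) M N \<longleftrightarrow> (\<exists>f. bij_betw f (fst M) (fst N) \<and>
     (\<forall>u\<in>fst M. \<forall>v\<in>fst M. f (u + v) = f u + f v) \<and>
     (\<forall>c. \<forall>v\<in>fst M. f (scale c v) = scale c (f v)) \<and>
     (\<forall>x. \<forall>v\<in>fst M. f (g x v) = g' x (f v)))"
proof -
  note DM = acts_byD[OF M] and DN = acts_byD[OF N]
  have "(\<forall>a\<in>carrier (presented_algebra R). \<forall>v\<in>fst M. f (snd M a v) = snd N a (f v)) \<longleftrightarrow>
        (\<forall>x. \<forall>v\<in>fst M. f (g x v) = g' x (f v))"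
    if f: "bij_betw f (fst M) (fst N)" "\<forall>u\<in>fst M. \<forall>v\<in>fst M. f (u + v) = f u + f v"
      "\<forall>c. \<forall>v\<in>fst M. f (scale c v) = scale c (f v)" for f
  proof -
    have fN: "v \<in> fst M \<Longrightarrow> f v \<in> fst N" for v using f(1) by (auto simp: bij_betw_def)
    have "(\<forall>a\<in>carrier (presented_algebra R). \<forall>v\<in>fst M. f (snd M a v) = snd N a (f v)) \<longleftrightarrow>
        (\<forall>p. \<forall>v\<in>fst M. f (ev g p v) = ev g' p (f v))"
      by (auto simp: carrier_presented DM(6) DN(6) fN)
    also have "\<dots> \<longleftrightarrow> (\<forall>x. \<forall>v\<in>fst M. f (g x v) = g' x (f v))"
    proof
      assume *: "\<forall>p. \<forall>v\<in>fst M. f (ev g p v) = ev g' p (f v)"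
      show "\<forall>x. \<forall>v\<in>fst M. f (g x v) = g' x (f v)"
        using *[rule_format, of _ "free_gen _"] by (simp add: ev_free_gen)
    next
      assume "\<forall>x. \<forall>v\<in>fst M. f (g x v) = g' x (f v)"
      then show "\<forall>p. \<forall>v\<in>fst M. f (ev g p v) = ev g' p (f v)"
        using ev_intertwine[OF DM(1,4), where f = f and g' = g'] f(2,3) by auto
    qed
    finally show ?thesis .
  qed
  then show ?thesis unfolding module_iso_def by blast
qed

lemma module_iso_refl: "module_iso A M M"
  unfolding module_iso_def by (rule exI[of _ "\<lambda>v. v"]) (auto simp: bij_betw_def)

lemma module_iso_sym:
  assumes M: "alg_module A M" and iso: "module_iso A M N"
  shows "module_iso A N M"
proof -
  obtain f where f: "bij_betw f (fst M) (fst N)"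
    and add: "\<And>u v. u \<in> fst M \<Longrightarrow> v \<in> fst M \<Longrightarrow> f (u + v) = f u + f v"
    and sc: "\<And>c v. v \<in> fst M \<Longrightarrow> f (scale c v) = scale c (f v)"
    and act: "\<And>a v. a \<in> carrier A \<Longrightarrow> v \<in> fst M \<Longrightarrow> f (snd M a v) = snd N a (f v)"
    using iso unfolding module_iso_def by blast
  have sub: "subspace (fst M)" and cl: "\<And>a v. a \<in> carrier A \<Longrightarrow> v \<in> fst M \<Longrightarrow> snd M a v \<in> fst M"
    using M by (auto simp: alg_module_def split: prod.splits)
  let ?h = "inv_into (fst M) f"
  have h: "?h w \<in> fst M" "f (?h w) = w" if "w \<in> fst N" for w
    using that f by (auto simp: bij_betw_def inv_into_into f_inv_into_f)
  have hf: "?h (f v) = v" if "v \<in> fst M" for v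
    using that f by (auto simp: bij_betw_def)
  have "?h (u + v) = ?h u + ?h v" if "u \<in> fst N" "v \<in> fst N" for u v
    using add[of "?h u" "?h v"] h that hf[of "?h u + ?h v"] subspace_add[OF sub] by metis
  moreover have "?h (scale c v) = scale c (?h v)" if "v \<in> fst N" for c v
    using sc[of "?h v"] h that hf[of "scale c (?h v)"] subspace_scale[OF sub] by metis
  moreover have "?h (snd N a v) = snd M a (?h v)" if "a \<in> carrier A" "v \<in> fst N" for a v
    using act[of a "?h v"] h that hf[of "snd M a (?h v)"] cl by metis
  ultimately show ?thesis
    unfolding module_iso_def using bij_betw_inv_into[OF f] by blast
qed

lemma module_iso_trans:
  assumes "module_iso A M N" "module_iso A N P"
  shows "module_iso A M P"
proof -
  obtain f h where f: "bij_betw f (fst M) (fst N)"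
    "\<forall>u\<in>fst M. \<forall>v\<in>fst M. f (u + v) = f u + f v" "\<forall>c. \<forall>v\<in>fst M. f (scale c v) = scale c (f v)"
    "\<forall>a\<in>carrier A. \<forall>v\<in>fst M. f (snd M a v) = snd N a (f v)"
    and h: "bij_betw h (fst N) (fst P)"
    "\<forall>u\<in>fst N. \<forall>v\<in>fst N. h (u + v) = h u + h v" "\<forall>c. \<forall>v\<in>fst N. h (scale c v) = scale c (h v)"
    "\<forall>a\<in>carrier A. \<forall>v\<in>fst N. h (snd N a v) = snd P a (h v)"
    using assms unfolding module_iso_def by blast
  have fN: "v \<in> fst M \<Longrightarrow> f v \<in> fst N" for v using f(1) by (auto simp: bij_betw_def)
  show ?thesis
    unfolding module_iso_def using f h bij_betw_trans[OF f(1) h(1)] fN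
    by (intro exI[of _ "h \<circ> f"]) auto
qed

lemma equiv_iso_rel:
  assumes "\<And>M. M \<in> S \<Longrightarrow> alg_module A M"
  shows "equiv S (iso_rel A S)"
  using assms module_iso_refl module_iso_sym module_iso_trans
  by (intro equivI refl_onI symI transI) (auto simp: iso_rel_def, blast+)

end

text \<open>
  The presented algebra acts faithfully on itself: realise it on a linear complement of the ideal.
  So an element of the free algebra lies in the ideal as soon as it acts as zero on every module.
\<close>

lemma ambient_free: "ambient_space (\<lambda>c (p :: 'x list \<Rightarrow>\<^sub>0 'f::field). free_const c * p)"
  unfolding ambient_space_def
  by unfold_locales
     (auto simp: algebra_simps free_const_def mult_single single_add list_monoid single_Nil simp flip: mult.assoc)

lemma in_Idl_if_acts_as_zero:
  fixes R :: "('x list \<Rightarrow>\<^sub>0 'f::field) set"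
  assumes zero: "\<And>V g (v :: 'x list \<Rightarrow>\<^sub>0 'f).
      module.subspace (\<lambda>c p. free_const c * p) V \<Longrightarrow>
      (\<And>x. ambient_space.lin (\<lambda>c p. free_const c * p) (g x)) \<Longrightarrow> (\<And>x v. g x v \<in> V) \<Longrightarrow>
      (\<And>r v. r \<in> R \<Longrightarrow> v \<in> V \<Longrightarrow> ambient_space.ev (\<lambda>c p. free_const c * p) g r v = 0) \<Longrightarrow>
      v \<in> V \<Longrightarrow> ambient_space.ev (\<lambda>c p. free_const c * p) g p v = 0"
  shows "p \<in> Idl\<^bsub>free_ring\<^esub> R"
proof -
  let ?s = "\<lambda>c (p :: 'x list \<Rightarrow>\<^sub>0 'f). free_const c * p"
  interpret A: ambient_space ?s by (rule ambient_free)
  let ?I = "Idl\<^bsub>free_ring\<^esub> R"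
  have I: "A.subspace ?I" by (simp add: A.subspace_def Idl_closed)
  obtain \<pi> where \<pi>: "A.lin \<pi>" "\<And>v. \<pi> v \<in> ?I" "\<And>v. v \<in> ?I \<Longrightarrow> \<pi> v = v"
    using A.exists_projection[OF I] by blast
  define \<kappa> where "\<kappa> v = v - \<pi> v" for v
  have \<kappa>: "A.lin \<kappa>" unfolding \<kappa>_def by (intro A.lin_minus A.lin_ident \<pi>(1))
  have \<kappa>_ker: "\<kappa> v = 0 \<longleftrightarrow> v \<in> ?I" for v
    using \<pi>(2,3)[of v] by (metis \<kappa>_def eq_iff_diff_eq_0)
  have \<kappa>_cong: "\<kappa> (s * \<kappa> v) = \<kappa> (s * v)" for s v
  proof -
    have "\<kappa> (s * \<pi> v) = 0" using \<pi>(2) by (simp add: \<kappa>_ker Idl_mult_left)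
    then show ?thesis by (simp add: \<kappa>_def[of v] right_diff_distrib A.lin_diff[OF \<kappa>])
  qed
  define g where "g x v = \<kappa> (free_gen x * v)" for x v
  have lin: "A.lin (g x)" for x
    by (simp add: A.lin_def g_def distrib_left A.lin_add[OF \<kappa>] flip: A.lin_scale[OF \<kappa>] mult.assoc)
       (simp add: free_gen_def free_const_def mult_single list_monoid)
  have foldr: "foldr g w (\<kappa> v) = \<kappa> (Poly_Mapping.single w 1 * v)" for w v
  proof (induction w)
    case Nil
    show ?case by (simp add: single_Nil)
  next
    case (Cons x w)
    have "Poly_Mapping.single (x # w) (1::'f) = free_gen x * Poly_Mapping.single w 1"
      by (simp add: free_gen_def mult_single list_monoid)
    then show ?case by (simp add: Cons g_def[of x] \<kappa>_cong mult.assoc)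
  qed
  have ev: "A.ev g r (\<kappa> v) = \<kappa> (r * v)" for r v
  proof -
    have "\<kappa> (r * v) = (\<Sum>w\<in>Poly_Mapping.keys r. \<kappa> (?s (Poly_Mapping.lookup r w) (Poly_Mapping.single w 1 * v)))"
      by (subst poly_mapping_as_sum[of r])
         (simp add: sum_distrib_right A.lin_sum[OF \<kappa>] free_const_mult_single flip: mult.assoc)
    then show ?thesis by (simp add: A.ev_def foldr A.lin_scale[OF \<kappa>])
  qed
  have V: "A.subspace (range \<kappa>)"
    unfolding A.subspace_def
    by (auto simp flip: A.lin_add[OF \<kappa>] A.lin_scale[OF \<kappa>] intro: range_eqI[of _ _ 0] simp: A.lin_zero[OF \<kappa>])
  have "A.ev g p (\<kappa> 1) = 0"
  proof (rule zero[OF V lin])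
    show "g x v \<in> range \<kappa>" for x v by (simp add: g_def)
    show "A.ev g r v = 0" if "r \<in> R" "v \<in> range \<kappa>" for r v
      using that Idl_generators[of R] by (auto simp: ev \<kappa>_ker Idl_mult_right)
  qed simp
  then show ?thesis by (simp add: ev \<kappa>_ker)
qed


section \<open>The homomorphism \<open>\<psi>\<close>\<close>

lemma uq_rels_mem:
  shows "kk i * ki i - 1 \<in> uq_rels q" "ki i * kk i - 1 \<in> uq_rels q"
    "kk 0 * kk 1 - 1 \<in> uq_rels q" "kk 1 * kk 0 - 1 \<in> uq_rels q"
    "kk i * ep i * ki i - free_const (q powi 2) * ep i \<in> uq_rels q"
    "kk i * em i * ki i - free_const (q powi (-2)) * em i \<in> uq_rels q"
    "i \<noteq> j \<Longrightarrow> kk i * ep j * ki i - free_const (q powi (-2)) * ep j \<in> uq_rels q"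
    "i \<noteq> j \<Longrightarrow> kk i * em j * ki i - free_const (q powi 2) * em j \<in> uq_rels q"
    "ep i * em i - em i * ep i - free_const (1 / (q - inverse q)) * (kk i - ki i) \<in> uq_rels q"
    "ep 0 * em 1 - em 1 * ep 0 \<in> uq_rels q" "em 0 * ep 1 - ep 1 * em 0 \<in> uq_rels q"
    "i \<noteq> j \<Longrightarrow> serre q (ep i) (ep j) \<in> uq_rels q" "i \<noteq> j \<Longrightarrow> serre q (em i) (em j) \<in> uq_rels q"
  unfolding uq_rels_def Un_iff mem_Collect_eq insert_iff
  by metis+

lemma four_eq_zero: "(4::4) = 0" "(5::4) = 1"
  by simp_all

lemma mem_rel_class: "p' \<in> rel_class R p \<longleftrightarrow> p' - p \<in> Idl\<^bsub>free_ring\<^esub> (R :: ('x list \<Rightarrow>\<^sub>0 'f::comm_ring_1) set)"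
proof -
  have "h \<oplus>\<^bsub>free_ring\<^esub> r = h + r" for h r :: "'x list \<Rightarrow>\<^sub>0 'f" by (simp add: free_ring_def)
  then show ?thesis by (auto simp: rel_class_def a_r_coset_def' intro: bexI[of _ "p' - p"])
qed

lemma exhaust_2: "(i::2) = 0 \<or> i = 1"
proof (induct i)
  case (of_int z)
  then have "z = 0 \<or> z = 1" by auto
  then show ?case by auto
qed

lemma exhaust_4: "(i::4) = 0 \<or> i = 1 \<or> i = 2 \<or> i = 3"
proof (induct i)
  case (of_int z)
  then have "z = 0 \<or> z = 1 \<or> z = 2 \<or> z = 3" by auto
  then show ?case by auto
qed

locale q_space = ambient_space scale
  for scale :: "'a::field \<Rightarrow> 'b::ab_group_add \<Rightarrow> 'b" +
  fixes q :: 'a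
  assumes q_nonzero: "q \<noteq> 0" and q_not_root: "\<And>n. 0 < n \<Longrightarrow> q ^ n \<noteq> 1"
    and closed_field: "\<And>p::'a poly. 0 < degree p \<Longrightarrow> \<exists>x. poly p x = 0"
begin

abbreviation qd :: 'a where "qd \<equiv> q - inverse q"

lemma qd_nonzero: "qd \<noteq> 0"
proof
  assume "qd = 0"
  then have "q ^ 2 = 1" using q_nonzero by (simp add: power2_eq_square field_simps)
  then show False using q_not_root[of 2] by simp
qed

lemma powi_inject: "q powi m = q powi n \<longleftrightarrow> m = n"
proof
  have neq: "q powi k \<noteq> 1" if "0 < k" for k :: int
    using q_not_root[of "nat k"] that by (simp add: power_int_def)
  have less: "q powi m \<noteq> q powi n" if "m < n" for m n :: int
  proof
    assume "q powi m = q powi n"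
    then have "q powi (n - m) = 1" using q_nonzero by (simp add: power_int_diff)
    then show False using neq[of "n - m"] that by simp
  qed
  assume "q powi m = q powi n"
  then show "m = n" using less[of m n] less[of n m] by (metis linorder_less_linear)
qed simp

lemma qnum_3: "qnum q 3 = q powi 2 + 1 + q powi (-2)"
proof -
  have "(q powi 2 + 1 + q powi (-2)) * qd = q powi 3 - q powi (-3)"
    using q_nonzero by (simp add: power_int_def field_simps power2_eq_square power3_eq_cube)
  then show ?thesis using qd_nonzero by (simp add: qnum_def field_simps)
qed

definition qweyl :: "'b set \<Rightarrow> ('b \<Rightarrow> 'b) \<Rightarrow> ('b \<Rightarrow> 'b) \<Rightarrow> bool" where
  "qweyl V x y \<longleftrightarrow> (\<forall>v\<in>V. scale q (x (y v)) - scale (inverse q) (y (x v)) = scale qd v)"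

definition qserre :: "'b set \<Rightarrow> ('b \<Rightarrow> 'b) \<Rightarrow> ('b \<Rightarrow> 'b) \<Rightarrow> bool" where
  "qserre V x y \<longleftrightarrow> (\<forall>v\<in>V. x (x (x (y v))) - scale (qnum q 3) (x (x (y (x v))))
     + scale (qnum q 3) (x (y (x (x v)))) - y (x (x (x v))) = 0)"

text \<open>
  With \<open>L\<close> and \<open>R\<close> the left and right multiplication by \<open>x\<close>, the \<open>q\<close>-Serre expression is
  \<open>(L - q\<^sup>2 R) (L - R) (L - q\<^sup>-\<^sup>2 R) y\<close>, and the three factors commute.
\<close>

lemma qserre_factored:
  assumes x: "lin x" and s: "s * s' = 1" "s + 1 + s' = qnum q 3"
    and z1: "\<And>v. z1 v = x (y v) - scale s (y (x v))"
    and z2: "\<And>v. z2 v = x (z1 v) - z1 (x v)"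
  shows "x (z2 v) - scale s' (z2 (x v)) = x (x (x (y v))) - scale (qnum q 3) (x (x (y (x v))))
     + scale (qnum q 3) (x (y (x (x v)))) - y (x (x (x v)))"
proof -
  have s2: "s' * s = 1" using s(1) by (simp add: mult.commute)
  show ?thesis
    unfolding s(2)[symmetric]
    by (simp add: z1 z2 lin_simps[OF x] scale_right_diff_distrib scale_left_distrib s2)
qed

text \<open>
  The operators of \<open>\<psi>(x\<^sub>i)\<close> and \<open>\<psi>(x\<^sub>i\<^sub>+\<^sub>2)\<close> have the form \<open>k - ce\<close> and \<open>k' - ce'\<close> with \<open>k'\<close> inverse to \<open>k\<close>.
  The \<open>q\<close>-Serre expression is linear in the second argument. Its value at \<open>k'\<close> vanishes because the factor for \<open>s\<close> already
  turns \<open>k'\<close> into a multiple of the identity, and at \<open>e'\<close> the terms with \<open>k\<close> cancel one factor at a time, which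
  leaves a multiple of the expression for \<open>(e, e')\<close>.
\<close>

lemma qserre_shifted:
  assumes sub: "subspace V" and lin: "lin k" "lin k'" "lin e" "lin e'"
    and cl: "\<And>v. k v \<in> V" "\<And>v. k' v \<in> V" "\<And>v. e v \<in> V" "\<And>v. e' v \<in> V"
    and s: "s * s' = 1" "s + 1 + s' = qnum q 3"
    and kk': "\<And>v. v \<in> V \<Longrightarrow> k (k' v) = v" "\<And>v. v \<in> V \<Longrightarrow> k' (k v) = v"
    and ke: "\<And>v. v \<in> V \<Longrightarrow> k (e v) = scale s (e (k v))"
    and ke': "\<And>v. v \<in> V \<Longrightarrow> k (e' v) = scale s' (e' (k v))"
    and c: "c \<noteq> 0"
  shows "qserre V (\<lambda>v. k v - scale c (e v)) (\<lambda>v. k' v - scale c (e' v)) \<longleftrightarrow> qserre V e e'"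
proof -
  have s'2: "s' * s = 1" "s' + 1 + s = qnum q 3" using s by (simp_all add: algebra_simps)
  have ss: "s * (s' * t) = t" "s' * (s * t) = t" for t
    using s(1) s'2(1) by (simp_all flip: mult.assoc)
  note L = lin_simps[OF lin(1)] lin_simps[OF lin(2)] lin_simps[OF lin(3)] lin_simps[OF lin(4)]
  note cl' = cl subspace_diff[OF sub] subspace_scale[OF sub] subspace_add[OF sub]
  define x where "x v = k v - scale c (e v)" for v
  have x: "lin x" unfolding x_def by (intro lin_minus lin_scaled lin)
  have ek': "e (k' v) = scale s (k' (e v))" if "v \<in> V" for v
  proof -
    have "k' (k (e (k' v))) = k' (scale s (e (k (k' v))))" using ke cl by simp
    then show ?thesis using kk' cl that by (simp add: L)
  qed
  have 1: "x (x (x (k' v))) - scale (qnum q 3) (x (x (k' (x v))))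
      + scale (qnum q 3) (x (k' (x (x v)))) - k' (x (x (x v))) = 0" if v: "v \<in> V" for v
  proof -
    define z1 where "z1 v = x (k' v) - scale s (k' (x v))" for v
    define z2 where "z2 v = x (z1 v) - z1 (x v)" for v
    have z1: "z1 v = scale (1 - s) v" if "v \<in> V" for v
      using that by (simp add: z1_def x_def L kk' ek' scale_right_diff_distrib scale_left_diff_distrib mult.commute)
    have xV: "x v \<in> V" for v by (simp add: x_def cl')
    have "z2 v = 0" if "v \<in> V" for v using that xV by (simp add: z2_def z1 lin_simps[OF x])
    then have "x (z2 v) - scale s' (z2 (x v)) = 0" using v xV by (simp add: lin_simps[OF x])
    then show ?thesis using qserre_factored[where y = k' and ?z1.0 = z1 and ?z2.0 = z2, OF x s z1_def z2_def] by simp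
  qed
  have 2: "x (x (x (e' v))) - scale (qnum q 3) (x (x (e' (x v))))
      + scale (qnum q 3) (x (e' (x (x v)))) - e' (x (x (x v)))
      = scale (- (c * c * c)) (e (e (e (e' v))) - scale (qnum q 3) (e (e (e' (e v))))
      + scale (qnum q 3) (e (e' (e (e v)))) - e' (e (e (e v))))" if v: "v \<in> V" for v
  proof -
    define z1 where "z1 v = x (e' v) - scale s' (e' (x v))" for v
    define z2 where "z2 v = x (z1 v) - z1 (x v)" for v
    define y1 where "y1 v = e (e' v) - scale s' (e' (e v))" for v
    define y2 where "y2 v = e (y1 v) - y1 (e v)" for v
    have xV: "x v \<in> V" for v by (simp add: x_def cl')
    have y1V: "y1 v \<in> V" for v by (simp add: y1_def cl')
    have y2V: "y2 v \<in> V" for v by (simp add: y2_def cl' y1V)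
    have ly1: "lin y1" unfolding y1_def by (intro lin_minus lin_scaled lin_comp[OF lin(3)] lin_comp[OF lin(4)] lin)
    have ly2: "lin y2" unfolding y2_def by (intro lin_minus lin_comp[OF lin(3)] lin_comp[OF ly1] ly1 lin)
    have ky1: "k (y1 v) = y1 (k v)" if "v \<in> V" for v
      using that by (simp add: y1_def L ke ke' cl' s(1) ss mult.commute)
    have ky2: "k (y2 v) = scale s (y2 (k v))" if "v \<in> V" for v
      using that by (simp add: y2_def L ke ky1 cl' y1V lin_simps[OF ly1] scale_right_diff_distrib)
    have z1: "z1 v = scale (- c) (y1 v)" if "v \<in> V" for v
      using that by (simp add: z1_def y1_def x_def L ke' scale_right_diff_distrib mult.commute)
    have z2: "z2 v = scale (c * c) (y2 v)" if "v \<in> V" for v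
      using that by (simp add: z2_def z1 xV) (simp add: x_def y2_def L ky1 lin_simps[OF ly1] scale_right_diff_distrib)
    have "x (z2 v) - scale s (z2 (x v)) = scale (c * c) (x (y2 v) - scale s (y2 (x v)))"
      using v by (simp add: z2 xV lin_simps[OF x] scale_right_diff_distrib mult.commute mult.left_commute)
    also have "x (y2 v) - scale s (y2 (x v)) = scale (- c) (e (y2 v) - scale s (y2 (e v)))"
      using v by (simp add: x_def ky2 lin_simps[OF ly2] scale_right_diff_distrib mult.commute)
    also have "e (y2 v) - scale s (y2 (e v)) = e (e (e (e' v))) - scale (qnum q 3) (e (e (e' (e v))))
      + scale (qnum q 3) (e (e' (e (e v)))) - e' (e (e (e v)))"
      by (rule qserre_factored[where y = e' and ?z1.0 = y1 and ?z2.0 = y2, OF lin(3) s'2 y1_def y2_def])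
    finally have "x (z2 v) - scale s (z2 (x v)) = scale (c * c) (scale (- c) (e (e (e (e' v))) - scale (qnum q 3) (e (e (e' (e v))))
      + scale (qnum q 3) (e (e' (e (e v)))) - e' (e (e (e v)))))" .
    then show ?thesis
      using qserre_factored[where y = e' and ?z1.0 = z1 and ?z2.0 = z2, OF x s'2 z1_def z2_def, of v]
      by (simp only: scale_scale mult_minus_right)
  qed
  have "x (x (x (k' v - scale c (e' v)))) - scale (qnum q 3) (x (x (k' (x v) - scale c (e' (x v)))))
      + scale (qnum q 3) (x (k' (x (x v)) - scale c (e' (x (x v))))) - (k' (x (x (x v))) - scale c (e' (x (x (x v)))))
      = scale (c * c * c * c) (e (e (e (e' v))) - scale (qnum q 3) (e (e (e' (e v))))
      + scale (qnum q 3) (e (e' (e (e v)))) - e' (e (e (e v))))" (is "?l v = scale _ (?r v)")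
    if "v \<in> V" for v
  proof -
    have "?l v
      = (x (x (x (k' v))) - scale (qnum q 3) (x (x (k' (x v))))
      + scale (qnum q 3) (x (k' (x (x v)))) - k' (x (x (x v))))
      - scale c (x (x (x (e' v))) - scale (qnum q 3) (x (x (e' (x v))))
      + scale (qnum q 3) (x (e' (x (x v)))) - e' (x (x (x v))))"
      by (simp add: lin_simps[OF x] scale_right_diff_distrib scale_right_distrib mult.commute algebra_simps)
    then show ?thesis
      unfolding 1[OF that] 2[OF that] by (simp only: scale_scale diff_0 scale_minus_left[symmetric]) (simp add: mult.assoc)
  qed
  then show ?thesis using c unfolding qserre_def x_def by simp
qed

end

text \<open>
  The operators of a \<open>U\<^sub>q(L(sl\<^sub>2))\<close>-module. In terms of the generators,
  \<open>K = K\<^sub>0\<close>, \<open>Ki = K\<^sub>1\<close>, \<open>A = e\<^sub>0\<^sup>+\<close>, \<open>a = e\<^sub>1\<^sup>+\<close>, \<open>B = e\<^sub>1\<^sup>-\<close>, \<open>b = e\<^sub>0\<^sup>-\<close>: the operators \<open>A\<close> and \<open>B\<close> raise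
  the weight, \<open>a\<close> and \<open>b\<close> lower it. This locale contains only the relations that involve \<open>K\<close> and \<open>Ki\<close>,
  which suffice to translate every other relation into one for the operators \<open>X i\<close> below.
  Exchanging the indices \<open>0\<close> and \<open>1\<close> exchanges
  \<open>K\<close> with \<open>Ki\<close>, \<open>A\<close> with \<open>a\<close> and \<open>B\<close> with \<open>b\<close>.
\<close>

locale uq_pre = q_space scale q
  for scale :: "'a::field \<Rightarrow> 'b::ab_group_add \<Rightarrow> 'b" and q :: 'a +
  fixes V :: "'b set" and K Ki A a B b :: "'b \<Rightarrow> 'b"
  assumes sub: "subspace V"
    and lin: "lin K" "lin Ki" "lin A" "lin a" "lin B" "lin b"
    and inV: "\<And>v. K v \<in> V" "\<And>v. Ki v \<in> V" "\<And>v. A v \<in> V" "\<And>v. a v \<in> V" "\<And>v. B v \<in> V" "\<And>v. b v \<in> V"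
    and KKi: "\<And>v. v \<in> V \<Longrightarrow> K (Ki v) = v" "\<And>v. v \<in> V \<Longrightarrow> Ki (K v) = v"
    and KA: "\<And>v. v \<in> V \<Longrightarrow> K (A v) = scale (q powi 2) (A (K v))"
    and KB: "\<And>v. v \<in> V \<Longrightarrow> K (B v) = scale (q powi 2) (B (K v))"
    and Ka: "\<And>v. v \<in> V \<Longrightarrow> K (a v) = scale (q powi (-2)) (a (K v))"
    and Kb: "\<And>v. v \<in> V \<Longrightarrow> K (b v) = scale (q powi (-2)) (b (K v))"
begin

lemmas L = lin_simps[OF lin(1)] lin_simps[OF lin(2)] lin_simps[OF lin(3)]
  lin_simps[OF lin(4)] lin_simps[OF lin(5)] lin_simps[OF lin(6)]

lemma powi2: "q powi 2 = q * q" "q powi (-2) = inverse q * inverse q"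
  by (simp_all add: power_int_def power2_eq_square)

lemma move_Ki:
  assumes lin': "lin e" and eV: "\<And>v. e v \<in> V" and t: "t \<noteq> 0"
    and Ke: "\<And>v. v \<in> V \<Longrightarrow> K (e v) = scale t (e (K v))" and v: "v \<in> V"
  shows "e (K v) = scale (inverse t) (K (e v))" "e (Ki v) = scale t (Ki (e v))"
    "Ki (e v) = scale (inverse t) (e (Ki v))"
proof -
  show "e (K v) = scale (inverse t) (K (e v))" using Ke[OF v] t by simp
  have "Ki (K (e (Ki v))) = Ki (scale t (e (K (Ki v))))" using Ke inV by simp
  then show *: "e (Ki v) = scale t (Ki (e v))" using KKi inV eV v by (simp add: L)
  show "Ki (e v) = scale (inverse t) (e (Ki v))" using * t by simp
qed

lemma q2_nonzero: "q powi 2 \<noteq> 0" "q powi (-2) \<noteq> 0" "inverse (q powi 2) = q powi (-2)" "inverse (q powi (-2)) = q powi 2"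
  using q_nonzero by (simp_all add: power_int_minus)

lemmas Kmoves =
  move_Ki[OF lin(3) inV(3) q2_nonzero(1) KA] move_Ki[OF lin(5) inV(5) q2_nonzero(1) KB]
  move_Ki[OF lin(4) inV(4) q2_nonzero(2) Ka] move_Ki[OF lin(6) inV(6) q2_nonzero(2) Kb]

lemma swapped_pre: "uq_pre scale q V Ki K a A b B"
proof unfold_locales
  show "Ki (a v) = scale (q powi 2) (a (Ki v))" if "v \<in> V" for v
    using Kmoves(9)[OF _ that] by (simp only: q2_nonzero)
  show "Ki (b v) = scale (q powi 2) (b (Ki v))" if "v \<in> V" for v
    using Kmoves(12)[OF _ that] by (simp only: q2_nonzero)
  show "Ki (A v) = scale (q powi (-2)) (A (Ki v))" if "v \<in> V" for v
    using Kmoves(3)[OF _ that] by (simp only: q2_nonzero)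
  show "Ki (B v) = scale (q powi (-2)) (B (Ki v))" if "v \<in> V" for v
    using Kmoves(6)[OF _ that] by (simp only: q2_nonzero)
qed (use sub lin inV KKi in auto)

definition X :: "4 \<Rightarrow> 'b \<Rightarrow> 'b" where
  "X i v = (if i = 0 then K v + scale (q * qd) (K (b v))
            else if i = 1 then Ki v - scale qd (a v)
            else if i = 2 then Ki v + scale (q * qd) (Ki (B v))
            else K v - scale qd (A v))"

lemma X_simps:
  "X 0 v = K v + scale (q * qd) (K (b v))" "X 1 v = Ki v - scale qd (a v)"
  "X 2 v = Ki v + scale (q * qd) (Ki (B v))" "X 3 v = K v - scale qd (A v)"
  by (simp_all add: X_def)

lemma lin_X: "lin (X i)"
  using exhaust_4[of i]
  by (auto simp: X_simps[abs_def] intro!: lin_plus lin_minus lin_scaled lin_comp[OF lin(1)] lin_comp[OF lin(2)] lin)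

lemma X_inV: "X i v \<in> V"
  unfolding X_def by (auto intro!: subspace_add[OF sub] subspace_diff[OF sub] subspace_scale[OF sub] inV)

lemmas to_K = Kmoves(1,2,4,5,7,8,10,11)

lemma K_zero_iff: "v \<in> V \<Longrightarrow> K v = 0 \<longleftrightarrow> v = 0"
  using KKi(2) by (metis lin_zero[OF lin(1)] lin_zero[OF lin(2)])

text \<open>
  The four \<open>q\<close>-Weyl relations are the commutation relations of the \<open>e\<^sub>i\<^sup>+\<close> with the \<open>e\<^sub>j\<^sup>-\<close>: in \<open>qX\<^sub>iX\<^sub>i\<^sub>+\<^sub>1 - q\<^sup>-\<^sup>1X\<^sub>i\<^sub>+\<^sub>1X\<^sub>i\<close>
  all terms with a single factor of this kind cancel.
\<close>

lemma weyl_01: "qweyl V (X 0) (X 1) \<longleftrightarrow> (\<forall>v\<in>V. a (b v) = b (a v))"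
proof -
  have "scale q (X 0 (X 1 v)) - scale (inverse q) (X 1 (X 0 v)) = scale qd v \<longleftrightarrow> a (b v) = b (a v)"
    if v: "v \<in> V" for v
  proof -
    define d where "d = qd"
    note X_simps' = X_simps[folded d_def]
    have 1: "X 0 (X 1 v) = v - scale d (K (a v)) + scale (d * inverse q) (b v) - scale (q * d * d) (K (b (a v)))"
      using v q_nonzero by (simp add: X_simps' L KKi to_K inV powi2 scale_right_diff_distrib power2_eq_square algebra_simps)
    have 2: "X 1 (X 0 v) = v + scale (q * d) (b v) - scale (d * q * q) (K (a v)) - scale (q * d * d * q * q) (K (a (b v)))"
      using v q_nonzero by (simp add: X_simps' L KKi to_K inV powi2 scale_right_distrib power2_eq_square algebra_simps)
    have c: "q * d = inverse q * (d * q * q)" "q * (d * inverse q) = inverse q * (q * d)"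
      "inverse q * (q * d * d * q * q) = q * (q * d * d)"
      using q_nonzero by (simp_all add: field_simps)
    have "scale q (X 0 (X 1 v)) - scale (inverse q) (X 1 (X 0 v))
        = scale q v - scale (inverse q) v + scale (q * (q * d * d)) (K (a (b v) - b (a v)))"
      unfolding 1 2 scale_right_distrib scale_right_diff_distrib scale_scale c
      using q_nonzero by (simp add: L scale_right_diff_distrib)
    also have "\<dots> = scale qd v + scale (q * (q * d * d)) (K (a (b v) - b (a v)))"
      by (simp add: scale_left_diff_distrib)
    finally show ?thesis
      using q_nonzero qd_nonzero K_zero_iff[of "a (b v) - b (a v)"] inV sub by (simp add: d_def subspace_diff)
  qed
  then show ?thesis by (simp add: qweyl_def)
qed

lemma weyl_12: "qweyl V (X 1) (X 2) \<longleftrightarrow> (\<forall>v\<in>V. a (B v) - B (a v) = scale (1 / qd) (Ki v - K v))"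
proof -
  have "scale q (X 1 (X 2 v)) - scale (inverse q) (X 2 (X 1 v)) = scale qd v
      \<longleftrightarrow> a (B v) - B (a v) = scale (1 / qd) (Ki v - K v)" if v: "v \<in> V" for v
  proof -
    define d where "d = qd"
    note X_simps' = X_simps[folded d_def]
    define w where "w = a (B v) - B (a v)"
    have wV: "w \<in> V" using inV sub by (simp add: w_def subspace_diff)
    have d: "d \<noteq> 0" using qd_nonzero by (simp add: d_def)
    have 1: "X 1 (X 2 v) = Ki (Ki v) + scale (q * d) (Ki (Ki (B v))) - scale (d * inverse q * inverse q) (Ki (a v))
        - scale (d * d * inverse q) (Ki (a (B v)))"
      using v q_nonzero by (simp add: X_simps' L KKi to_K inV powi2 scale_right_distrib power2_eq_square algebra_simps)
    have 2: "X 2 (X 1 v) = Ki (Ki v) - scale d (Ki (a v)) + scale (q * d * q * q) (Ki (Ki (B v))) - scale (q * d * d) (Ki (B (a v)))"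
      using v q_nonzero by (simp add: X_simps' L KKi to_K inV powi2 scale_right_diff_distrib power2_eq_square algebra_simps)
    have c: "q * (q * d) = inverse q * (q * d * q * q)" "q * (d * inverse q * inverse q) = inverse q * d"
      "q * (d * d * inverse q) = d * d" "inverse q * (q * d * d) = d * d"
      using q_nonzero by (simp_all add: field_simps)
    have "scale q (X 1 (X 2 v)) - scale (inverse q) (X 2 (X 1 v))
        = scale q (Ki (Ki v)) - scale (inverse q) (Ki (Ki v)) - scale (d * d) (Ki w)"
      unfolding 1 2 scale_right_distrib scale_right_diff_distrib scale_scale c w_def
      by (simp add: L scale_right_diff_distrib)
    also have "\<dots> = scale d (Ki (Ki v)) - scale (d * d) (Ki w)"
      by (simp add: d_def scale_left_diff_distrib)
    finally have e: "scale q (X 1 (X 2 v)) - scale (inverse q) (X 2 (X 1 v)) = scale d (Ki (Ki v)) - scale (d * d) (Ki w)" .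
    have "scale d (Ki (Ki v)) - scale (d * d) (Ki w) = scale d v \<longleftrightarrow> scale d (Ki (Ki v) - v - scale d (Ki w)) = 0"
      by (auto simp: scale_right_diff_distrib algebra_simps)
    also have "\<dots> \<longleftrightarrow> K (Ki (Ki v) - v - scale d (Ki w)) = 0"
      using d inV v sub by (subst K_zero_iff) (auto intro!: subspace_diff subspace_scale)
    also have "\<dots> \<longleftrightarrow> scale d w = Ki v - K v"
      using v wV inV by (auto simp: L KKi)
    also have "\<dots> \<longleftrightarrow> w = scale (1 / d) (Ki v - K v)"
    proof
      assume "scale d w = Ki v - K v"
      then have "scale (1 / d) (scale d w) = scale (1 / d) (Ki v - K v)" by simp
      then show "w = scale (1 / d) (Ki v - K v)" using d by simp
    qed (use d in simp)
    finally show ?thesis unfolding e by (simp only: w_def d_def)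
  qed
  then show ?thesis by (simp add: qweyl_def)
qed

lemma serre_13: "qserre V (X 1) (X 3) \<longleftrightarrow> qserre V a A"
  unfolding X_simps[abs_def]
  by (rule qserre_shifted[where s = "q powi 2" and s' = "q powi (-2)"])
     (use sub lin inV KKi q_nonzero qd_nonzero in \<open>auto simp: qnum_3 Kmoves(3,9) q2_nonzero(3,4) power_int_minus\<close>)

text \<open>
  In \<open>Kb\<close> and \<open>KiB\<close> the factors \<open>K\<close> and \<open>Ki\<close> can be moved to the left; the powers of \<open>q\<close> that arise are the same
  for all four monomials.
\<close>

lemma twisted_serre: "qserre V (\<lambda>v. scale (- q) (K (b v))) (\<lambda>v. scale (- q) (Ki (B v))) \<longleftrightarrow> qserre V b B"
proof -
  define e e' where "e v = scale (- q) (K (b v))" and "e' v = scale (- q) (Ki (B v))" for v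
  let ?t = "(- q) * (- q) * (- q) * (- q)"
  have cancel: "q * (inverse q * t) = t" "inverse q * (q * t) = t" for t
    using q_nonzero by (simp_all flip: mult.assoc)
  have "e (e (e (e' v))) - scale (qnum q 3) (e (e (e' (e v))))
       + scale (qnum q 3) (e (e' (e (e v)))) - e' (e (e (e v))) = 0
    \<longleftrightarrow> b (b (b (B v))) - scale (qnum q 3) (b (b (B (b v))))
         + scale (qnum q 3) (b (B (b (b v)))) - B (b (b (b v))) = 0" (is "?l = 0 \<longleftrightarrow> ?r = 0")
    if v: "v \<in> V" for v
  proof -
    have w: "e (e (e (e' v))) = scale ?t (K (K (b (b (b (B v))))))"
      "e (e (e' (e v))) = scale ?t (K (K (b (b (B (b v))))))"
      "e (e' (e (e v))) = scale ?t (K (K (b (B (b (b v))))))"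
      "e' (e (e (e v))) = scale ?t (K (K (B (b (b (b v))))))"
      using v q_nonzero by (simp_all add: e_def e'_def L KKi to_K inV powi2 power2_eq_square mult.assoc cancel)
    have "?l = scale ?t (K (K ?r))"
      unfolding w
      by (simp only: L scale_right_diff_distrib scale_right_distrib scale_left_commute[of "qnum q 3"])
    moreover have "K v = 0 \<longleftrightarrow> v = 0" if "v \<in> V" for v
      using KKi(2)[OF that] by (metis lin_zero[OF lin(1)] lin_zero[OF lin(2)])
    moreover have "?r \<in> V" using sub inV by (auto intro!: subspace_add subspace_diff subspace_scale)
    ultimately show ?thesis using q_nonzero inV by simp
  qed
  then have "qserre V e e' \<longleftrightarrow> qserre V b B" by (simp add: qserre_def)
  then show ?thesis by (simp only: e_def[abs_def] e'_def[abs_def])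
qed

lemma serre_02: "qserre V (X 0) (X 2) \<longleftrightarrow> qserre V b B"
proof -
  have lin': "lin (\<lambda>v. scale (- q) (K (b v)))" "lin (\<lambda>v. scale (- q) (Ki (B v)))"
    by (intro lin_scaled lin_comp[OF lin(1)] lin_comp[OF lin(2)] lin)+
  have "qserre V (\<lambda>v. K v - scale qd (scale (- q) (K (b v)))) (\<lambda>v. Ki v - scale qd (scale (- q) (Ki (B v))))
      \<longleftrightarrow> qserre V (\<lambda>v. scale (- q) (K (b v))) (\<lambda>v. scale (- q) (Ki (B v)))"
  proof (rule qserre_shifted[where s = "q powi (-2)" and s' = "q powi 2", OF sub lin(1,2) lin' inV(1,2) _ _ _ _ KKi _ _ qd_nonzero])
    show "q powi -2 * q powi 2 = 1" using q_nonzero by (simp add: power_int_minus)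
    show "q powi -2 + 1 + q powi 2 = qnum q 3" by (simp add: qnum_3)
    show "scale (- q) (K (b v)) \<in> V" "scale (- q) (Ki (B v)) \<in> V" for v
      by (intro subspace_scale[OF sub] inV)+
    show "K (scale (- q) (K (b v))) = scale (q powi -2) (scale (- q) (K (b (K v))))" if "v \<in> V" for v
      using Kb[OF that] by (simp only: lin_scale[OF lin(1)] scale_left_commute[of "q powi -2"])
    show "K (scale (- q) (Ki (B v))) = scale (q powi 2) (scale (- q) (Ki (B (K v))))" if "v \<in> V" for v
    proof -
      have "Ki (B (K v)) = scale (inverse (q powi 2)) (B v)"
        using Kmoves(4)[of v] that inV KKi by (simp add: L)
      then show ?thesis using q2_nonzero(1) KKi inV by (simp add: L)
    qed
  qed
  moreover have "(\<lambda>v. K v - scale qd (scale (- q) (K (b v)))) = X 0" "(\<lambda>v. Ki v - scale qd (scale (- q) (Ki (B v)))) = X 2"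
    by (simp_all add: X_simps[abs_def] mult.commute)
  ultimately show ?thesis using twisted_serre by simp
qed

lemma swapped_X: "uq_pre.X scale q Ki K a A b B i = X (i + 2)"
proof -
  interpret sw: uq_pre scale q V Ki K a A b B by (rule swapped_pre)
  show ?thesis
    using exhaust_4[of i] by (auto simp: fun_eq_iff sw.X_simps X_simps four_eq_zero)
qed

lemma serre_31: "qserre V (X 3) (X 1) \<longleftrightarrow> qserre V A a"
  and serre_20: "qserre V (X 2) (X 0) \<longleftrightarrow> qserre V B b"
proof -
  interpret sw: uq_pre scale q V Ki K a A b B by (rule swapped_pre)
  show "qserre V (X 3) (X 1) \<longleftrightarrow> qserre V A a" "qserre V (X 2) (X 0) \<longleftrightarrow> qserre V B b"
    using sw.serre_13 sw.serre_02 by (simp_all add: swapped_X four_eq_zero)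
qed

lemma weyl_23: "qweyl V (X 2) (X 3) \<longleftrightarrow> (\<forall>v\<in>V. A (B v) = B (A v))"
  and weyl_30: "qweyl V (X 3) (X 0) \<longleftrightarrow> (\<forall>v\<in>V. A (b v) - b (A v) = scale (1 / qd) (K v - Ki v))"
proof -
  interpret sw: uq_pre scale q V Ki K a A b B by (rule swapped_pre)
  show "qweyl V (X 2) (X 3) \<longleftrightarrow> (\<forall>v\<in>V. A (B v) = B (A v))"
    "qweyl V (X 3) (X 0) \<longleftrightarrow> (\<forall>v\<in>V. A (b v) - b (A v) = scale (1 / qd) (K v - Ki v))"
    using sw.weyl_01 sw.weyl_12 by (simp_all add: swapped_X four_eq_zero)
qed

end

locale uq_ops = uq_pre scale q V K Ki A a B b
  for scale :: "'a::field \<Rightarrow> 'b::ab_group_add \<Rightarrow> 'b" and q :: 'a and V K Ki A a B b +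
  assumes AB: "\<And>v. v \<in> V \<Longrightarrow> A (B v) = B (A v)"
    and ab: "\<And>v. v \<in> V \<Longrightarrow> a (b v) = b (a v)"
    and Ab: "\<And>v. v \<in> V \<Longrightarrow> A (b v) - b (A v) = scale (1 / qd) (K v - Ki v)"
    and aB: "\<And>v. v \<in> V \<Longrightarrow> a (B v) - B (a v) = scale (1 / qd) (Ki v - K v)"
    and serres: "qserre V A a" "qserre V a A" "qserre V B b" "qserre V b B"
begin

lemma swapped: "uq_ops scale q V Ki K a A b B"
proof -
  interpret sw: uq_pre scale q V Ki K a A b B by (rule swapped_pre)
  show ?thesis by unfold_locales (use AB ab Ab aB serres in auto)
qed

lemma box_relations: "qweyl V (X i) (X (i + 1))" "qserre V (X i) (X (i + 2))"
  using exhaust_4[of i] AB ab Ab aB serres weyl_01 weyl_12 weyl_23 weyl_30 serre_13 serre_02 serre_31 serre_20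
  by (auto simp: four_eq_zero)

end

lemma (in uq_pre) uq_ops_if_box_relations:
  assumes "\<And>i. qweyl V (X i) (X (i + 1))" "\<And>i. qserre V (X i) (X (i + 2))"
  shows "uq_ops scale q V K Ki A a B b"
proof unfold_locales
  show "qserre V A a" "qserre V a A" "qserre V B b" "qserre V b B"
    using assms(2)[of 0] assms(2)[of 1] assms(2)[of 2] assms(2)[of 3] serre_13 serre_02 serre_31 serre_20
    by (simp_all add: four_eq_zero)
  show "A (B v) = B (A v)" if "v \<in> V" for v using assms(1)[of 2] weyl_23 that by simp
  show "a (b v) = b (a v)" if "v \<in> V" for v using assms(1)[of 0] weyl_01 that by simp
  show "A (b v) - b (A v) = scale (1 / qd) (K v - Ki v)" if "v \<in> V" for v
    using assms(1)[of 3] weyl_30 that by (simp add: four_eq_zero)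
  show "a (B v) - B (a v) = scale (1 / qd) (Ki v - K v)" if "v \<in> V" for v
    using assms(1)[of 1] weyl_12 that by simp
qed

context q_space
begin

text \<open>The generators \<open>KInv 0\<close> and \<open>KInv 1\<close> act as \<open>K\<^sub>1\<close> and \<open>K\<^sub>0\<close>, because \<open>K\<^sub>0K\<^sub>1 = 1\<close>.\<close>

definition gen_ops :: "(uq_gen \<Rightarrow> 'b \<Rightarrow> 'b) \<Rightarrow> 'b set \<Rightarrow> bool" where
  "gen_ops g V \<longleftrightarrow> uq_ops scale q V (g (KGen 0)) (g (KGen 1)) (g (EPlus 0)) (g (EPlus 1)) (g (EMinus 1)) (g (EMinus 0))
     \<and> (\<forall>v\<in>V. g (KInv 0) v = g (KGen 1) v \<and> g (KInv 1) v = g (KGen 0) v)"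

lemmas ev_simps = ev_diff ev_add ev_uminus ev_1 ev_free_gen ev_free_const

lemma uq_relations_gen_ops:
  assumes V: "subspace V" and lin: "\<And>x. lin (g x)" and inV: "\<And>x v. g x v \<in> V"
    and rel: "\<And>r v. r \<in> uq_rels q \<Longrightarrow> v \<in> V \<Longrightarrow> ev g r v = 0"
  shows "gen_ops g V"
proof -
  note E = ev_simps ev_mult[of g, OF lin]
  have KKinv: "g (KGen i) (g (KInv i) v) = v" "g (KInv i) (g (KGen i) v) = v" if "v \<in> V" for i v
  proof -
    from uq_rels_mem(1,2)[THEN rel, OF that] show "g (KGen i) (g (KInv i) v) = v" "g (KInv i) (g (KGen i) v) = v"
      by (simp_all only: E right_minus_eq)
  qed
  have K01: "g (KGen 0) (g (KGen 1) v) = v" "g (KGen 1) (g (KGen 0) v) = v" if "v \<in> V" for v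
    using uq_rels_mem(3,4)[THEN rel, OF that] by (simp_all only: E right_minus_eq)
  have inv: "g (KInv 0) v = g (KGen 1) v" "g (KInv 1) v = g (KGen 0) v" if "v \<in> V" for v
    using KKinv(2)[of "g (KGen 1) v" 0] KKinv(2)[of "g (KGen 0) v" 1] K01[OF that] inV by simp_all
  have ep0: "g (KGen 0) (g (EPlus 0) (g (KInv 0) v)) = scale (q powi 2) (g (EPlus 0) v)"
    and em0: "g (KGen 0) (g (EMinus 0) (g (KInv 0) v)) = scale (q powi (-2)) (g (EMinus 0) v)"
    and ep1: "g (KGen 0) (g (EPlus 1) (g (KInv 0) v)) = scale (q powi (-2)) (g (EPlus 1) v)"
    and em1: "g (KGen 0) (g (EMinus 1) (g (KInv 0) v)) = scale (q powi 2) (g (EMinus 1) v)" if "v \<in> V" for v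
  proof -
    have "(0::2) \<noteq> 1" by simp
    note M = uq_rels_mem(5)[of 0 q] uq_rels_mem(6)[of 0 q] uq_rels_mem(7)[OF this, of q] uq_rels_mem(8)[OF this, of q]
    from M[THEN rel, OF that] show
      "g (KGen 0) (g (EPlus 0) (g (KInv 0) v)) = scale (q powi 2) (g (EPlus 0) v)"
      "g (KGen 0) (g (EMinus 0) (g (KInv 0) v)) = scale (q powi (-2)) (g (EMinus 0) v)"
      "g (KGen 0) (g (EPlus 1) (g (KInv 0) v)) = scale (q powi (-2)) (g (EPlus 1) v)"
      "g (KGen 0) (g (EMinus 1) (g (KInv 0) v)) = scale (q powi 2) (g (EMinus 1) v)"
      by (simp_all only: E right_minus_eq)
  qed
  have comm: "g (EPlus i) (g (EMinus i) v) - g (EMinus i) (g (EPlus i) v) = scale (1 / qd) (g (KGen i) v - g (KInv i) v)"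
    if "v \<in> V" for i v
    using rel[OF uq_rels_mem(9) that] by (simp only: E right_minus_eq)
  have cross: "g (EPlus 0) (g (EMinus 1) v) = g (EMinus 1) (g (EPlus 0) v)"
    "g (EMinus 0) (g (EPlus 1) v) = g (EPlus 1) (g (EMinus 0) v)" if "v \<in> V" for v
    using uq_rels_mem(10,11)[THEN rel, OF that] by (simp_all only: E right_minus_eq)
  have serre: "qserre V (g (EPlus i)) (g (EPlus j))" "qserre V (g (EMinus i)) (g (EMinus j))" if "i \<noteq> j" for i j
  proof -
    have "ev g (serre q (ep i) (ep j)) v = 0" "ev g (serre q (em i) (em j)) v = 0" if "v \<in> V" for v
      using uq_rels_mem(12,13)[OF \<open>i \<noteq> j\<close>, THEN rel, OF that] by auto
    then show "qserre V (g (EPlus i)) (g (EPlus j))" "qserre V (g (EMinus i)) (g (EMinus j))"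
      by (auto simp: serre_def qserre_def E power3_eq_cube power2_eq_square)
  qed
  have "uq_ops scale q V (g (KGen 0)) (g (KGen 1)) (g (EPlus 0)) (g (EPlus 1)) (g (EMinus 1)) (g (EMinus 0))"
  proof unfold_locales
    fix v assume v: "v \<in> V"
    have v': "g (KGen 0) v \<in> V" by (rule inV)
    show "g (KGen 0) (g (EPlus 0) v) = scale (q powi 2) (g (EPlus 0) (g (KGen 0) v))"
      using ep0[OF v'] KKinv(2)[OF v] by simp
    show "g (KGen 0) (g (EMinus 1) v) = scale (q powi 2) (g (EMinus 1) (g (KGen 0) v))"
      using em1[OF v'] KKinv(2)[OF v] by simp
    show "g (KGen 0) (g (EPlus 1) v) = scale (q powi (-2)) (g (EPlus 1) (g (KGen 0) v))"
      using ep1[OF v'] KKinv(2)[OF v] by simp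
    show "g (KGen 0) (g (EMinus 0) v) = scale (q powi (-2)) (g (EMinus 0) (g (KGen 0) v))"
      using em0[OF v'] KKinv(2)[OF v] by simp
    show "g (EPlus 0) (g (EMinus 0) v) - g (EMinus 0) (g (EPlus 0) v) = scale (1 / qd) (g (KGen 0) v - g (KGen 1) v)"
      using comm[OF v, of 0] inv[OF v] by simp
    show "g (EPlus 1) (g (EMinus 1) v) - g (EMinus 1) (g (EPlus 1) v) = scale (1 / qd) (g (KGen 1) v - g (KGen 0) v)"
      using comm[OF v, of 1] inv[OF v] by simp
  qed (use V lin inV K01 cross serre in auto)
  then show ?thesis using inv by (simp add: gen_ops_def)
qed

lemma gen_ops_psi:
  assumes g: "gen_ops g V" and lin: "\<And>x. lin (g x)"
  shows "ev g (psi_gen q i) v = uq_pre.X scale q (g (KGen 0)) (g (KGen 1)) (g (EPlus 0)) (g (EPlus 1)) (g (EMinus 1)) (g (EMinus 0)) i v"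
proof -
  interpret U: uq_ops scale q V "g (KGen 0)" "g (KGen 1)" "g (EPlus 0)" "g (EPlus 1)" "g (EMinus 1)" "g (EMinus 0)"
    using g by (simp add: gen_ops_def)
  show ?thesis by (simp add: psi_gen_def U.X_def ev_simps ev_mult[of g, OF lin])
qed

lemma box_relations_ev:
  assumes lin: "\<And>i. lin (x i)" and W: "\<And>i. qweyl V (x i) (x (i + 1))" and S: "\<And>i. qserre V (x i) (x (i + 2))"
    and r: "r \<in> box_rels q" and v: "v \<in> V"
  shows "ev x r v = 0"
proof -
  note E = ev_simps ev_mult[of x, OF lin]
  consider i where "r = free_const (1 / qd) * (free_const q * (xg i * xg (i + 1)) - free_const (inverse q) * (xg (i + 1) * xg i)) - 1"
    | i where "r = serre q (xg i) (xg (i + 2))"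
    using r unfolding box_rels_def by blast
  then show ?thesis
  proof cases
    case 1
    then show ?thesis using W[of i] v qd_nonzero by (simp add: E qweyl_def)
  next
    case 2
    then show ?thesis using S[of i] v
      by (auto simp: serre_def qserre_def E power3_eq_cube power2_eq_square)
  qed
qed

lemma ev_box_relations:
  assumes lin: "\<And>i. lin (x i)" and rel: "\<And>r v. r \<in> box_rels q \<Longrightarrow> v \<in> V \<Longrightarrow> ev x r v = 0"
  shows "qweyl V (x i) (x (i + 1))" "qserre V (x i) (x (i + 2))"
proof -
  note E = ev_simps ev_mult[of x, OF lin]
  have 1: "free_const (1 / qd) * (free_const q * (xg i * xg (i + 1)) - free_const (inverse q) * (xg (i + 1) * xg i)) - 1 \<in> box_rels q"
    and 2: "serre q (xg i) (xg (i + 2)) \<in> box_rels q"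
    unfolding box_rels_def by blast+
  show "qweyl V (x i) (x (i + 1))"
    unfolding qweyl_def
  proof
    fix v assume "v \<in> V"
    from rel[OF 1 this] have "scale (1 / qd) (scale q (x i (x (i + 1) v)) - scale (inverse q) (x (i + 1) (x i v))) = v"
      by (simp add: E)
    then have "scale qd (scale (1 / qd) (scale q (x i (x (i + 1) v)) - scale (inverse q) (x (i + 1) (x i v)))) = scale qd v"
      by simp
    then show "scale q (x i (x (i + 1) v)) - scale (inverse q) (x (i + 1) (x i v)) = scale qd v"
      using qd_nonzero by simp
  qed
  show "qserre V (x i) (x (i + 2))"
    using rel[OF 2] by (auto simp: serre_def qserre_def E power3_eq_cube power2_eq_square)
qed

end

lemma q_space_free:
  assumes "q_space scale (q :: 'f::field)"
  shows "q_space (\<lambda>c (p :: 'x list \<Rightarrow>\<^sub>0 'f). free_const c * p) q"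
proof -
  interpret q_space scale q by fact
  show ?thesis
    unfolding q_space_def q_space_axioms_def
    using ambient_free q_nonzero q_not_root closed_field by blast
qed

text \<open>
  \<open>\<psi>\<close> is well defined: an element of the ideal of \<open>\<box>\<^sub>q\<close> is mapped to one that acts as zero on every module of
  \<open>U\<^sub>q(L(sl\<^sub>2))\<close>, and such an element lies in the ideal of \<open>U\<^sub>q(L(sl\<^sub>2))\<close>.
\<close>

lemma (in q_space) psi_rel_class:
  "psi q (rel_class (box_rels q) p) = uq_class q (free_ext (psi_gen q) p)"
proof -
  have eq: "uq_class q (free_ext (psi_gen q) p') = uq_class q (free_ext (psi_gen q) p)"
    if "p' \<in> rel_class (box_rels q) p" for p'
  proof -
    have p: "p' - p \<in> Idl\<^bsub>free_ring\<^esub> (box_rels q)" using that by (simp only: mem_rel_class)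
    have "free_ext (psi_gen q) p' - free_ext (psi_gen q) p \<in> Idl\<^bsub>free_ring\<^esub> (uq_rels q)"
    proof (rule in_Idl_if_acts_as_zero)
      let ?s = "\<lambda>c (p :: uq_gen list \<Rightarrow>\<^sub>0 'a). free_const c * p"
      interpret Q: q_space ?s q by (rule q_space_free[OF q_space_axioms])
      fix V g and v :: "uq_gen list \<Rightarrow>\<^sub>0 'a"
      assume A: "Q.subspace V" "\<And>x. Q.lin (g x)" "\<And>x v. g x v \<in> V"
        "\<And>r v. r \<in> uq_rels q \<Longrightarrow> v \<in> V \<Longrightarrow> Q.ev g r v = 0" "v \<in> V"
      have g: "Q.gen_ops g V" by (rule Q.uq_relations_gen_ops) (use A in auto)
      interpret U: uq_ops ?s q V "g (KGen 0)" "g (KGen 1)" "g (EPlus 0)" "g (EPlus 1)" "g (EMinus 1)" "g (EMinus 0)"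
        using g by (simp add: Q.gen_ops_def)
      have X: "(\<lambda>i. Q.ev g (psi_gen q i)) = U.X"
        by (intro ext) (rule Q.gen_ops_psi[OF g A(2)])
      have "Q.ev U.X (p' - p) v = 0"
      proof (rule Q.ev_Idl[OF A(1) U.lin_X _ _ p A(5)])
        show "Q.maps_into V (U.X x)" for x by (simp add: Q.maps_into_def U.X_inV)
        show "Q.ev U.X r v = 0" if "r \<in> box_rels q" "v \<in> V" for r v
          using Q.box_relations_ev[of U.X V, OF U.lin_X U.box_relations that] .
      qed
      then show "Q.ev g (free_ext (psi_gen q) p' - free_ext (psi_gen q) p) v = 0"
        by (simp add: Q.ev_diff Q.ev_free_ext[OF A(2)] X)
    qed
    then show ?thesis by (simp add: uq_class_def rel_class_eq_iff)
  qed
  have "p \<in> rel_class (box_rels q) p" by (simp add: mem_rel_class Idl_zero)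
  then have "(\<lambda>p. uq_class q (free_ext (psi_gen q) p)) ` rel_class (box_rels q) p = {uq_class q (free_ext (psi_gen q) p)}"
    using eq by blast
  then show ?thesis by (simp add: psi_def)
qed

context q_space
begin

lemma acts_by_gen_ops: "acts_by (uq_rels q) M g \<Longrightarrow> gen_ops g (fst M)"
  by (rule uq_relations_gen_ops) (auto simp: acts_byD)

lemma pullback_acts_by:
  assumes M: "acts_by (uq_rels q) M g"
  shows "acts_by (box_rels q) (pullback (psi q) M)
    (uq_pre.X scale q (g (KGen 0)) (g (KGen 1)) (g (EPlus 0)) (g (EPlus 1)) (g (EMinus 1)) (g (EMinus 0)))"
proof -
  note D = acts_byD[OF M]
  have g: "gen_ops g (fst M)" by (rule acts_by_gen_ops[OF M])
  interpret U: uq_ops scale q "fst M" "g (KGen 0)" "g (KGen 1)" "g (EPlus 0)" "g (EPlus 1)" "g (EMinus 1)" "g (EMinus 0)"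
    using g by (simp add: gen_ops_def)
  have X: "(\<lambda>i. ev g (psi_gen q i)) = U.X"
    by (intro ext) (rule gen_ops_psi[OF g D(2)])
  have "snd M (psi q (rel_class (box_rels q) p)) v = ev U.X p v" if "v \<in> fst M" for p v
    using D(6)[OF that, of "free_ext (psi_gen q) p"] by (simp add: psi_rel_class uq_class_def ev_free_ext[OF D(2)] X)
  then show ?thesis
    unfolding acts_by_def pullback_def
    using D(1) U.lin_X U.X_inV box_relations_ev[of U.X "fst M", OF U.lin_X U.box_relations] by auto
qed

end


section \<open>Higher \<open>q\<close>-Serre relations\<close>

lemma poly_as_sum: "degree p \<le> n \<Longrightarrow> poly p (x::'f::field) = (\<Sum>i\<le>n. coeff p i * x ^ i)"
  unfolding poly_altdef by (rule sum.mono_neutral_left) (auto simp: coeff_eq_0)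

context q_space
begin

text \<open>
  A sequence \<open>f\<close> on \<open>{0..m}\<close> is a \<open>k\<close>-line if it looks like a linear combination of the \<open>2k + 1\<close>
  geometric sequences with ratios \<open>q\<^sup>2\<^sup>i\<close>, \<open>\<bar>i\<bar> \<le> k\<close>; this is expressed by the linear relations that
  all these sequences satisfy. As long as \<open>2k \<le> m\<close>, such a sequence is determined by any
  \<open>2k + 1\<close> of its values.
\<close>

definition kline :: "nat \<Rightarrow> nat \<Rightarrow> (nat \<Rightarrow> 'b) \<Rightarrow> bool" where
  "kline m k f \<longleftrightarrow> (\<forall>p::'a poly. degree p \<le> m \<longrightarrow> (\<forall>i\<le>2*k. poly p (q powi (2 * (int i - int k))) = 0)
     \<longrightarrow> (\<Sum>r\<le>m. scale (coeff p r) (f r)) = 0)"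

lemma kline_diff: "kline m k f \<Longrightarrow> kline m k g \<Longrightarrow> kline m k (\<lambda>r. f r - g r)"
  unfolding kline_def by (simp add: scale_right_diff_distrib sum_subtractf)

lemma kline_image: "lin h \<Longrightarrow> kline m k f \<Longrightarrow> kline m k (\<lambda>r. h (f r))"
  unfolding kline_def
proof (intro allI impI)
  fix p :: "'a poly"
  assume h: "lin h" and *: "\<forall>p. degree p \<le> m \<longrightarrow> (\<forall>i\<le>2*k. poly p (q powi (2 * (int i - int k))) = 0)
     \<longrightarrow> (\<Sum>r\<le>m. scale (coeff p r) (f r)) = 0"
    and p: "degree p \<le> m" "\<forall>i\<le>2*k. poly p (q powi (2 * (int i - int k))) = 0"
  have "(\<Sum>r\<le>m. scale (coeff p r) (h (f r))) = h (\<Sum>r\<le>m. scale (coeff p r) (f r))"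
    by (simp add: lin_simps[OF h])
  then show "(\<Sum>r\<le>m. scale (coeff p r) (h (f r))) = 0"
    using * p by (simp add: lin_zero[OF h])
qed

lemma kline_reverse:
  assumes f: "kline m k f"
  shows "kline m k (\<lambda>r. f (m - r))"
  unfolding kline_def
proof (intro allI impI)
  fix p :: "'a poly"
  assume deg: "degree p \<le> m" and roots: "\<forall>i\<le>2*k. poly p (q powi (2 * (int i - int k))) = 0"
  define p' where "p' = (\<Sum>r\<le>m. monom (coeff p (m - r)) r)"
  have cf: "coeff p' r = (if r \<le> m then coeff p (m - r) else 0)" for r
    by (simp add: p'_def coeff_sum)
  have "degree p' \<le> m" by (rule degree_le) (simp add: cf)
  have rev: "(\<Sum>r\<le>m. h (m - r) r) = (\<Sum>r\<le>m. h r (m - r))" for h :: "nat \<Rightarrow> nat \<Rightarrow> 'c::comm_monoid_add"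
    by (rule sum.reindex_bij_witness[of _ "\<lambda>r. m - r" "\<lambda>r. m - r"]) auto
  have val: "poly p' x = x ^ m * poly p (inverse x)" if "x \<noteq> 0" for x
  proof -
    have "poly p' x = (\<Sum>r\<le>m. coeff p (m - r) * x ^ r)"
      by (simp add: p'_def poly_sum poly_monom)
    also have "\<dots> = (\<Sum>r\<le>m. coeff p r * x ^ (m - r))" by (rule rev)
    also have "\<dots> = (\<Sum>r\<le>m. x ^ m * (coeff p r * inverse x ^ r))"
      using that by (intro sum.cong) (auto simp: power_diff field_simps)
    also have "\<dots> = x ^ m * poly p (inverse x)"
      by (simp add: poly_as_sum[OF deg] sum_distrib_left)
    finally show ?thesis .
  qed
  have "poly p' (q powi (2 * (int i - int k))) = 0" if "i \<le> 2 * k" for i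
  proof -
    have "inverse (q powi (2 * (int i - int k))) = q powi (2 * (int (2 * k - i) - int k))"
      using that by (simp add: of_nat_diff algebra_simps flip: power_int_minus)
    moreover have "poly p (q powi (2 * (int (2 * k - i) - int k))) = 0" using roots by simp
    ultimately show ?thesis using q_nonzero by (simp only: val power_int_not_zero simp_thms mult_zero_right)
  qed
  then have "(\<Sum>r\<le>m. scale (coeff p' r) (f r)) = 0"
    using f \<open>degree p' \<le> m\<close> unfolding kline_def by blast
  then have "(\<Sum>r\<le>m. scale (coeff p (m - r)) (f r)) = 0" by (simp add: cf)
  then show "(\<Sum>r\<le>m. scale (coeff p r) (f (m - r))) = 0"
    by (simp only: rev[of "\<lambda>i j. scale (coeff p i) (f j)"])
qed

text \<open>
  Lagrange interpolation at the points \<open>q\<^sup>2\<^sup>r\<close>, \<open>r \<in> R\<close>, expresses \<open>f l\<close> by the values on \<open>R\<close>. The factors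
  \<open>\<theta>\<^sup>k\<close> in the coefficients shift the exponents \<open>0, \<dots>, 2k\<close> of interpolation to \<open>-k, \<dots>, k\<close>.
\<close>

lemma kline_in_subspace:
  assumes f: "kline m k f" and S: "subspace S" and R: "R \<subseteq> {..m}" "card R = 2 * k + 1"
    and fR: "\<And>r. r \<in> R \<Longrightarrow> f r \<in> S" and l: "l \<le> m"
  shows "f l \<in> S"
proof (cases "l \<in> R")
  case False
  define \<theta> where "\<theta> r = q powi (2 * int r)" for r :: nat
  have fin: "finite R" using R(1) finite_subset by blast
  have inj: "inj_on \<theta> R" by (auto simp: inj_on_def \<theta>_def powi_inject)
  have nz: "\<theta> r \<noteq> 0" for r using q_nonzero by (simp add: \<theta>_def)
  define c where "c r = poly (lagrange_poly R \<theta> r) (\<theta> l) * \<theta> r ^ k / \<theta> l ^ k" for r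
  define p where "p = monom 1 l - (\<Sum>r\<in>R. monom (c r) r)"
  have cf: "coeff p r = (if r = l then 1 else 0) - (if r \<in> R then c r else 0)" for r
    using fin by (simp add: p_def coeff_sum)
  have "degree p \<le> m" by (rule degree_le) (use R(1) l in \<open>auto simp: cf\<close>)
  moreover have "poly p (q powi (2 * (int i - int k))) = 0" if i: "i \<le> 2 * k" for i
  proof -
    have pw: "(q powi (2 * (int i - int k))) ^ r = \<theta> r ^ i / \<theta> r ^ k" for r
    proof -
      have pow: "(q powi n) ^ s = q powi (n * int s)" for n s by (simp add: power_int_mult)
      have "2 * (int i - int k) * int r = 2 * int r * int i - 2 * int r * int k" by (simp add: algebra_simps)
      then show ?thesis using q_nonzero by (simp only: \<theta>_def pow power_int_diff simp_thms)
    qed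
    have "(\<Sum>r\<in>R. poly (lagrange_poly R \<theta> r) (\<theta> l) * \<theta> r ^ i)
        = poly (\<Sum>r\<in>R. Polynomial.smult (poly (monom 1 i) (\<theta> r)) (lagrange_poly R \<theta> r)) (\<theta> l)"
      by (simp add: poly_sum poly_monom mult.commute)
    also have "\<dots> = \<theta> l ^ i"
      using i R(2) by (subst lagrange_interpolation[OF fin inj]) (auto simp: degree_monom_eq poly_monom)
    finally have *: "(\<Sum>r\<in>R. poly (lagrange_poly R \<theta> r) (\<theta> l) * \<theta> r ^ i) = \<theta> l ^ i" .
    have "(\<Sum>r\<in>R. c r * (\<theta> r ^ i / \<theta> r ^ k)) = (\<Sum>r\<in>R. poly (lagrange_poly R \<theta> r) (\<theta> l) * \<theta> r ^ i) / \<theta> l ^ k"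
      unfolding sum_divide_distrib by (intro sum.cong) (auto simp: c_def nz)
    moreover have "poly p (q powi (2 * (int i - int k))) = (q powi (2 * (int i - int k))) ^ l
        - (\<Sum>r\<in>R. c r * (q powi (2 * (int i - int k))) ^ r)"
      by (simp only: p_def poly_diff poly_sum poly_monom mult_1_left)
    ultimately show ?thesis by (simp only: pw * diff_self)
  qed
  ultimately have "(\<Sum>r\<le>m. scale (coeff p r) (f r)) = 0" using f unfolding kline_def by blast
  moreover have "(\<Sum>r\<le>m. scale (coeff p r) (f r)) = f l - (\<Sum>r\<in>R. scale (c r) (f r))"
  proof -
    have "(\<Sum>r\<le>m. scale (coeff p r) (f r))
        = (\<Sum>r\<le>m. (if r = l then f r else 0) - (if r \<in> R then scale (c r) (f r) else 0))"
      by (intro sum.cong) (use False in \<open>auto simp: cf\<close>)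
    also have "\<dots> = f l - (\<Sum>r\<in>R. scale (c r) (f r))"
      using l R(1) by (simp add: sum_subtractf sum.inter_restrict[symmetric] Int_absorb1)
    finally show ?thesis .
  qed
  ultimately have "f l = (\<Sum>r\<in>R. scale (c r) (f r))" by simp
  then show ?thesis using fR S by (simp add: subspace_sum subspace_scale)
qed (use fR in auto)

text \<open>
  \<open>twist y x k l\<close> applies to \<open>x\<^sup>k\<close> the first \<open>l\<close> of the operators \<open>R - q\<^sup>2\<^sup>i L\<close>, \<open>i = -k, \<dots>, k\<close>, where
  \<open>L\<close> and \<open>R\<close> are left and right multiplication by \<open>y\<close>.
\<close>

fun twist :: "('b \<Rightarrow> 'b) \<Rightarrow> ('b \<Rightarrow> 'b) \<Rightarrow> nat \<Rightarrow> nat \<Rightarrow> 'b \<Rightarrow> 'b" where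
  "twist y x k 0 v = (x ^^ k) v"
| "twist y x k (Suc l) v = twist y x k l (y v) - scale (q powi (2 * (int l - int k))) (y (twist y x k l v))"

lemma lin_twist:
  assumes y: "lin y" and x: "lin x"
  shows "lin (twist y x k l)"
proof (induction l)
  case 0
  have "twist y x k 0 = x ^^ k" by (simp add: fun_eq_iff)
  then show ?case using lin_pow[OF x] by simp
next
  case (Suc l)
  have "twist y x k (Suc l) = (\<lambda>v. twist y x k l (y v) - scale (q powi (2 * (int l - int k))) (y (twist y x k l v)))"
    by (simp add: fun_eq_iff)
  then show ?case
    using lin_minus[OF lin_comp[OF Suc.IH y] lin_scaled[OF lin_comp[OF y Suc.IH]]] by simp
qed

lemma twist_in:
  assumes "subspace V" "maps_into V y" "maps_into V x" "v \<in> V"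
  shows "twist y x k l v \<in> V"
  using assms(4)
proof (induction l arbitrary: v)
  case 0
  then show ?case using maps_into_pow[OF assms(3)] by simp
next
  case (Suc l)
  then show ?case using assms(1,2) by (auto simp: maps_into_def intro!: subspace_diff subspace_scale)
qed

text \<open>
  A Leibniz rule for \<open>x\<^sup>k\<^sup>+\<^sup>1 = x \<cdot> x\<^sup>k\<close>, from \<open>R - stL = (R - tL)\<close> on the right factor plus \<open>t(R - sL)\<close> on the left
  factor.
\<close>

lemma twist_product:
  assumes y: "lin y" and x: "lin x"
  shows "\<exists>c. \<forall>v. twist y x (Suc k) m v = (\<Sum>i\<le>m. scale (c i) (twist y x 1 i (twist y x k (m - i) v)))"
proof (induction m)
  case 0
  show ?case by (rule exI[of _ "\<lambda>_. 1"]) simp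
next
  case (Suc m)
  let ?f = "twist y x 1" and ?g = "twist y x k"
  obtain c where c: "\<And>v. twist y x (Suc k) m v = (\<Sum>i\<le>m. scale (c i) (?f i (?g (m - i) v)))"
    using Suc by blast
  let ?\<beta> = "\<lambda>j. q powi (2 * (int j - int k))"
  let ?s = "q powi (2 * (int m - int (Suc k)))"
  have step: "?f i (?g (m - i) (y v)) - scale ?s (y (?f i (?g (m - i) v)))
      = ?f i (?g (Suc m - i) v) + scale (?\<beta> (m - i)) (?f (Suc i) (?g (m - i) v))" if "i \<le> m" for i v
  proof -
    have s: "?s = ?\<beta> (m - i) * q powi (2 * (int i - int 1))"
      using that q_nonzero by (simp add: of_nat_diff algebra_simps flip: power_int_add)
    have g: "?g (m - i) (y v) = ?g (Suc m - i) v + scale (?\<beta> (m - i)) (y (?g (m - i) v))"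
      using that by (simp add: Suc_diff_le)
    show ?thesis
      unfolding s g by (simp add: lin_simps[OF lin_twist[OF y x]] scale_right_diff_distrib)
  qed
  define c' where "c' i = (if i \<le> m then c i else 0) + (if 0 < i then c (i - 1) * ?\<beta> (Suc m - i) else 0)" for i
  have "twist y x (Suc k) (Suc m) v = (\<Sum>i\<le>Suc m. scale (c' i) (?f i (?g (Suc m - i) v)))" for v
  proof -
    have "twist y x (Suc k) (Suc m) v
        = (\<Sum>i\<le>m. scale (c i) (?f i (?g (m - i) (y v)) - scale ?s (y (?f i (?g (m - i) v)))))"
      by (simp only: twist.simps(2) c lin_simps[OF y] scale_sum_right sum_subtractf[symmetric]
          scale_right_diff_distrib scale_left_commute[of ?s])
    also have "\<dots> = (\<Sum>i\<le>m. scale (c i) (?f i (?g (Suc m - i) v)) + scale (c i * ?\<beta> (m - i)) (?f (Suc i) (?g (m - i) v)))"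
      by (intro sum.cong refl) (simp only: step atMost_iff scale_right_distrib scale_scale)
    also have "\<dots> = (\<Sum>i\<le>m. scale (c i) (?f i (?g (Suc m - i) v))) + (\<Sum>i\<le>m. scale (c i * ?\<beta> (m - i)) (?f (Suc i) (?g (m - i) v)))"
      by (rule sum.distrib)
    also have "(\<Sum>i\<le>m. scale (c i) (?f i (?g (Suc m - i) v)))
        = (\<Sum>i\<le>Suc m. scale (if i \<le> m then c i else 0) (?f i (?g (Suc m - i) v)))"
      by simp
    also have "(\<Sum>i\<le>m. scale (c i * ?\<beta> (m - i)) (?f (Suc i) (?g (m - i) v)))
        = (\<Sum>i\<le>Suc m. scale (if 0 < i then c (i - 1) * ?\<beta> (Suc m - i) else 0) (?f i (?g (Suc m - i) v)))"
      by (subst sum.atMost_Suc_shift) simp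
    finally show ?thesis by (simp only: c'_def scale_left_distrib sum.distrib)
  qed
  then show ?case by blast
qed

text \<open>
  The higher \<open>q\<close>-Serre relation of degree \<open>(2k + 1, k)\<close>. In the Leibniz rule with \<open>2k + 3\<close> factors either at least three
  factors hit \<open>x\<close> and the ordinary relation applies, or at least \<open>2k + 1\<close> factors hit \<open>x\<^sup>k\<close>.
\<close>

lemma twist_vanishes:
  assumes V: "subspace V" and y: "lin y" "maps_into V y" and x: "lin x" "maps_into V x"
    and serre: "qserre V y x" and v: "v \<in> V" and l: "2 * k + 1 \<le> l"
  shows "twist y x k l v = 0"
proof -
  have later: "twist y x k l v = 0"
    if "\<And>v. v \<in> V \<Longrightarrow> twist y x k l0 v = 0" "l0 \<le> l" "v \<in> V" for k l0 l v
    using that(2,3)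
  proof (induction l arbitrary: v)
    case 0
    then show ?case using that(1)[of v] by simp
  next
    case (Suc l)
    then show ?case
      using that(1)[OF Suc.prems(2)] y by (cases "l0 = Suc l") (auto simp: maps_into_def lin_zero)
  qed
  have f3: "twist y x 1 3 v = 0" if "v \<in> V" for v
  proof -
    have 3: "twist y x 1 3 v = twist y x 1 (Suc (Suc (Suc 0))) v" by (simp only: numeral_3_eq_3)
    have e: "twist y x 1 3 v = - (y (y (y (x v))) - scale (qnum q 3) (y (y (x (y v))))
     + scale (qnum q 3) (y (x (y (y v)))) - x (y (y (y v))))"
      unfolding 3 using q_nonzero
      by (simp add: qnum_3 lin_simps[OF y(1)] lin_simps[OF x(1)] scale_left_distrib
          scale_right_diff_distrib power_int_minus)
    show ?thesis unfolding e using serre that by (simp add: qserre_def)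
  qed
  have "twist y x k (2 * k + 1) v = 0" if "v \<in> V" for v
    using that
  proof (induction k arbitrary: v)
    case 0
    then show ?case by simp
  next
    case (Suc k)
    have m: "2 * Suc k + 1 = 2 * k + 3" by simp
    obtain c where c: "\<And>v. twist y x (Suc k) (2 * k + 3) v
        = (\<Sum>i\<le>2*k+3. scale (c i) (twist y x 1 i (twist y x k (2 * k + 3 - i) v)))"
      using twist_product[OF y(1) x(1), of k "2 * k + 3"] by blast
    have "twist y x 1 i (twist y x k (2 * k + 3 - i) v) = 0" for i
    proof (cases "3 \<le> i")
      case True
      show ?thesis by (rule later[of 1 3, OF f3 True]) (auto intro: twist_in[OF V y(2) x(2) Suc.prems])
    next
      case False
      then have le: "2 * k + 1 \<le> 2 * k + 3 - i" by simp
      have "twist y x k (2 * k + 3 - i) v = 0"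
        by (rule later[of k "2 * k + 1", OF Suc.IH le Suc.prems])
      then show ?thesis by (simp only: lin_zero[OF lin_twist[OF y(1) x(1)]])
    qed
    then show ?case unfolding m c by simp
  qed
  then show ?thesis using later l v by blast
qed

text \<open>
  A polynomial that vanishes at all \<open>q\<^sup>2\<^sup>i\<close>, \<open>\<bar>i\<bar> \<le> k\<close>, is divisible by \<open>\<Prod>\<^sub>i (z - q\<^sup>2\<^sup>i)\<close>, and each linear factor
  contributes one application of \<open>R - q\<^sup>2\<^sup>iL\<close>; after all \<open>2k + 1\<close> of them the twist vanishes.
\<close>

lemma kline_serre:
  assumes V: "subspace V" and y: "lin y" "maps_into V y" and x: "lin x" "maps_into V x"
    and serre: "qserre V y x" and v: "v \<in> V"
  shows "kline m k (\<lambda>r. (y ^^ (m - r)) ((x ^^ k) ((y ^^ r) v)))"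
proof -
  define t where "t l = q powi (2 * (int l - int k))" for l :: nat
  define \<Phi> where "\<Phi> l M s = (\<Sum>r\<le>M. scale (coeff s r) ((y ^^ (M - r)) (twist y x k l ((y ^^ r) v))))"
    for l M and s :: "'a poly"
  have step: "\<Phi> l (Suc M) ([:- t l, 1:] * s) = \<Phi> (Suc l) M s" if s: "degree s \<le> M" for l M s
  proof -
    note ly = lin_simps[OF lin_pow[OF y(1)]]
    have top: "coeff s (Suc M) = 0" using s by (simp add: coeff_eq_0)
    have "\<Phi> l (Suc M) ([:- t l, 1:] * s)
        = (\<Sum>r\<le>Suc M. scale (coeff (pCons 0 s) r) ((y ^^ (Suc M - r)) (twist y x k l ((y ^^ r) v))))
        - (\<Sum>r\<le>Suc M. scale (t l * coeff s r) ((y ^^ (Suc M - r)) (twist y x k l ((y ^^ r) v))))"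
      by (simp del: sum.atMost_Suc add: \<Phi>_def sum_subtractf[symmetric] scale_left_diff_distrib[symmetric])
    also have "(\<Sum>r\<le>Suc M. scale (coeff (pCons 0 s) r) ((y ^^ (Suc M - r)) (twist y x k l ((y ^^ r) v))))
        = (\<Sum>r\<le>M. scale (coeff s r) ((y ^^ (M - r)) (twist y x k l ((y ^^ Suc r) v))))"
      by (subst sum.atMost_Suc_shift) simp
    also have "(\<Sum>r\<le>Suc M. scale (t l * coeff s r) ((y ^^ (Suc M - r)) (twist y x k l ((y ^^ r) v))))
        = (\<Sum>r\<le>M. scale (t l * coeff s r) ((y ^^ (M - r)) (y (twist y x k l ((y ^^ r) v)))))"
      by (simp add: top) (intro sum.cong refl, simp add: Suc_diff_le funpow_swap1)
    finally show ?thesis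
      by (simp add: \<Phi>_def sum_subtractf[symmetric] ly t_def scale_right_diff_distrib mult.commute)
  qed
  have vanish: "\<Phi> l M p = 0"
    if "2 * k + 1 = n + l" "degree p \<le> M" "\<And>i. l \<le> i \<Longrightarrow> i \<le> 2 * k \<Longrightarrow> poly p (t i) = 0" for n l M and p :: "'a poly"
    using that
  proof (induction n arbitrary: l M p)
    case 0
    have "twist y x k l ((y ^^ r) v) = 0" for r
      using 0 by (intro twist_vanishes[OF V y x serre]) (auto intro: maps_into_pow[OF y(2)] v)
    then show ?case by (simp add: \<Phi>_def lin_zero[OF lin_pow[OF y(1)]])
  next
    case (Suc n)
    show ?case
    proof (cases "p = 0")
      case True
      then show ?thesis by (simp add: \<Phi>_def)
    next
      case False
      have "poly p (t l) = 0" using Suc.prems by simp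
      then obtain s where s: "p = [:- t l, 1:] * s" by (metis poly_eq_0_iff_dvd dvdE)
      have "s \<noteq> 0" using False s by auto
      then have deg: "degree p = Suc (degree s)" unfolding s by (subst degree_mult_eq) auto
      then obtain M' where M': "M = Suc M'" using Suc.prems(2) by (cases M) auto
      have roots: "poly s (t i) = 0" if "Suc l \<le> i" "i \<le> 2 * k" for i
      proof -
        have "t i \<noteq> t l" using that by (simp add: t_def powi_inject)
        then show ?thesis using Suc.prems(3)[of i] that s by auto
      qed
      show ?thesis
        unfolding M' s by (subst step) (use Suc.IH[of "Suc l" s M'] Suc.prems deg M' roots in auto)
    qed
  qed
  show ?thesis
    unfolding kline_def
    using vanish[of "2 * k + 1" 0 _ m] by (auto simp: \<Phi>_def t_def)
qed

end


section \<open>Weight decomposition and the action of the raising operators\<close>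

context q_space
begin

text \<open>The \<open>q\<close>-integer \<open>[n]\<^sub>q\<close>, also for negative \<open>n\<close>.\<close>

definition qi :: "int \<Rightarrow> 'a" where
  "qi n = (q powi n - q powi (- n)) / qd"

lemma qi_zero_iff: "qi n = 0 \<longleftrightarrow> n = 0"
  using powi_inject[of n "- n"] qd_nonzero by (auto simp: qi_def)

lemma qnum_qi: "qnum q n = qi (int n)"
  by (simp add: qnum_def qi_def)

lemma qi_identity: "qi n * qi m + qi (m + n + 1) = qi (n + 1) * qi (m + 1)"
proof -
  have prod: "(q powi a - q powi (- a)) * (q powi b - q powi (- b))
      = q powi (a + b) - q powi (a - b) - q powi (b - a) + q powi (- a - b)" for a b
    using q_nonzero by (simp add: algebra_simps flip: power_int_add)
  have d: "qd = q powi 1 - q powi (- 1)" by (simp add: power_int_minus)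
  define E where "E = qd"
  have E: "E \<noteq> 0" and qi: "qi k = (q powi k - q powi (- k)) / E" for k
    using qd_nonzero by (simp_all add: E_def qi_def)
  have "(qi n * qi m + qi (m + n + 1)) * (E * E)
      = (q powi n - q powi (- n)) * (q powi m - q powi (- m))
        + (q powi (m + n + 1) - q powi (- (m + n + 1))) * E"
    using E by (simp add: qi distrib_right)
  also have "\<dots> = (q powi n - q powi (- n)) * (q powi m - q powi (- m))
        + (q powi (m + n + 1) - q powi (- (m + n + 1))) * (q powi 1 - q powi (- 1))"
    by (simp only: E_def d)
  also have "\<dots> = (q powi (n + 1) - q powi (- (n + 1))) * (q powi (m + 1) - q powi (- (m + 1)))"
    unfolding prod by (simp only: algebra_simps) (simp add: algebra_simps, rule arg_cong[of _ _ "\<lambda>t. q powi t"], simp)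
  also have "\<dots> = (qi (n + 1) * qi (m + 1)) * (E * E)"
    using E by (simp add: qi)
  finally show ?thesis using E by simp
qed

end

text \<open>
  The index \<open>j\<close> of a weight space runs over the integers, and \<open>wt j\<close> is zero outside \<open>{0..d}\<close>; so no boundary
  cases arise when operators shift the weight.
\<close>

locale uq_graded = uq_ops scale q V K Ki A a B b
  for scale :: "'a::field \<Rightarrow> 'b::ab_group_add \<Rightarrow> 'b" and q :: 'a and V K Ki A a B b +
  fixes d :: nat
  assumes decomposition: "\<And>v. v \<in> V \<Longrightarrow>
      \<exists>u. (\<forall>j\<in>{0..int d}. u j \<in> V \<and> K (u j) = scale (q powi (2 * j - int d)) (u j)) \<and> v = (\<Sum>j\<in>{0..int d}. u j)"
    and finite_dim: "\<exists>S. finite S \<and> V \<subseteq> span S"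
begin

definition wt :: "int \<Rightarrow> 'b set" where
  "wt j = {v\<in>V. K v = scale (q powi (2 * j - int d)) v}"

lemma wt_V: "v \<in> wt j \<Longrightarrow> v \<in> V" and wt_K: "v \<in> wt j \<Longrightarrow> K v = scale (q powi (2 * j - int d)) v"
  by (auto simp: wt_def)

lemma wt_subspace: "subspace (wt j)"
  using sub unfolding wt_def subspace_def
  by (auto simp: lin_simps[OF lin(1)] scale_right_distrib mult.commute)

lemma wt_Ki: "v \<in> wt j \<Longrightarrow> Ki v = scale (q powi (int d - 2 * j)) v"
proof -
  assume v: "v \<in> wt j"
  have "v = scale (q powi (2 * j - int d)) (Ki v)"
    using KKi(2)[OF wt_V[OF v]] by (simp add: wt_K[OF v] L)
  then have "scale (q powi (int d - 2 * j)) v = scale (q powi (int d - 2 * j) * q powi (2 * j - int d)) (Ki v)"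
    by (metis scale_scale)
  then show ?thesis using q_nonzero by (simp flip: power_int_add)
qed

lemma wt_shift:
  assumes "v \<in> wt j"
  shows "A v \<in> wt (j + 1)" "B v \<in> wt (j + 1)" "a v \<in> wt (j - 1)" "b v \<in> wt (j - 1)"
proof -
  have v: "v \<in> V" and k: "K v = scale (q powi (2 * j - int d)) v" using assms by (auto simp: wt_def)
  have p: "q powi 2 * q powi (2 * j - int d) = q powi (2 * (j + 1) - int d)"
    "q powi (-2) * q powi (2 * j - int d) = q powi (2 * (j - 1) - int d)"
    using q_nonzero by (simp_all only: power_int_add[symmetric] simp_thms) (simp_all add: algebra_simps)
  show "A v \<in> wt (j + 1)" unfolding wt_def mem_Collect_eq KA[OF v] k L p[symmetric] scale_scale using inV by simp
  show "B v \<in> wt (j + 1)" unfolding wt_def mem_Collect_eq KB[OF v] k L p[symmetric] scale_scale using inV by simp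
  show "a v \<in> wt (j - 1)" unfolding wt_def mem_Collect_eq Ka[OF v] k L p[symmetric] scale_scale using inV by simp
  show "b v \<in> wt (j - 1)" unfolding wt_def mem_Collect_eq Kb[OF v] k L p[symmetric] scale_scale using inV by simp
qed

lemma wt_pow:
  assumes "v \<in> wt j"
  shows "(A ^^ n) v \<in> wt (j + int n)" "(a ^^ n) v \<in> wt (j - int n)"
proof (induction n)
  case (Suc n)
  show "(A ^^ Suc n) v \<in> wt (j + int (Suc n))" using wt_shift(1)[OF Suc(1)] by (simp add: algebra_simps)
  show "(a ^^ Suc n) v \<in> wt (j - int (Suc n))" using wt_shift(3)[OF Suc(2)] by (simp add: algebra_simps)
qed (use assms in auto)

lemma wt_Ab:
  assumes v: "v \<in> wt j"
  shows "A (b v) = b (A v) + scale (qi (2 * j - int d)) v"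
proof -
  have "A (b v) - b (A v) = scale (1 / qd) (scale (q powi (2 * j - int d)) v - scale (q powi (int d - 2 * j)) v)"
    using Ab[OF wt_V[OF v]] by (simp only: wt_K[OF v] wt_Ki[OF v])
  also have "\<dots> = scale (qi (2 * j - int d)) v"
    by (simp only: scale_left_diff_distrib[symmetric] scale_scale qi_def minus_diff_eq) (simp only: divide_inverse mult.commute mult_1_left mult_1_right)
  finally show ?thesis by (simp add: algebra_simps)
qed

definition \<theta> :: "int \<Rightarrow> 'a" where "\<theta> j = q powi (2 * j - int d)"

lemma \<theta>_inj: "inj_on \<theta> J"
  by (auto simp: inj_on_def \<theta>_def powi_inject)

definition cmp :: "int \<Rightarrow> 'b \<Rightarrow> 'b" where
  "cmp j = papp K (lagrange_poly {0..int d} \<theta> j)"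

lemma lin_cmp: "lin (cmp j)"
  unfolding cmp_def by (rule lin_papp[OF lin(1)])

lemma cmp_sum:
  assumes u: "\<And>i. i \<in> {0..int d} \<Longrightarrow> u i \<in> wt i" and j: "j \<in> {0..int d}"
  shows "cmp j (\<Sum>i\<in>{0..int d}. u i) = u j"
  unfolding cmp_def using u j
  by (intro papp_component[OF lin(1)] \<theta>_inj) (auto simp: wt_K \<theta>_def)

lemma wt_decomposition: "v \<in> V \<Longrightarrow> \<exists>u. (\<forall>j\<in>{0..int d}. u j \<in> wt j) \<and> v = (\<Sum>j\<in>{0..int d}. u j)"
  using decomposition[of v] unfolding wt_def by auto

lemma cmp_wt: "v \<in> V \<Longrightarrow> j \<in> {0..int d} \<Longrightarrow> cmp j v \<in> wt j"
  and sum_cmp: "v \<in> V \<Longrightarrow> (\<Sum>j\<in>{0..int d}. cmp j v) = v"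
proof -
  assume "v \<in> V"
  then obtain u where u: "\<And>j. j \<in> {0..int d} \<Longrightarrow> u j \<in> wt j" "v = (\<Sum>j\<in>{0..int d}. u j)"
    using wt_decomposition by blast
  then have c: "\<And>j. j \<in> {0..int d} \<Longrightarrow> cmp j v = u j" using cmp_sum by simp
  show "j \<in> {0..int d} \<Longrightarrow> cmp j v \<in> wt j" using c u by simp
  show "(\<Sum>j\<in>{0..int d}. cmp j v) = v" using c u by simp
qed

lemma cmp_closed: "subspace W \<Longrightarrow> maps_into W K \<Longrightarrow> w \<in> W \<Longrightarrow> cmp j w \<in> W"
  unfolding cmp_def by (rule papp_closed[OF lin(1)])

lemma cmp_eigen: "v \<in> wt i \<Longrightarrow> i \<in> {0..int d} \<Longrightarrow> j \<in> {0..int d} \<Longrightarrow> cmp j v = (if i = j then v else 0)"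
  unfolding cmp_def
  by (subst papp_eigen[OF lin(1), of _ "\<theta> i"]) (auto simp: wt_K \<theta>_def[symmetric] poly_lagrange[OF _ \<theta>_inj])

lemma wt_outside: "v \<in> wt j \<Longrightarrow> j \<notin> {0..int d} \<Longrightarrow> v = 0"
proof -
  assume v: "v \<in> wt j" and j: "j \<notin> {0..int d}"
  have "papp K (root_poly {0..int d} \<theta>) v = (\<Sum>i\<in>{0..int d}. papp K (root_poly {0..int d} \<theta>) (cmp i v))"
    using sum_cmp[OF wt_V[OF v]] by (metis lin_sum[OF lin_papp[OF lin(1)]])
  also have "\<dots> = 0"
  proof (intro sum.neutral ballI)
    fix i assume i: "i \<in> {0..int d}"
    have "papp K (root_poly {0..int d} \<theta>) (cmp i v) = scale (poly (root_poly {0..int d} \<theta>) (\<theta> i)) (cmp i v)"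
      using cmp_wt[OF wt_V[OF v] i] by (intro papp_eigen[OF lin(1)]) (simp add: wt_K \<theta>_def)
    moreover have "poly (root_poly {0..int d} \<theta>) (\<theta> i) = 0"
      unfolding poly_root_poly using i by (intro prod_zero) auto
    ultimately show "papp K (root_poly {0..int d} \<theta>) (cmp i v) = 0" by simp
  qed
  finally have "scale (poly (root_poly {0..int d} \<theta>) (\<theta> j)) v = 0"
    using papp_eigen[OF lin(1), of v "\<theta> j"] v by (simp add: wt_K \<theta>_def)
  moreover have "poly (root_poly {0..int d} \<theta>) (\<theta> j) \<noteq> 0"
    unfolding poly_root_poly using j by (auto simp: \<theta>_def powi_inject)
  ultimately show "v = 0" by simp
qed

lemma swapped_graded: "uq_graded scale q V Ki K a A b B d"
proof -
  interpret sw: uq_ops scale q V Ki K a A b B by (rule swapped)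
  show ?thesis
  proof unfold_locales
    show "\<exists>S. finite S \<and> V \<subseteq> span S" by (rule finite_dim)
    fix v assume v: "v \<in> V"
    have "(\<Sum>j\<in>{0..int d}. cmp (int d - j) v) = (\<Sum>j\<in>{0..int d}. cmp j v)"
      by (rule sum.reindex_bij_witness[of _ "\<lambda>j. int d - j" "\<lambda>j. int d - j"]) auto
    then have 1: "v = (\<Sum>j\<in>{0..int d}. cmp (int d - j) v)" using sum_cmp[OF v] by simp
    have 2: "cmp (int d - j) v \<in> V \<and> Ki (cmp (int d - j) v) = scale (q powi (2 * j - int d)) (cmp (int d - j) v)"
      if "j \<in> {0..int d}" for j
    proof -
      have "cmp (int d - j) v \<in> wt (int d - j)" using cmp_wt[OF v] that by simp
      moreover have "int d - 2 * (int d - j) = 2 * j - int d" by simp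
      ultimately show ?thesis using wt_Ki wt_V by metis
    qed
    show "\<exists>u. (\<forall>j\<in>{0..int d}. u j \<in> V \<and> Ki (u j) = scale (q powi (2 * j - int d)) (u j))
        \<and> v = (\<Sum>j\<in>{0..int d}. u j)"
      by (rule exI[of _ "\<lambda>j. cmp (int d - j) v"], rule conjI[OF ballI[OF 2] 1])
  qed
qed

lemma swapped_wt: "uq_graded.wt scale q V Ki d j = wt (int d - j)"
proof -
  interpret sw: uq_graded scale q V Ki K a A b B d by (rule swapped_graded)
  have "v \<in> wt (int d - j)" if v: "v \<in> sw.wt j" for v
    using sw.wt_Ki[OF v] sw.wt_V[OF v] by (simp add: wt_def)
  moreover have "v \<in> sw.wt j" if v: "v \<in> wt (int d - j)" for v
    using wt_Ki[OF v] wt_V[OF v] by (simp add: sw.wt_def)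
  ultimately show ?thesis by blast
qed

text \<open>
  \<open>A\<close>, \<open>b\<close> and \<open>K\<close> satisfy the relations of \<open>U\<^sub>q(sl\<^sub>2)\<close>. From the commutation of \<open>b\<close> with powers of \<open>A\<close> it follows by induction
  on the weight that \<open>A\<^sup>n\<close> is injective on \<open>wt i\<close> for \<open>n \<le> d - 2i\<close>, as in the hard Lefschetz theorem.
\<close>

lemma A_pow_b:
  "v \<in> wt i \<Longrightarrow> (A ^^ Suc n) (b v) = b ((A ^^ Suc n) v) + scale (qi (int n + 1) * qi (2 * i - int d + int n)) ((A ^^ n) v)"
proof (induction n)
  case 0
  have "qi 1 = 1" using qd_nonzero by (simp add: qi_def power_int_minus)
  then show ?case using wt_Ab[OF 0] by simp
next
  case (Suc n)
  let ?m = "2 * i - int d + int n"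
  have "(A ^^ Suc (Suc n)) (b v) = A (b ((A ^^ Suc n) v) + scale (qi (int n + 1) * qi ?m) ((A ^^ n) v))"
    using Suc by simp
  also have "\<dots> = b ((A ^^ Suc (Suc n)) v)
      + scale (qi (2 * (i + int (Suc n)) - int d) + qi (int n + 1) * qi ?m) ((A ^^ Suc n) v)"
    using wt_Ab[OF wt_pow(1)[OF Suc.prems, of "Suc n"]] by (simp add: L scale_left_distrib)
  also have "qi (2 * (i + int (Suc n)) - int d) + qi (int n + 1) * qi ?m = qi (int (Suc n) + 1) * qi (2 * i - int d + int (Suc n))"
    using qi_identity[of "int n + 1" ?m] by (simp add: algebra_simps)
  finally show ?case .
qed

lemma A_pow_inj:
  assumes "v \<in> wt i" "(A ^^ n) v = 0" "int n \<le> int d - 2 * i"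
  shows "v = 0"
proof (cases "i < 0")
  case True
  then show ?thesis using wt_outside[OF assms(1)] by simp
next
  case False
  then obtain k where "i = int k" using nonneg_int_cases by (metis not_less)
  have "v \<in> wt (int k) \<Longrightarrow> (A ^^ n) v = 0 \<Longrightarrow> int n \<le> int d - 2 * int k \<Longrightarrow> v = 0" for k
  proof (induction k arbitrary: v n)
    case k: 0
    show ?case
      using k
    proof (induction n)
      case (Suc n)
      have "b v = 0" using wt_outside[OF wt_shift(4)[OF Suc.prems(1)]] by simp
      then have "scale (qi (int n + 1) * qi (2 * int 0 - int d + int n)) ((A ^^ n) v) = 0"
        using A_pow_b[OF Suc.prems(1), of n] Suc.prems(2) by (simp add: L lin_zero[OF lin_pow[OF lin(3)]])
      moreover have "qi (int n + 1) * qi (2 * int 0 - int d + int n) \<noteq> 0"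
        using Suc.prems(3) by (simp add: qi_zero_iff)
      ultimately have "(A ^^ n) v = 0" by simp
      then show ?case using Suc by simp
    qed simp
  next
    case k: (Suc k)
    show ?case
      using k.prems
    proof (induction n)
      case (Suc n)
      have "(A ^^ Suc (Suc n)) (b v) = 0"
        using A_pow_b[OF Suc.prems(1), of "Suc n"] Suc.prems(2) by (simp add: L)
      moreover have "b v \<in> wt (int k)" using wt_shift(4)[OF Suc.prems(1)] by simp
      ultimately have "b v = 0" using Suc.prems(3) by (intro k.IH[of "b v" "Suc (Suc n)"]) auto
      then have "scale (qi (int n + 1) * qi (2 * int (Suc k) - int d + int n)) ((A ^^ n) v) = 0"
        using A_pow_b[OF Suc.prems(1), of n] Suc.prems(2) by (simp add: L lin_zero[OF lin_pow[OF lin(3)]])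
      moreover have "qi (int n + 1) * qi (2 * int (Suc k) - int d + int n) \<noteq> 0"
        using Suc.prems(3) by (simp add: qi_zero_iff)
      ultimately have "(A ^^ n) v = 0" by simp
      then show ?case using Suc by simp
    qed simp
  qed
  then show ?thesis using assms \<open>i = int k\<close> by simp
qed

lemma a_pow_inj:
  assumes "v \<in> wt i" "(a ^^ n) v = 0" "int n \<le> 2 * i - int d"
  shows "v = 0"
proof -
  interpret sw: uq_graded scale q V Ki K a A b B d by (rule swapped_graded)
  show ?thesis using assms by (intro sw.A_pow_inj[of v "int d - i" n]) (simp_all add: swapped_wt)
qed

text \<open>
  A subspace that is stable under \<open>K\<close>, \<open>A\<close> and \<open>a\<close> satisfies \<open>A\<^sup>n W\<^sub>i = W\<^sub>d\<^sub>-\<^sub>i\<close> for \<open>n = d - 2i \<ge> 0\<close>, because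
  both \<open>A\<^sup>n\<close> and \<open>a\<^sup>n\<close> are injective there.
\<close>

lemma A_pow_surj:
  assumes W: "subspace W" "W \<subseteq> V" "maps_into W A" "maps_into W a"
    and n: "int n = int d - 2 * i" and w: "w \<in> W" "w \<in> wt (int d - i)"
  shows "\<exists>w'\<in>W. w' \<in> wt i \<and> (A ^^ n) w' = w"
proof -
  let ?S = "W \<inter> wt (int d - i)" and ?T = "\<lambda>v. (A ^^ n) ((a ^^ n) v)"
  obtain S where S: "finite S" "V \<subseteq> span S" using finite_dim by blast
  have shift: "(a ^^ n) v \<in> wt i" if "v \<in> wt (int d - i)" for v
    using wt_pow(2)[OF that, of n] n by (simp add: algebra_simps)
  have lT: "lin ?T" by (rule lin_comp[OF lin_pow[OF lin(3)] lin_pow[OF lin(4)]])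
  have "maps_into ?S ?T"
    unfolding maps_into_def
  proof
    fix v assume v: "v \<in> ?S"
    have "(A ^^ n) ((a ^^ n) v) \<in> wt (i + int n)" using shift v by (intro wt_pow) auto
    then show "(A ^^ n) ((a ^^ n) v) \<in> ?S" using v W n by (auto intro!: maps_into_pow)
  qed
  moreover have "v = 0" if "v \<in> ?S" "?T v = 0" for v
  proof -
    have "(a ^^ n) v = 0" using that shift n by (intro A_pow_inj[of "(a ^^ n) v" i n]) auto
    then show "v = 0" using that n by (intro a_pow_inj[of v "int d - i" n]) auto
  qed
  ultimately have "\<exists>v\<in>?S. ?T v = w"
    using W(1,2) S w wt_subspace by (intro injective_imp_surjective[OF lT _ _ S(1)]) (auto intro: subspace_inter)
  then obtain v where v: "v \<in> W" "v \<in> wt (int d - i)" "(A ^^ n) ((a ^^ n) v) = w" by blast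
  show ?thesis
    by (rule bexI[of _ "(a ^^ n) v"]) (use v shift maps_into_pow[OF W(4)] in auto)
qed

text \<open>
  In the lower half of the weights, a vector of \<open>W\<close> is corrected by \<open>A w'\<close> with \<open>w'\<close> in \<open>W\<close> such that the difference
  is killed by \<open>A\<^sup>n\<^sup>+\<^sup>1\<close>, \<open>n = d - 2i\<close>; then \<open>b\<close> kills it too. The upper half is the image of the lower half under powers of \<open>A\<close>.
\<close>

lemma stable_under_b:
  assumes W: "subspace W" "W \<subseteq> V" "maps_into W K" "maps_into W A" "maps_into W a"
  shows "maps_into W b"
proof -
  have low: "w \<in> W \<Longrightarrow> w \<in> wt (int k) \<Longrightarrow> 2 * int k \<le> int d \<Longrightarrow> b w \<in> W" for k w
  proof (induction k arbitrary: w)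
    case 0
    then have "b w = 0" using wt_outside[OF wt_shift(4)[of w 0]] by simp
    then show ?case using W(1) subspace_0 by simp
  next
    case (Suc k)
    define n where "n = d - 2 * Suc k"
    have n: "int n = int d - 2 * int (Suc k)" using Suc.prems(3) by (simp add: n_def)
    have "(A ^^ Suc n) w \<in> wt (int d - int k)"
      using wt_pow(1)[OF Suc.prems(2), of "Suc n"] n by (simp add: algebra_simps)
    moreover have "(A ^^ Suc n) w \<in> W" using W(4) Suc.prems(1) by (rule maps_into_pow)
    ultimately obtain w' where w': "w' \<in> W" "w' \<in> wt (int k)" "(A ^^ Suc (Suc n)) w' = (A ^^ Suc n) w"
      using A_pow_surj[OF W(1,2,4,5), of "Suc (Suc n)" "int k" "(A ^^ Suc n) w"] n by auto
    \<comment> \<open>subtracting \<open>A w'\<close> leaves a vector killed by \<open>b\<close>\<close>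
    define u where "u = w - A w'"
    have u: "u \<in> wt (int (Suc k))"
      using wt_shift(1)[OF w'(2)] Suc.prems(2) wt_subspace by (auto simp: u_def add.commute intro: subspace_diff)
    have Au: "(A ^^ Suc n) u = 0"
      using w'(3) by (simp add: u_def lin_diff[OF lin_pow[OF lin(3)]] L funpow_swap1)
    have z: "2 * int (Suc k) - int d + int n = 0" using n by simp
    have "(A ^^ Suc n) (b u) = 0"
      unfolding A_pow_b[OF u, of n] Au z using qi_zero_iff[of 0] by (simp add: L)
    then have "b u = 0"
      using wt_shift(4)[OF u] n by (intro A_pow_inj[of "b u" "int k" "Suc n"]) auto
    moreover have "b (A w') = A (b w') - scale (qi (2 * int k - int d)) w'"
      using wt_Ab[OF w'(2)] by simp
    moreover have "b w' \<in> W" using Suc.IH[OF w'(1,2)] Suc.prems(3) by simp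
    ultimately have "b w = A (b w') - scale (qi (2 * int k - int d)) w'" "b w' \<in> W"
      by (simp_all add: u_def L)
    then show ?case using W(1,4) w'(1) by (auto simp: maps_into_def intro: subspace_diff subspace_scale)
  qed
  have hom: "b w \<in> W" if w: "w \<in> W" "w \<in> wt j" for w j
  proof (cases "j \<in> {0..int d} \<and> 2 * j > int d")
    case False
    show ?thesis
    proof (cases "j \<in> {0..int d}")
      case True
      then obtain k where "j = int k" using nonneg_int_cases by auto
      then show ?thesis using low[of w k] w False True by auto
    next
      case False
      then have "w = 0" using wt_outside w by blast
      then show ?thesis using W(1) by (simp add: L subspace_0)
    qed
  next
    case True
    then obtain n where n: "int (Suc n) = 2 * j - int d" using zero_less_imp_eq_int[of "2 * j - int d"] by (metis diff_gt_0_iff_gt gr0_conv_Suc)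
    obtain k where k: "int d - j = int k" using True nonneg_int_cases by (metis atLeastAtMost_iff diff_ge_0_iff_ge)
    obtain w' where w': "w' \<in> W" "w' \<in> wt (int k)" "(A ^^ Suc n) w' = w"
    proof -
      have "int (Suc n) = int d - 2 * int k" "w \<in> wt (int d - int k)" using n k w by (auto simp: algebra_simps)
      then show ?thesis using A_pow_surj[OF W(1,2,4,5), of "Suc n" "int k" w] w(1) that by blast
    qed
    have "b w' \<in> W" using low[OF w'(1,2)] True k by auto
    then have "(A ^^ Suc n) (b w') \<in> W" using W(4) by (intro maps_into_pow)
    moreover have "(A ^^ n) w' \<in> W" using W(4) w'(1) by (intro maps_into_pow)
    moreover have "b w = (A ^^ Suc n) (b w') - scale (qi (int n + 1) * qi (2 * int k - int d + int n)) ((A ^^ n) w')"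
      using A_pow_b[OF w'(2), of n] w'(3) by simp
    ultimately show ?thesis using W(1) by (simp add: subspace_diff subspace_scale)
  qed
  show ?thesis
    unfolding maps_into_def
  proof
    fix w assume w: "w \<in> W"
    have wV: "w \<in> V" using w W(2) by auto
    have "b w = (\<Sum>j\<in>{0..int d}. b (cmp j w))" using sum_cmp[OF wV] by (metis lin_sum[OF lin(6)])
    also have "\<dots> \<in> W"
      using hom[OF cmp_closed[OF W(1,3) w] cmp_wt[OF wV]] W(1) by (intro subspace_sum) auto
    finally show "b w \<in> W" .
  qed
qed

lemma maps_into_Ki:
  assumes W: "subspace W" "W \<subseteq> V" "maps_into W K"
  shows "maps_into W Ki"
  unfolding maps_into_def
proof
  fix w assume w: "w \<in> W"
  have wV: "w \<in> V" using w W(2) by auto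
  have "Ki w = (\<Sum>j\<in>{0..int d}. Ki (cmp j w))" using sum_cmp[OF wV] by (metis lin_sum[OF lin(2)])
  also have "\<dots> = (\<Sum>j\<in>{0..int d}. scale (q powi (int d - 2 * j)) (cmp j w))"
    using wt_Ki[OF cmp_wt[OF wV]] by (intro sum.cong) auto
  also have "\<dots> \<in> W"
    using cmp_closed[OF W(1,3) w] W(1) by (intro subspace_sum subspace_scale) auto
  finally show "Ki w \<in> W" .
qed

lemma stable_under_B:
  assumes W: "subspace W" "W \<subseteq> V" "maps_into W K" "maps_into W A" "maps_into W a"
  shows "maps_into W B"
proof -
  interpret sw: uq_graded scale q V Ki K a A b B d by (rule swapped_graded)
  show ?thesis using sw.stable_under_b[of W] W maps_into_Ki by blast
qed

end


section \<open>The lowest weight space of an irreducible module is a line\<close>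

lemma (in q_space) kline_cong: "kline m k f \<Longrightarrow> (\<And>r. r \<le> m \<Longrightarrow> f r = g r) \<Longrightarrow> kline m k g"
  unfolding kline_def by simp

context uq_graded
begin

definition \<sigma> :: "nat \<Rightarrow> 'b \<Rightarrow> 'b" where
  "\<sigma> j v = (a ^^ j) ((A ^^ j) v)"

lemma lin_\<sigma>: "lin (\<sigma> j)"
  unfolding \<sigma>_def[abs_def] by (rule lin_comp[OF lin_pow[OF lin(4)] lin_pow[OF lin(3)]])

lemma \<sigma>_wt: "v \<in> wt i \<Longrightarrow> \<sigma> j v \<in> wt i"
  using wt_pow(2)[OF wt_pow(1), of v i j j] by (simp add: \<sigma>_def)

lemma a_pow_zero: "v \<in> wt i \<Longrightarrow> i < int n \<Longrightarrow> (a ^^ n) v = 0"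
  by (rule wt_outside[OF wt_pow(2)]) auto

lemma maps_into_V: "maps_into V K" "maps_into V A" "maps_into V a"
  using inV by (auto simp: maps_into_def)

text \<open>
  Both sides are \<open>p\<close>-lines in \<open>r\<close>. By symmetry and induction on \<open>p\<close> they agree for \<open>r \<le> p\<close>, and for
  \<open>r > n - p\<close> they vanish because a weight becomes negative; that gives \<open>2p + 1\<close> coincidences, enough
  if \<open>2p \<le> n\<close>. For \<open>2p > n\<close> every \<open>r\<close> belongs to one of the two cases.
\<close>

lemma exchange:
  assumes u: "u \<in> wt 0" and "p \<le> n" "r \<le> n"
  shows "(a ^^ (n - r)) ((A ^^ p) ((a ^^ r) ((A ^^ (n - p)) u)))
       = (a ^^ (n - p)) ((A ^^ r) ((a ^^ p) ((A ^^ (n - r)) u)))"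
proof -
  define W where "W p r = (a ^^ (n - r)) ((A ^^ p) ((a ^^ r) ((A ^^ (n - p)) u)))" for p r
  have zero: "W p r = 0" if "n < p + r" "p \<le> n" for p r
  proof -
    have "(a ^^ r) ((A ^^ (n - p)) u) = 0"
      using that by (intro a_pow_zero[OF wt_pow(1)[OF u]]) auto
    then show ?thesis by (simp add: W_def lin_zero[OF lin_pow[OF lin(3)]] lin_zero[OF lin_pow[OF lin(4)]])
  qed
  have "p \<le> n \<Longrightarrow> r \<le> n \<Longrightarrow> W p r = W r p" for p r
  proof (induction p arbitrary: r rule: less_induct)
    case (less p)
    have agree: "W p r = W r p" if r: "r \<le> n" "r \<le> p \<or> n - p < r" for r
    proof -
      consider "r < p" | "r = p" | "n - p < r" using r by linarith
      then show ?thesis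
      proof cases
        case 1
        then show ?thesis using less.IH[of r p] less.prems by simp
      next
        case 3
        then show ?thesis using zero less.prems r by simp
      qed simp
    qed
    show ?case
    proof (cases "2 * p \<le> n")
      case False
      then show ?thesis using agree[of r] less.prems by linarith
    next
      case True
      have "kline n p (\<lambda>r. W p r)"
        unfolding W_def
        using serres(2) wt_V[OF wt_pow(1)[OF u]]
        by (intro kline_serre[OF sub lin(4) maps_into_V(3) lin(3) maps_into_V(2)]) auto
      moreover have "kline n p (\<lambda>r. W r p)"
      proof (rule kline_cong)
        have "kline n p (\<lambda>r. (A ^^ (n - r)) ((a ^^ p) ((A ^^ r) u)))"
          using serres(1) wt_V[OF u]
          by (intro kline_serre[OF sub lin(3) maps_into_V(2) lin(4) maps_into_V(3)]) auto
        from kline_image[OF lin_pow[OF lin(4)] kline_reverse[OF this], of "n - p"]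
        show "kline n p (\<lambda>r. (a ^^ (n - p)) ((A ^^ (n - (n - r))) ((a ^^ p) ((A ^^ (n - r)) u))))" .
      qed (simp add: W_def)
      ultimately have line: "kline n p (\<lambda>r. W p r - W r p)" by (rule kline_diff)
      have "W p r - W r p \<in> {0}"
      proof (rule kline_in_subspace[OF line _ _ _ _ less.prems(2)])
        show "{..p} \<union> {n - p<..n} \<subseteq> {..n}" using less.prems by auto
        have "card ({..p} \<union> {n - p<..n}) = card {..p} + card {n - p<..n}"
          using True by (intro card_Un_disjoint) auto
        then show "card ({..p} \<union> {n - p<..n}) = 2 * p + 1" using True by simp
        show "W p r - W r p \<in> {0}" if "r \<in> {..p} \<union> {n - p<..n}" for r
          using agree[of r] that less.prems by auto
      qed simp
      then show ?thesis by simp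
    qed
  qed
  then show ?thesis using assms by (simp add: W_def)
qed

lemma \<sigma>_commute: "u \<in> wt 0 \<Longrightarrow> \<sigma> i (\<sigma> j u) = \<sigma> j (\<sigma> i u)"
  using exchange[of u i "i + j" j] by (simp add: \<sigma>_def)

text \<open>
  \<open>alt True [i\<^sub>1, i\<^sub>2, i\<^sub>3, \<dots>]\<close> is the word in alternating powers of \<open>a\<close> and \<open>A\<close>, starting with \<open>a\<close>,
  that has these exponents, and \<open>alt False\<close> starts with a power of \<open>A\<close>;
  \<open>net\<close> is the weight of the word.
\<close>

fun alt :: "bool \<Rightarrow> nat list \<Rightarrow> 'b \<Rightarrow> 'b" where
  "alt c [] v = v"
| "alt True (i # is) v = (a ^^ i) (alt False is v)"
| "alt False (i # is) v = (A ^^ i) (alt True is v)"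

fun net :: "bool \<Rightarrow> nat list \<Rightarrow> int" where
  "net c [] = 0"
| "net True (i # is) = net False is - int i"
| "net False (i # is) = net True is + int i"

lemma alt_wt: "v \<in> wt k \<Longrightarrow> alt c is v \<in> wt (k + net c is)"
proof (induction c "is" v rule: alt.induct)
  case (2 i "is" v)
  then show ?case using wt_pow(2)[OF 2(1)[OF 2(2)], of i] by (simp add: algebra_simps)
next
  case (3 i "is" v)
  then show ?case using wt_pow(1)[OF 3(1)[OF 3(2)], of i] by (simp add: algebra_simps)
qed simp

lemma lin_alt: "lin (alt c is)"
proof (induction "is" arbitrary: c)
  case Nil
  then show ?case by (simp add: lin_def)
next
  case (Cons i "is")
  have "alt True (i # is) = (\<lambda>v. (a ^^ i) (alt False is v))" "alt False (i # is) = (\<lambda>v. (A ^^ i) (alt True is v))"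
    by auto
  then show ?case
    using lin_comp[OF lin_pow[OF lin(4)] Cons[of False], of i] lin_comp[OF lin_pow[OF lin(3)] Cons[of True], of i]
    by (cases c) simp_all
qed

lemma alt_append: "alt c (xs @ ys) v = alt c xs (alt (if even (length xs) then c else \<not> c) ys v)"
  by (induction c xs v rule: alt.induct) auto

lemma net_append: "net c (xs @ ys) = net c xs + net (if even (length xs) then c else \<not> c) ys"
proof (induction xs arbitrary: c)
  case (Cons x xs)
  then show ?case by (cases c) auto
qed simp

text \<open>
  Every balanced word in \<open>A\<close> and \<open>a\<close> preserves a subspace of the lowest weight space that all
  \<open>a\<^sup>jA\<^sup>j\<close> preserve. An exponent \<open>k\<close> inside the word, together with its two neighbours \<open>x\<close> and \<open>y\<close>, lies
  on a \<open>k\<close>-line obtained by varying \<open>x\<close> and \<open>y\<close> with a fixed sum. On this line, \<open>2k + 1\<close> words are known: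
  those with \<open>y < k\<close> or \<open>x < k\<close> contain a smaller exponent or pass through a negative weight, and the
  one with \<open>x = k\<close> has an exponent \<open>k\<close> further to the left or splits off the factor \<open>a\<^sup>kA\<^sup>k\<close>.
\<close>

lemma balanced_word:
  assumes S: "subspace S" "S \<subseteq> wt 0" "\<And>j. maps_into S (\<sigma> j)" and v: "v \<in> S"
  shows "length is = 2 * n \<Longrightarrow> net True is = 0 \<Longrightarrow> alt True is v \<in> S"
proof (induction n arbitrary: "is")
  case 0
  then show ?case using v by simp
next
  case outer: (Suc n)
  have v0: "v \<in> wt 0" using v S by auto
  have inner: "alt True is v \<in> S"
    if "1 \<le> s" "s + 2 \<le> 2 * Suc n" "is ! s = k" "length is = 2 * Suc n" "net True is = 0" for k s "is"
    using that
  proof (induction k arbitrary: s "is" rule: less_induct)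
    case smaller: (less k)
    show ?case
      using smaller.prems
    proof (induction s arbitrary: "is" rule: less_induct)
      case (less s)
      define pre post x y where "pre = take (s - 1) is" and "post = drop (s + 2) is"
        and "x = is ! (s - 1)" and "y = is ! (s + 1)"
      have lpre: "length pre = s - 1" and lpost: "length post + (s + 2) = 2 * Suc n"
        using less.prems by (auto simp: pre_def post_def)
      have split: "is = pre @ x # k # y # post"
      proof -
        have "drop (s - 1) is = is ! (s - 1) # drop s is"
          using less.prems Cons_nth_drop_Suc[of "s - 1" "is"] by simp
        moreover have "drop s is = is ! s # is ! (s + 1) # drop (s + 2) is"
          using less.prems Cons_nth_drop_Suc[of s "is"] Cons_nth_drop_Suc[of "Suc s" "is"] by simp
        ultimately have "drop (s - 1) is = x # k # y # post"
          using less.prems by (simp add: x_def y_def post_def)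
        then show ?thesis unfolding pre_def by (metis append_take_drop_id)
      qed
      define m where "m = x + y"
      define vary where "vary r = pre @ (m - r) # k # r # post" for r
      have vary_y: "is = vary y" by (simp add: vary_def m_def split)
      have len: "length (vary r) = 2 * Suc n" for r
        using lpre lpost less.prems(1) by (simp add: vary_def)
      have net: "net True (vary r) = 0" if "r \<le> m" for r
      proof -
        have "net c ((m - r) # k # r # post) = net c (x # k # y # post)" for c
          using that by (cases c) (auto simp: m_def)
        then show ?thesis using less.prems(5) unfolding vary_def split net_append by presburger
      qed
      have nth: "vary r ! (s - 1) = m - r" "vary r ! (s + 1) = r" for r
        using lpre less.prems(1) by (auto simp: vary_def nth_append nth_Cons')
      have right: "alt True (vary r) v \<in> S" if "r < k" "r \<le> m" for r
      proof (cases "s + 3 \<le> 2 * Suc n")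
        case True
        show ?thesis
          by (rule smaller.IH[of r "s + 1"]) (use that True nth len net in auto)
      next
        case False
        then have s: "s + 2 = 2 * Suc n" using less.prems(2) by simp
        then have "post = []" "odd (length pre)" using lpost lpre less.prems(1) by simp_all
        moreover have "(a ^^ k) ((A ^^ r) v) = 0"
          using that by (intro a_pow_zero[OF wt_pow(1)[OF v0]]) auto
        ultimately have "alt True (vary r) v = 0"
          by (simp add: vary_def alt_append lin_zero[OF lin_pow[OF lin(3)]] lin_zero[OF lin_alt])
        then show ?thesis using S(1) subspace_0 by simp
      qed
      have left_small: "alt True (vary r) v \<in> S" if "m - r < k" "r \<le> m" for r
      proof (cases "s = 1")
        case False
        show ?thesis
          by (rule smaller.IH[of "m - r" "s - 1"]) (use that False nth len net less.prems in auto)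
      next
        case True
        then have pre: "pre = []" using lpre by simp
        have "alt True (r # post) v \<in> wt (0 + net True (r # post))" by (rule alt_wt[OF v0])
        moreover have "net True (r # post) = int (m - r) - int k"
          using net[OF that(2)] by (simp add: vary_def pre)
        ultimately have "alt True (r # post) v = 0" using that by (intro wt_outside) auto
        then have "alt True (vary r) v = 0"
          by (simp add: vary_def pre lin_zero[OF lin_pow[OF lin(3)]] lin_zero[OF lin_pow[OF lin(4)]])
        then show ?thesis using S(1) subspace_0 by simp
      qed
      have left_equal: "alt True (vary r) v \<in> S" if "m - r = k" "r \<le> m" for r
      proof (cases "s = 1")
        case False
        show ?thesis
          by (rule less.IH[of "s - 1"]) (use that False nth len net less.prems in auto)
      next
        case True
        then have pre: "pre = []" using lpre by simp
        have "net True (r # post) = 0" using net[OF that(2)] that(1) by (simp add: vary_def pre)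
        moreover have "length (r # post) = 2 * n" using lpost True by simp
        ultimately have "alt True (r # post) v \<in> S" using outer.IH by blast
        moreover have "alt True (vary r) v = \<sigma> k (alt True (r # post) v)"
          by (simp add: vary_def pre that \<sigma>_def)
        ultimately show ?thesis using S(3) by (auto simp: maps_into_def)
      qed
      show ?case
      proof (cases "x < k \<or> y < k")
        case True
        then show ?thesis using right[of y] left_small[of y] unfolding vary_y by (auto simp: m_def)
      next
        case False
        let ?c = "even (length pre)"
        have "kline m k (\<lambda>r. alt ?c ((m - r) # k # [r]) (alt (\<not> ?c) post v))"
        proof (cases ?c)
          case True
          then show ?thesis
            using kline_serre[OF sub lin(4) maps_into_V(3) lin(3) maps_into_V(2) serres(2) wt_V[OF alt_wt[OF v0]], of m k False post]
            by simp
        next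
          case False
          then show ?thesis
            using kline_serre[OF sub lin(3) maps_into_V(2) lin(4) maps_into_V(3) serres(1) wt_V[OF alt_wt[OF v0]], of m k True post]
            by simp
        qed
        from kline_image[OF lin_alt[of True pre] this]
        have "kline m k (\<lambda>r. alt True (vary r) v)"
          unfolding vary_def alt_append by (cases ?c) simp_all
        then have "alt True (vary y) v \<in> S"
        proof (rule kline_in_subspace[OF _ S(1)])
          show "{..<k} \<union> {m - k..m} \<subseteq> {..m}" using False by (auto simp: m_def)
          have "card ({..<k} \<union> {m - k..m}) = card {..<k} + card {m - k..m}"
            using False by (intro card_Un_disjoint) (auto simp: m_def)
          then show "card ({..<k} \<union> {m - k..m}) = 2 * k + 1" using False by (simp add: m_def)
          show "alt True (vary r) v \<in> S" if r: "r \<in> {..<k} \<union> {m - k..m}" for r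
          proof -
            consider "r < k" "r \<le> m" | "m - r < k" "r \<le> m" | "m - r = k" "r \<le> m"
              using r False by (fastforce simp: m_def)
            then show ?thesis using right left_small left_equal by cases auto
          qed
          show "y \<le> m" by (simp add: m_def)
        qed
        then show ?thesis by (simp add: vary_y)
      qed
    qed
  qed
  show ?case
  proof (cases n)
    case 0
    then obtain i j where ij: "is = [i, j]" using outer.prems(1) by (auto simp: length_Suc_conv eval_nat_numeral)
    then have "i = j" using outer.prems(2) by (simp add: ij)
    then show ?thesis using ij S(3) v by (auto simp: \<sigma>_def maps_into_def)
  next
    case (Suc n')
    then show ?thesis using inner[of 1 "is"] outer.prems by simp
  qed
qed

end

locale uq_irreducible = uq_graded scale q V K Ki A a B b d
  for scale :: "'a::field \<Rightarrow> 'b::ab_group_add \<Rightarrow> 'b" and q :: 'a and V K Ki A a B b d +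
  assumes irred: "\<And>W. subspace W \<Longrightarrow> W \<subseteq> V \<Longrightarrow> maps_into W K \<Longrightarrow> maps_into W Ki \<Longrightarrow> maps_into W A \<Longrightarrow>
      maps_into W a \<Longrightarrow> maps_into W B \<Longrightarrow> maps_into W b \<Longrightarrow> W = {0} \<or> W = V"
    and nonzero: "\<And>j. 0 \<le> j \<Longrightarrow> j \<le> int d \<Longrightarrow> \<exists>v\<in>V. v \<noteq> 0 \<and> K v = scale (q powi (2 * j - int d)) v"
begin

lemma swapped_irreducible: "uq_irreducible scale q V Ki K a A b B d"
proof -
  interpret sw: uq_graded scale q V Ki K a A b B d by (rule swapped_graded)
  show ?thesis
  proof unfold_locales
    fix j assume j: "0 \<le> j" "j \<le> int d"
    then obtain v where v: "v \<in> V" "v \<noteq> 0" "v \<in> wt (int d - j)"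
      using nonzero[of "int d - j"] by (auto simp: wt_def)
    then have "v \<in> sw.wt j" by (simp add: swapped_wt)
    then show "\<exists>v\<in>V. v \<noteq> 0 \<and> Ki v = scale (q powi (2 * j - int d)) v"
      using v by (auto simp: sw.wt_def)
  qed (use irred in auto)
qed

lemma irreducible_under_raising:
  assumes "subspace W" "W \<subseteq> V" "maps_into W K" "maps_into W A" "maps_into W a" "W \<noteq> {0}"
  shows "W = V"
  using irred[OF assms(1-3) _ assms(4,5)] stable_under_b[OF assms(1-5)] stable_under_B[OF assms(1-5)]
    maps_into_Ki[OF assms(1-3)] assms(6) by blast

text \<open>
  A common eigenvector \<open>u\<close> of the operators \<open>a\<^sup>jA\<^sup>j\<close> spans a line preserved by all balanced words. As the words in \<open>A\<close> and
  \<open>a\<close> applied to \<open>u\<close> span the module, the projection to the lowest weight space maps it onto this line.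
\<close>

lemma lowest_weight_line: "\<exists>u. u \<in> wt 0 \<and> u \<noteq> 0 \<and> wt 0 = span {u} \<and> (\<forall>j. \<exists>s. \<sigma> j u = scale s u)"
proof -
  have wt0: "wt 0 \<noteq> {0}" using nonzero[of 0] by (auto simp: wt_def)
  obtain F where F: "finite F" "V \<subseteq> span F" using finite_dim by blast
  have "\<exists>v\<in>wt 0. v \<noteq> 0 \<and> (\<forall>i<Suc d. \<exists>s. \<sigma> i v = scale s v)"
    by (rule common_eigenvector[OF closed_field lin_\<sigma> _ \<sigma>_commute wt_subspace wt0 F(1)])
       (use \<sigma>_wt F(2) wt_V in \<open>auto simp: maps_into_def\<close>)
  then obtain u where u: "u \<in> wt 0" "u \<noteq> 0" "\<And>i. i < Suc d \<Longrightarrow> \<exists>s. \<sigma> i u = scale s u" by blast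
  have eig: "\<exists>s. \<sigma> j u = scale s u" for j
  proof (cases "j < Suc d")
    case False
    have "(A ^^ j) u = 0" using False by (intro wt_outside[OF wt_pow(1)[OF u(1)]]) auto
    then have "\<sigma> j u = scale 0 u" by (simp add: \<sigma>_def lin_zero[OF lin_pow[OF lin(4)]])
    then show ?thesis by blast
  qed (use u in blast)
  let ?S = "span {u}"
  have S: "subspace ?S" "?S \<subseteq> wt 0"
    using u(1) by (auto intro: span_minimal[THEN subsetD, OF _ wt_subspace])
  have S\<sigma>: "maps_into ?S (\<sigma> j)" for j
  proof -
    obtain s where "\<sigma> j u = scale s u" using eig by blast
    then show ?thesis
      unfolding maps_into_def by (auto simp: span_singleton lin_scale[OF lin_\<sigma>])
  qed
  define G where "G = {alt True is u | is. even (length is)}"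
  have GV: "G \<subseteq> V" using wt_V[OF alt_wt[OF u(1)]] by (auto simp: G_def)
  have gen: "maps_into (span G) f" if f: "lin f" "\<And>v. v \<in> G \<Longrightarrow> f v \<in> span G" for f
    using span_image_subset[OF f(1) subspace_span f(2)] by (auto simp: maps_into_def)
  have "maps_into (span G) K"
  proof (rule gen[OF lin(1)])
    fix v assume v: "v \<in> G"
    then obtain "is" where "v = alt True is u" by (auto simp: G_def)
    then show "K v \<in> span G" using wt_K[OF alt_wt[OF u(1)]] v by (auto intro: span_scale span_base)
  qed
  moreover have "maps_into (span G) A"
  proof (rule gen[OF lin(3)])
    fix v assume "v \<in> G"
    then obtain "is" where "even (length is)" "v = alt True is u" by (auto simp: G_def)
    \<comment> \<open>an exponent \<open>0\<close> keeps the length even\<close>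
    then have "A v \<in> G" unfolding G_def by (intro CollectI exI[of _ "0 # 1 # is"]) simp
    then show "A v \<in> span G" by (rule span_base)
  qed
  moreover have "maps_into (span G) a"
  proof (rule gen[OF lin(4)])
    fix v assume "v \<in> G"
    then obtain "is" where "even (length is)" "v = alt True is u" by (auto simp: G_def)
    then have "a v \<in> G" unfolding G_def by (intro CollectI exI[of _ "1 # 0 # is"]) simp
    then show "a v \<in> span G" by (rule span_base)
  qed
  moreover have "u \<in> span G" by (rule span_base) (auto simp: G_def intro: exI[of _ "[]"])
  then have "span G \<noteq> {0}" using u(2) by auto
  ultimately have full: "span G = V"
    using GV sub by (intro irreducible_under_raising) (auto intro: span_minimal[THEN subsetD])
  have "cmp 0 v \<in> ?S" if "v \<in> span G" for v
  proof (rule span_image_subset[OF lin_cmp S(1) _ that])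
    fix v assume "v \<in> G"
    then obtain "is" where w: "even (length is)" "v = alt True is u" by (auto simp: G_def)
    have vw: "v \<in> wt (net True is)" using alt_wt[OF u(1), of True "is"] w by simp
    show "cmp 0 v \<in> ?S"
    proof (cases "net True is = 0")
      case True
      then have "v \<in> ?S"
        using balanced_word[OF S S\<sigma> span_base[of u], of "is" "length is div 2"] w by simp
      moreover have "cmp 0 v = v" using vw True by (simp add: cmp_eigen)
      ultimately show ?thesis by simp
    next
      case False
      have "cmp 0 v = 0"
        using cmp_eigen[OF vw] wt_outside[OF vw] False lin_zero[OF lin_cmp]
        by (cases "net True is \<in> {0..int d}") auto
      then show ?thesis by (simp add: span_zero)
    qed
  qed
  moreover have "cmp 0 v = v" if "v \<in> wt 0" for v using that by (simp add: cmp_eigen)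
  ultimately have "wt 0 \<subseteq> ?S" using full wt_V by (metis subsetI)
  then show ?thesis using S(2) u eig by blast
qed

end


section \<open>Eigenspace flags of a \<open>\<box>\<^sub>q\<close>-module\<close>

lemma four_shift: "(i::4) + 2 + 2 = i" "(i::4) + 3 + 1 = i" "(i::4) + 2 + 3 = i + 1" "(i::4) + 2 + 1 = i + 3"
  using exhaust_4[of i] by (auto simp: four_eq_zero)

lemma cover_4: "(l::4) = i \<or> l = i + 1 \<or> l = i + 2 \<or> l = i + 3"
  using exhaust_4[of "l - i"] by (auto simp: algebra_simps)

context ambient_space
begin

lemma span_Union_sum:
  assumes "finite J" "\<And>j. j \<in> J \<Longrightarrow> subspace (U j)" "v \<in> span (\<Union>j\<in>J. U j)"
  shows "\<exists>u. (\<forall>j\<in>J. u j \<in> U j) \<and> v = (\<Sum>j\<in>J. u j)"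
proof -
  let ?Z = "{v. \<exists>u. (\<forall>j\<in>J. u j \<in> U j) \<and> v = (\<Sum>j\<in>J. u j)}"
  have "subspace ?Z"
    unfolding subspace_def
  proof (intro conjI ballI allI)
    show "0 \<in> ?Z" using assms(2) subspace_0 by (auto intro!: exI[of _ "\<lambda>_. 0"])
    show "v + w \<in> ?Z" if vw: "v \<in> ?Z" "w \<in> ?Z" for v w
    proof -
      obtain u u' where "\<forall>j\<in>J. u j \<in> U j" "v = (\<Sum>j\<in>J. u j)" "\<forall>j\<in>J. u' j \<in> U j" "w = (\<Sum>j\<in>J. u' j)"
        using vw by blast
      then show ?thesis
        using assms(2) subspace_add by (auto intro!: exI[of _ "\<lambda>j. u j + u' j"] simp: sum.distrib)
    qed
    show "scale c v \<in> ?Z" if v: "v \<in> ?Z" for c v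
    proof -
      obtain u where "\<forall>j\<in>J. u j \<in> U j" "v = (\<Sum>j\<in>J. u j)" using v by blast
      then show ?thesis
        using assms(2) subspace_scale by (auto intro!: exI[of _ "\<lambda>j. scale c (u j)"] simp: scale_sum_right)
    qed
  qed
  moreover have "(\<Union>j\<in>J. U j) \<subseteq> ?Z"
  proof safe
    fix j v assume j: "j \<in> J" "v \<in> U j"
    have "v = (\<Sum>i\<in>J. if i = j then v else 0)" using assms(1) j by simp
    then show "\<exists>u. (\<forall>i\<in>J. u i \<in> U i) \<and> v = (\<Sum>i\<in>J. u i)"
      using j assms(2) subspace_0 by (intro exI[of _ "\<lambda>i. if i = j then v else 0"]) auto
  qed
  ultimately have "span (\<Union>j\<in>J. U j) \<subseteq> ?Z" by (intro span_minimal)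
  then show ?thesis using assms(3) by auto
qed

lemma maps_into_span_Union:
  assumes T: "lin T" and step: "\<And>j v. v \<in> S j \<Longrightarrow> \<exists>\<alpha> i. T v - scale \<alpha> v \<in> S i"
  shows "maps_into (span (\<Union>j. S j)) T"
  unfolding maps_into_def
proof
  fix v assume v: "v \<in> span (\<Union>j. S j)"
  show "T v \<in> span (\<Union>j. S j)"
  proof (rule span_image_subset[OF T subspace_span _ v])
    fix v assume "v \<in> (\<Union>j. S j)"
    then obtain j where j: "v \<in> S j" by blast
    obtain \<alpha> i where i: "T v - scale \<alpha> v \<in> S i" using step[OF j] by blast
    have "T v - scale \<alpha> v \<in> span (\<Union>j. S j)" "scale \<alpha> v \<in> span (\<Union>j. S j)"
      using i j by (auto intro: span_base span_scale)
    then show "T v \<in> span (\<Union>j. S j)" using span_add by fastforce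
  qed
qed

end

locale box_ops = q_space scale q
  for scale :: "'a::field \<Rightarrow> 'b::ab_group_add \<Rightarrow> 'b" and q :: 'a +
  fixes V :: "'b set" and x :: "4 \<Rightarrow> 'b \<Rightarrow> 'b" and d :: nat
  assumes sub: "subspace V" and lin: "\<And>i. lin (x i)" and inV: "\<And>i v. x i v \<in> V"
    and weyl: "\<And>i. qweyl V (x i) (x (i + 1))" and serre: "\<And>i. qserre V (x i) (x (i + 2))"
begin

definition E :: "4 \<Rightarrow> int \<Rightarrow> 'b set" where
  "E i j = {v\<in>V. x i v = scale (q powi (2 * j - int d)) v}"

definition F :: "4 \<Rightarrow> int \<Rightarrow> 'b set" where
  "F i j = span (\<Union>k\<in>{..j}. E i k)"

lemma E_subspace: "subspace (E i j)"
  using sub unfolding E_def subspace_def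
  by (auto simp: lin_simps[OF lin] scale_right_distrib mult.commute)

lemma F_subspace: "subspace (F i j)"
  by (simp add: F_def)

lemma E_subset_F: "k \<le> j \<Longrightarrow> E i k \<subseteq> F i j"
  unfolding F_def by (auto intro!: span_base)

lemma F_mono: "j \<le> j' \<Longrightarrow> F i j \<subseteq> F i j'"
  unfolding F_def by (intro span_mono UN_mono) auto

lemma F_subset_V: "F i j \<subseteq> V"
  unfolding F_def by (rule span_minimal[OF _ sub]) (auto simp: E_def)

text \<open>
  The \<open>q\<close>-Weyl relations say how the neighbours \<open>x\<^sub>i\<^sub>+\<^sub>1\<close> and \<open>x\<^sub>i\<^sub>-\<^sub>1 = x\<^sub>i\<^sub>+\<^sub>3\<close> move the eigenspaces of \<open>x\<^sub>i\<close>; the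
  \<open>q\<close>-Serre relation does the same for the opposite generator.
\<close>

lemma next_E:
  assumes v: "v \<in> E i j"
  shows "x (i + 1) v - scale (q powi (int d - 2 * j)) v \<in> E i (j - 1)"
proof -
  let ?t = "q powi (2 * j - int d)" and ?t' = "q powi (int d - 2 * j)"
  have vV: "v \<in> V" and xv: "x i v = scale ?t v" using v by (auto simp: E_def)
  have tt: "?t * ?t' = 1" using q_nonzero by (simp flip: power_int_add)
  have t2: "q powi (2 * (j - 1) - int d) = inverse q * inverse q * ?t"
  proof -
    have "2 * (j - 1) - int d = (2 * j - int d) + (- 1) + (- 1)" by simp
    then show ?thesis using q_nonzero by (simp only: power_int_add simp_thms) (simp add: power_int_minus)
  qed
  have "scale q (x i (x (i + 1) v)) - scale (inverse q * ?t) (x (i + 1) v) = scale qd v"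
    using weyl[of i] vV by (auto simp: qweyl_def xv lin_simps[OF lin])
  then have "scale (inverse q) (scale q (x i (x (i + 1) v)))
      = scale (inverse q) (scale (inverse q * ?t) (x (i + 1) v) + scale qd v)"
    by (simp only: diff_eq_eq add.commute)
  then have 1: "x i (x (i + 1) v) = scale (inverse q * inverse q * ?t) (x (i + 1) v) + scale (inverse q * qd) v"
    using q_nonzero by (simp add: scale_right_distrib mult.assoc)
  have "inverse q * qd = 1 - inverse q * inverse q" using q_nonzero by (simp add: right_diff_distrib)
  then have "x i (x (i + 1) v - scale ?t' v)
      = scale (inverse q * inverse q * ?t) (x (i + 1) v) - scale (inverse q * inverse q) v"
    using tt by (simp add: 1 lin_simps[OF lin] xv mult.commute[of ?t'] scale_left_diff_distrib)
  also have "\<dots> = scale (inverse q * inverse q * ?t) (x (i + 1) v - scale ?t' v)"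
    using tt by (simp add: scale_right_diff_distrib mult.assoc)
  finally show ?thesis
    unfolding E_def mem_Collect_eq t2
    by (intro conjI subspace_diff[OF sub] subspace_scale[OF sub] inV vV)
qed

lemma prev_E:
  assumes v: "v \<in> E i j"
  shows "x (i + 3) v - scale (q powi (int d - 2 * j)) v \<in> E i (j + 1)"
proof -
  let ?t = "q powi (2 * j - int d)" and ?t' = "q powi (int d - 2 * j)"
  have vV: "v \<in> V" and xv: "x i v = scale ?t v" using v by (auto simp: E_def)
  have tt: "?t * ?t' = 1" using q_nonzero by (simp flip: power_int_add)
  have t2: "q powi (2 * (j + 1) - int d) = q * q * ?t"
  proof -
    have "2 * (j + 1) - int d = (2 * j - int d) + 1 + 1" by simp
    then show ?thesis using q_nonzero by (simp only: power_int_add simp_thms) simp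
  qed
  have "scale (q * ?t) (x (i + 3) v) - scale (inverse q) (x i (x (i + 3) v)) = scale qd v"
    using weyl[of "i + 3"] vV by (auto simp: qweyl_def four_shift xv lin_simps[OF lin])
  then have "scale (inverse q) (x i (x (i + 3) v)) = scale (q * ?t) (x (i + 3) v) - scale qd v"
    by (metis diff_diff_eq2 add_diff_cancel_left')
  then have "scale q (scale (inverse q) (x i (x (i + 3) v)))
      = scale q (scale (q * ?t) (x (i + 3) v) - scale qd v)"
    by (simp only:)
  then have 1: "x i (x (i + 3) v) = scale (q * q * ?t) (x (i + 3) v) - scale (q * qd) v"
    using q_nonzero by (simp add: scale_right_diff_distrib mult.assoc)
  have "q * qd = q * q - 1" using q_nonzero by (simp add: right_diff_distrib)
  then have "x i (x (i + 3) v - scale ?t' v)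
      = scale (q * q * ?t) (x (i + 3) v) - scale (q * q) v"
    using tt by (simp add: 1 lin_simps[OF lin] xv mult.commute[of ?t'] scale_left_diff_distrib)
  also have "\<dots> = scale (q * q * ?t) (x (i + 3) v - scale ?t' v)"
    using tt by (simp add: scale_right_diff_distrib mult.assoc)
  finally show ?thesis
    unfolding E_def mem_Collect_eq t2
    by (intro conjI subspace_diff[OF sub] subspace_scale[OF sub] inV vV)
qed

text \<open>
  On an eigenvector for \<open>\<theta>\<close>, the \<open>q\<close>-Serre relation becomes the cubic
  \<open>(x\<^sub>i - q\<^sup>-\<^sup>2\<theta>) (x\<^sub>i - \<theta>) (x\<^sub>i - q\<^sup>2\<theta>) x\<^sub>i\<^sub>+\<^sub>2 v = 0\<close>.
\<close>

lemma opposite_E: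
  assumes v: "v \<in> E i j"
  shows "x (i + 2) v \<in> F i (j + 1)"
proof -
  let ?\<theta> = "\<lambda>k::int. q powi (2 * k - int d)" and ?J = "{j - 1, j, j + 1}"
  let ?t = "?\<theta> j" and ?w = "x (i + 2) v"
  have vV: "v \<in> V" and xv: "x i v = scale ?t v" using v by (auto simp: E_def)
  have t: "?\<theta> (j - 1) = q powi (-2) * ?t" "?\<theta> (j + 1) = q powi 2 * ?t"
    using q_nonzero by (simp_all only: power_int_add[symmetric] simp_thms) (simp_all add: algebra_simps)
  define p m where "p = q powi 2" and "m = q powi (-2)"
  have pm: "p * m = 1" "m * p = 1" using q_nonzero by (simp_all add: p_def m_def power_int_minus)
  have Q: "qnum q 3 = p + 1 + m" by (simp add: qnum_3 p_def m_def)
  have "x i (x i (x i ?w)) - scale (qnum q 3 * ?t) (x i (x i ?w))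
      + scale (qnum q 3 * (?t * ?t)) (x i ?w) - scale (?t * ?t * ?t) ?w = 0"
    using serre[of i] vV by (auto simp: qserre_def xv lin_simps[OF lin] mult.assoc)
  moreover have "papp (x i) (root_poly ?J ?\<theta>) ?w = x i (x i (x i ?w)) - scale (qnum q 3 * ?t) (x i (x i ?w))
      + scale (qnum q 3 * (?t * ?t)) (x i ?w) - scale (?t * ?t * ?t) ?w"
  proof -
    have "root_poly ?J ?\<theta> = [:- ?\<theta> (j - 1), 1:] * ([:- ?\<theta> j, 1:] * [:- ?\<theta> (j + 1), 1:])"
      by (simp add: root_poly_def)
    also have "\<dots> = [:- (m * ?t), 1:] * ([:- ?t, 1:] * [:- (p * ?t), 1:])" by (simp only: t p_def m_def)
    also have "\<dots> = [:- (?t * ?t * ?t), qnum q 3 * (?t * ?t), - (qnum q 3 * ?t), 1:]"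
    proof -
      have "m * t * (t * (p * t)) = (m * p) * (t * t * t)" for t by (simp only: mult_ac)
      moreover have "m * t * (t + p * t) + t * (p * t) = m * (t * t) + (m * p) * (t * t) + p * (t * t)" for t
        by (simp add: algebra_simps)
      moreover have "[:- \<alpha>, 1:] * ([:- \<beta>, 1:] * [:- \<gamma>, 1:])
          = [:- (\<alpha> * (\<beta> * \<gamma>)), \<alpha> * (\<beta> + \<gamma>) + \<beta> * \<gamma>, - (\<alpha> + \<beta> + \<gamma>), 1:]" for \<alpha> \<beta> \<gamma> :: 'a
        by (simp add: algebra_simps)
      ultimately show ?thesis by (simp add: Q pm distrib_right)
    qed
    finally show ?thesis by (simp add: papp_pCons[OF lin] lin_simps[OF lin] algebra_simps)
  qed
  ultimately have ker: "papp (x i) (root_poly ?J ?\<theta>) ?w = 0" by simp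
  have "papp (x i) (lagrange_poly ?J ?\<theta> k) ?w \<in> F i (j + 1)" if k: "k \<in> ?J" for k
  proof -
    have "papp (x i) (lagrange_poly ?J ?\<theta> k) ?w \<in> E i k"
      unfolding E_def mem_Collect_eq
      using kernel_root_poly_eigenvector[OF lin _ k ker]
      by (auto intro!: papp_closed[OF lin sub] simp: inV maps_into_def)
    then show ?thesis using E_subset_F[of k "j + 1" i] k by auto
  qed
  then have "(\<Sum>k\<in>?J. papp (x i) (lagrange_poly ?J ?\<theta> k) ?w) \<in> F i (j + 1)"
    by (intro subspace_sum[OF F_subspace]) auto
  moreover have "?w = (\<Sum>k\<in>?J. papp (x i) (lagrange_poly ?J ?\<theta> k) ?w)"
    by (rule kernel_root_poly_sum[OF lin]) (auto simp: inj_on_def powi_inject)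
  ultimately show ?thesis by simp
qed

lemma F_induct:
  assumes "lin f" "subspace Z" "\<And>k v. k \<le> j \<Longrightarrow> v \<in> E i k \<Longrightarrow> f v \<in> Z" "v \<in> F i j"
  shows "f v \<in> Z"
  using span_image_subset[OF assms(1,2) _ assms(4)[unfolded F_def]] assms(3) by auto

lemma self_F: "v \<in> F i j \<Longrightarrow> x i v - scale (q powi (2 * j - int d)) v \<in> F i (j - 1)"
proof (erule F_induct[rotated -1])
  show "lin (\<lambda>v. x i v - scale (q powi (2 * j - int d)) v)" by (intro lin_minus lin lin_scaled lin_ident)
  fix k v assume k: "k \<le> j" and v: "v \<in> E i k"
  show "x i v - scale (q powi (2 * j - int d)) v \<in> F i (j - 1)"
  proof (cases "k = j")
    case True
    then show ?thesis using v subspace_0[OF F_subspace] by (simp add: E_def)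
  next
    case False
    then have "v \<in> F i (j - 1)" using k v E_subset_F[of k "j - 1"] by auto
    moreover have "x i v = scale (q powi (2 * k - int d)) v" using v by (simp add: E_def)
    ultimately show ?thesis by (simp add: F_subspace subspace_diff subspace_scale)
  qed
qed (rule F_subspace)

lemma next_F: "v \<in> F i j \<Longrightarrow> x (i + 1) v - scale (q powi (int d - 2 * j)) v \<in> F i (j - 1)"
proof (erule F_induct[rotated -1])
  show "lin (\<lambda>v. x (i + 1) v - scale (q powi (int d - 2 * j)) v)" by (intro lin_minus lin lin_scaled lin_ident)
  fix k v assume k: "k \<le> j" and v: "v \<in> E i k"
  have 1: "x (i + 1) v - scale (q powi (int d - 2 * k)) v \<in> F i (j - 1)"
    using next_E[OF v] E_subset_F[of "k - 1" "j - 1" i] k by auto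
  show "x (i + 1) v - scale (q powi (int d - 2 * j)) v \<in> F i (j - 1)"
  proof (cases "k = j")
    case True
    then show ?thesis using 1 by simp
  next
    case False
    then have "v \<in> F i (j - 1)" using k v E_subset_F[of k "j - 1"] by auto
    then have "(x (i + 1) v - scale (q powi (int d - 2 * k)) v) +
        scale (q powi (int d - 2 * k) - q powi (int d - 2 * j)) v \<in> F i (j - 1)"
      using 1 by (intro subspace_add subspace_scale F_subspace)
    then show ?thesis by (simp add: scale_left_diff_distrib)
  qed
qed (rule F_subspace)

lemma up_F:
  assumes v: "v \<in> F i j"
  shows "x (i + 2) v \<in> F i (j + 1)" "x (i + 3) v \<in> F i (j + 1)"
proof -
  show "x (i + 2) v \<in> F i (j + 1)"
    using opposite_E F_mono by (intro F_induct[OF lin F_subspace _ v]) (meson add_right_mono subsetD)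
  show "x (i + 3) v \<in> F i (j + 1)"
  proof (rule F_induct[OF lin F_subspace _ v])
    fix k v assume k: "k \<le> j" and v: "v \<in> E i k"
    have "x (i + 3) v - scale (q powi (int d - 2 * k)) v \<in> F i (j + 1)" "v \<in> F i (j + 1)"
      using prev_E[OF v] v E_subset_F[of k "j + 1" i] E_subset_F[of "k + 1" "j + 1" i] k by auto
    then have "(x (i + 3) v - scale (q powi (int d - 2 * k)) v) + scale (q powi (int d - 2 * k)) v \<in> F i (j + 1)"
      by (intro subspace_add subspace_scale F_subspace)
    then show "x (i + 3) v \<in> F i (j + 1)" by simp
  qed
qed

text \<open>
  Each generator lowers one of the two opposite flags by a step up to scalars and raises the other one by a step. So
  the sum over \<open>j\<close> of the spaces \<open>S i e j\<close> is a submodule, whatever the offset \<open>e\<close> between the flags.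
\<close>

definition S :: "4 \<Rightarrow> int \<Rightarrow> int \<Rightarrow> 'b set" where
  "S i e j = F i j \<inter> F (i + 2) (int d - j + e)"

lemma S_step:
  assumes v: "v \<in> S i e j"
  shows "x i v - scale (q powi (2 * j - int d)) v \<in> S i e (j - 1)"
    "x (i + 1) v - scale (q powi (int d - 2 * j)) v \<in> S i e (j - 1)"
    "x (i + 2) v - scale (q powi (2 * (int d - j + e) - int d)) v \<in> S i e (j + 1)"
    "x (i + 3) v - scale (q powi (int d - 2 * (int d - j + e))) v \<in> S i e (j + 1)"
proof -
  let ?m = "int d - j + e"
  have 1: "v \<in> F i j" and 2: "v \<in> F (i + 2) ?m" using v by (auto simp: S_def)
  have 3: "v \<in> F i (j + 1)" "v \<in> F (i + 2) (?m + 1)"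
    using 1 2 F_mono[of j "j + 1" i] F_mono[of ?m "?m + 1" "i + 2"] by auto
  have m: "int d - (j - 1) + e = ?m + 1" "int d - (j + 1) + e = ?m - 1" by simp_all
  show "x i v - scale (q powi (2 * j - int d)) v \<in> S i e (j - 1)"
    unfolding S_def m using self_F[OF 1] up_F(1)[OF 2] 3
    by (auto simp: four_shift intro!: subspace_diff[OF F_subspace] subspace_scale[OF F_subspace])
  show "x (i + 1) v - scale (q powi (int d - 2 * j)) v \<in> S i e (j - 1)"
    unfolding S_def m using next_F[OF 1] up_F(2)[OF 2] 3
    by (auto simp: four_shift intro!: subspace_diff[OF F_subspace] subspace_scale[OF F_subspace])
  show "x (i + 2) v - scale (q powi (2 * ?m - int d)) v \<in> S i e (j + 1)"
    unfolding S_def m using self_F[OF 2] up_F(1)[OF 1] 3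
    by (auto intro!: subspace_diff[OF F_subspace] subspace_scale[OF F_subspace])
  show "x (i + 3) v - scale (q powi (int d - 2 * ?m)) v \<in> S i e (j + 1)"
    unfolding S_def m using next_F[OF 2] up_F(2)[OF 1] 3
    by (auto simp: four_shift intro!: subspace_diff[OF F_subspace] subspace_scale[OF F_subspace])
qed

lemma S_subspace: "subspace (S i e j)"
  unfolding S_def by (intro subspace_inter F_subspace)

lemma S_stable: "maps_into (span (\<Union>j. S i e j)) (x l)"
proof (rule maps_into_span_Union[OF lin])
  fix j v assume "v \<in> S i e j"
  then show "\<exists>\<alpha> k. x l v - scale \<alpha> v \<in> S i e k"
    using S_step[of v i e j] cover_4[of l i] by blast
qed

end

locale box_irreducible = box_ops scale q V x d
  for scale :: "'a::field \<Rightarrow> 'b::ab_group_add \<Rightarrow> 'b" and q :: 'a and V x d +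
  assumes irred: "\<And>W. subspace W \<Longrightarrow> W \<subseteq> V \<Longrightarrow> (\<And>i. maps_into W (x i)) \<Longrightarrow> W = {0} \<or> W = V"
    and spectrum: "\<And>i. {c. \<exists>v\<in>V. v \<noteq> 0 \<and> x i v = scale c v} = {q powi (2 * j - int d) | j. 0 \<le> j \<and> j \<le> int d}"
begin

lemma E_zero: "j \<notin> {0..int d} \<Longrightarrow> E i j = {0}"
proof -
  assume j: "j \<notin> {0..int d}"
  have "v = 0" if "v \<in> E i j" for v
  proof (rule ccontr)
    assume "v \<noteq> 0"
    then have "q powi (2 * j - int d) \<in> {q powi (2 * j - int d) | j. 0 \<le> j \<and> j \<le> int d}"
      using that spectrum[of i] by (auto simp: E_def)
    then show False using j by (auto simp: powi_inject)
  qed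
  then show ?thesis using subspace_0[OF E_subspace] by auto
qed

lemma E_nonzero: "j \<in> {0..int d} \<Longrightarrow> \<exists>v\<in>E i j. v \<noteq> 0"
  using spectrum[of i] by (auto simp: E_def set_eq_iff)

lemma F_zero: "j < 0 \<Longrightarrow> F i j = {0}"
proof -
  assume j: "j < 0"
  have "(\<Union>k\<in>{..j}. E i k) \<subseteq> {0}" using E_zero[of _ i] j by force
  then have "F i j \<subseteq> {0}" unfolding F_def by (intro span_minimal) auto
  then show ?thesis using subspace_0[OF F_subspace] by auto
qed

text \<open>
  The sum of all eigenspaces of \<open>x\<^sub>i\<close> is a submodule; hence \<open>x\<^sub>i\<close> is diagonalizable.
\<close>

lemma F_full: "int d \<le> j \<Longrightarrow> F i j = V"
proof -
  assume j: "int d \<le> j"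
  have "F i (int d) \<noteq> {0}" using E_nonzero[of "int d" i] E_subset_F[of "int d" "int d" i] by auto
  moreover have "maps_into (F i (int d)) (x l)" for l
  proof -
    have top: "F i (int d + 1) = F i (int d)"
    proof (rule antisym)
      have "(\<Union>k\<in>{..int d + 1}. E i k) \<subseteq> F i (int d)"
      proof safe
        fix k v assume "k \<le> int d + 1" "v \<in> E i k"
        then show "v \<in> F i (int d)"
          using E_zero[of k i] E_subset_F[of k "int d" i] subspace_0[OF F_subspace] by (cases "k = int d + 1") auto
      qed
      then show "F i (int d + 1) \<subseteq> F i (int d)" unfolding F_def[of i "int d + 1"] by (intro span_minimal F_subspace)
    qed (simp add: F_mono)
    have "x l v \<in> F i (int d)" if v: "v \<in> F i (int d)" for v
    proof -
      have down: "v' \<in> F i (int d)" if "v' - scale c v \<in> F i (int d - 1)" for c v'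
      proof -
        have "(v' - scale c v) + scale c v \<in> F i (int d)"
          using that v F_mono[of "int d - 1" "int d" i] by (intro subspace_add subspace_scale F_subspace) auto
        then show ?thesis by simp
      qed
      show ?thesis
        using cover_4[of l i] down[OF self_F[OF v]] down[OF next_F[OF v]] up_F[OF v] top by auto
    qed
    then show ?thesis by (simp add: maps_into_def)
  qed
  ultimately have "F i (int d) = V" using irred[OF F_subspace F_subset_V] by blast
  then show ?thesis using F_mono[OF j, of i] F_subset_V[of i j] by auto
qed

lemma F_proper: "j < int d \<Longrightarrow> v \<in> E i (int d) \<Longrightarrow> v \<in> F i j \<Longrightarrow> v = 0"
proof -
  assume j: "j < int d" and v: "v \<in> E i (int d)" "v \<in> F i j"
  let ?\<theta> = "\<lambda>k. q powi (2 * k - int d)" and ?J = "{0..<int d}"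
  let ?P = "papp (x i) (root_poly ?J ?\<theta>)"
  have eig: "?P w = scale (poly (root_poly ?J ?\<theta>) (?\<theta> k)) w" if "w \<in> E i k" for w k
    using that by (intro papp_eigen[OF lin]) (auto simp: E_def)
  have "?P w \<in> {0}" if "w \<in> F i j" for w
  proof (rule F_induct[OF lin_papp[OF lin] _ _ that])
    fix k w assume k: "k \<le> j" "w \<in> E i k"
    show "?P w \<in> {0}"
    proof (cases "k \<in> ?J")
      case True
      then have "poly (root_poly ?J ?\<theta>) (?\<theta> k) = 0" unfolding poly_root_poly by (intro prod_zero) auto
      then show ?thesis using eig[OF k(2)] by simp
    next
      case False
      then have "w = 0" using E_zero[of k i] k j by auto
      then show ?thesis by (simp add: lin_zero[OF lin_papp[OF lin]])
    qed
  qed simp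
  then have "scale (poly (root_poly ?J ?\<theta>) (?\<theta> (int d))) v = 0" using v eig by fastforce
  moreover have "poly (root_poly ?J ?\<theta>) (?\<theta> (int d)) \<noteq> 0"
  proof -
    have "\<forall>k\<in>?J. ?\<theta> (int d) - ?\<theta> k \<noteq> 0" by (simp only: powi_inject right_minus_eq) auto
    then show ?thesis unfolding poly_root_poly by (simp only: prod_zero_iff[OF finite_atLeastLessThan_int]) blast
  qed
  ultimately show "v = 0" by simp
qed

lemma F_not_full: "j < int d \<Longrightarrow> F i j \<noteq> V"
  using F_proper[of j _ i] E_nonzero[of "int d" i] by (auto simp: E_def)

text \<open>
  Flags belonging to opposite generators are in general position: otherwise the intersections
  below would span a proper submodule.
\<close>

lemma opposite_flags: "F i j \<inter> F (i + 2) (int d - j - 1) = {0}"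
proof -
  let ?W = "span (\<Union>j. S i (- 1) j)"
  have "S i (- 1) j \<subseteq> F (i + 2) (int d - 1)" for j
  proof (cases "j < 0")
    case True
    then show ?thesis using F_zero[OF True, of i] subspace_0[OF F_subspace] by (auto simp: S_def)
  next
    case False
    then show ?thesis using F_mono[of "int d - j + - 1" "int d - 1" "i + 2"] by (auto simp: S_def)
  qed
  then have W: "?W \<subseteq> F (i + 2) (int d - 1)" by (intro span_minimal F_subspace) auto
  then have "?W \<noteq> V" using F_not_full[of "int d - 1" "i + 2"] F_subset_V[of "i + 2" "int d - 1"] by auto
  moreover have "?W \<subseteq> V" using W F_subset_V by blast
  ultimately have "?W = {0}" using irred[OF subspace_span _ S_stable] by blast
  moreover have "S i (- 1) j \<subseteq> ?W" by (auto intro: span_base)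
  ultimately have "S i (- 1) j \<subseteq> {0}" by simp
  then show ?thesis using subspace_0[OF F_subspace] by (auto simp: S_def)
qed

text \<open>With offset \<open>0\<close> the intersections of the flags of \<open>x\<^sub>0\<close> and \<open>x\<^sub>2\<close> become the weight spaces.\<close>

abbreviation U :: "int \<Rightarrow> 'b set" where "U \<equiv> S 0 0"

lemma U_alt: "U j = F 0 j \<inter> F 2 (int d - j)"
  by (simp add: S_def)

lemma U_zero: "j \<notin> {0..int d} \<Longrightarrow> U j = {0}"
  using F_zero[of j 0] F_zero[of "int d - j" 2] subspace_0[OF F_subspace]
  by (cases "j < 0") (auto simp: U_alt)

lemma U_independent:
  assumes "\<forall>j\<in>{0..int d}. u j \<in> U j" "(\<Sum>j\<in>{0..int d}. u j) = 0" "j \<in> {0..int d}"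
  shows "u j = 0"
proof -
  have "\<forall>j\<in>{0..int n}. u j \<in> U j \<Longrightarrow> (\<Sum>j\<in>{0..int n}. u j) = 0 \<Longrightarrow> \<forall>j\<in>{0..int n}. u j = 0" for n
  proof (induction n)
    case 0
    then show ?case by simp
  next
    case (Suc n)
    have set: "{0..int (Suc n)} = insert (int (Suc n)) {0..int n}" by auto
    have eq: "u (int (Suc n)) = - (\<Sum>j\<in>{0..int n}. u j)"
      using Suc.prems(2) unfolding set by (simp add: eq_neg_iff_add_eq_0)
    have "u j \<in> F 0 (int n)" if "j \<in> {0..int n}" for j
      using Suc.prems(1) F_mono[of j "int n" 0] that by (auto simp: U_alt)
    then have "(\<Sum>j\<in>{0..int n}. u j) \<in> F 0 (int n)" by (intro subspace_sum F_subspace) auto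
    then have "u (int (Suc n)) \<in> F 0 (int n)" unfolding eq by (rule subspace_neg[OF F_subspace])
    moreover have "u (int (Suc n)) \<in> F (0 + 2) (int d - int n - 1)"
      using Suc.prems(1) by (auto simp: U_alt algebra_simps)
    ultimately have top: "u (int (Suc n)) = 0" using opposite_flags[of 0 "int n"] by blast
    then have "(\<Sum>j\<in>{0..int n}. u j) = 0" using Suc.prems(2) unfolding set by simp
    moreover have "\<forall>j\<in>{0..int n}. u j \<in> U j" using Suc.prems(1) unfolding set by blast
    ultimately have "\<forall>j\<in>{0..int n}. u j = 0" using Suc.IH by blast
    then show ?case unfolding set using top by blast
  qed
  then show ?thesis using assms by blast
qed

lemma span_U: "span (\<Union>j\<in>{0..int d}. U j) = V"
proof -
  have "U 0 = F 0 0" using F_full[of "int d" 2] F_subset_V[of 0 0] by (auto simp: U_alt)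
  then obtain v where v: "v \<in> U 0" "v \<noteq> 0"
    using E_nonzero[of 0 0] E_subset_F[of 0 0 0] by auto
  have "v \<in> span (\<Union>j. U j)" using v(1) by (intro span_base) blast
  then have "span (\<Union>j. U j) \<noteq> {0}" using v(2) by auto
  moreover have "span (\<Union>j. U j) \<subseteq> V"
    by (rule span_minimal[OF _ sub]) (use F_subset_V in \<open>auto simp: U_alt\<close>)
  ultimately have full: "span (\<Union>j. U j) = V" using irred[OF subspace_span _ S_stable] by blast
  have "(\<Union>j. U j) \<subseteq> span (\<Union>j\<in>{0..int d}. U j)"
  proof
    fix v assume "v \<in> (\<Union>j. U j)"
    then obtain j where "v \<in> U j" by blast
    then show "v \<in> span (\<Union>j\<in>{0..int d}. U j)"
      using U_zero[of j] span_zero by (cases "j \<in> {0..int d}") (blast intro: span_base, auto)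
  qed
  then have "span (\<Union>j. U j) \<subseteq> span (\<Union>j\<in>{0..int d}. U j)" by (intro span_minimal) auto
  moreover have "span (\<Union>j\<in>{0..int d}. U j) \<subseteq> span (\<Union>j. U j)" by (intro span_mono) auto
  ultimately show ?thesis using full by auto
qed

lemma U_decomposition: "v \<in> V \<Longrightarrow> \<exists>u. (\<forall>j\<in>{0..int d}. u j \<in> U j) \<and> v = (\<Sum>j\<in>{0..int d}. u j)"
  by (rule span_Union_sum) (auto simp: S_subspace span_U)

text \<open>
  If \<open>U j\<close> were zero, then the sum of the \<open>U k\<close> with \<open>k < j\<close> would be a submodule, since the only way out of it is through \<open>U j\<close>.
\<close>

lemma U_nonzero: "j \<in> {0..int d} \<Longrightarrow> U j \<noteq> {0}"
proof
  assume j: "j \<in> {0..int d}" and zero: "U j = {0}"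
  define S' where "S' k = (if k < j then U k else {0})" for k
  have j0: "j \<noteq> 0"
  proof
    assume "j = 0"
    moreover have "U 0 = F 0 0" using F_full[of "int d" 2] F_subset_V[of 0 0] by (auto simp: U_alt)
    ultimately show False using zero E_nonzero[of 0 0] E_subset_F[of 0 0 0] by auto
  qed
  have "maps_into (span (\<Union>k. S' k)) (x l)" for l
  proof (rule maps_into_span_Union[OF lin])
    fix k v assume v: "v \<in> S' k"
    show "\<exists>\<alpha> i. x l v - scale \<alpha> v \<in> S' i"
    proof (cases "k < j")
      case False
      then have "v = 0" using v by (simp add: S'_def)
      then show ?thesis by (intro exI[of _ 0] exI[of _ j]) (simp add: S'_def lin_zero[OF lin])
    next
      case True
      then have "v \<in> U k" using v by (simp add: S'_def)
      note st = S_step[OF this]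
      have S'1: "S' (k - 1) = U (k - 1)" using True by (simp only: S'_def) simp
      have S'2: "S' (k + 1) = U (k + 1)"
      proof (cases "k + 1 < j")
        case False
        then have "k + 1 = j" using True by linarith
        then show ?thesis using zero by (simp only: S'_def) simp
      qed (simp only: S'_def if_True)
      from exhaust_4[of l] show ?thesis
      proof (elim disjE)
        assume "l = 0" then show ?thesis using st(1) unfolding S'1[symmetric] by blast
      next
        assume "l = 1" then show ?thesis using st(2) unfolding S'1[symmetric] by (metis add_0)
      next
        assume "l = 2" then show ?thesis using st(3) unfolding S'2[symmetric] by (metis add_0)
      next
        assume "l = 3" then show ?thesis using st(4) unfolding S'2[symmetric] by (metis add_0)
      qed
    qed
  qed
  moreover have sub': "span (\<Union>k. S' k) \<subseteq> F 0 (j - 1)"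
  proof (rule span_minimal[OF _ F_subspace])
    show "(\<Union>k. S' k) \<subseteq> F 0 (j - 1)"
    proof
      fix v assume "v \<in> (\<Union>k. S' k)"
      then obtain k where k: "v \<in> S' k" by blast
      show "v \<in> F 0 (j - 1)"
      proof (cases "k < j")
        case True
        then have "v \<in> F 0 k" using k by (simp add: S'_def S_def)
        then show ?thesis using F_mono[of k "j - 1" 0] True by auto
      next
        case False
        then show ?thesis using k subspace_0[OF F_subspace] by (simp add: S'_def)
      qed
    qed
  qed
  moreover have "span (\<Union>k. S' k) \<noteq> V"
    using sub' F_not_full[of "j - 1" 0] F_subset_V[of 0 "j - 1"] j by auto
  ultimately have W: "span (\<Union>k. S' k) = {0}"
    using irred[OF subspace_span, of "\<Union>k. S' k"] F_subset_V[of 0 "j - 1"] by blast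
  have "U 0 = F 0 0" using F_full[of "int d" 2] F_subset_V[of 0 0] by (auto simp: U_alt)
  then obtain v where v: "v \<in> U 0" "v \<noteq> 0"
    using E_nonzero[of 0 0] E_subset_F[of 0 0 0] by auto
  then have "v \<in> S' 0" using j j0 by (simp add: S'_def)
  then have "v \<in> span (\<Union>k. S' k)" by (intro span_base) blast
  then show False using W v by simp
qed

end


section \<open>From \<open>\<box>\<^sub>q\<close>-modules to \<open>U\<^sub>q(L(sl\<^sub>2))\<close>-modules\<close>

context box_irreducible
begin

lemma lin_eq_on_V:
  assumes "lin f" "lin g" "\<And>j u. u \<in> U j \<Longrightarrow> f u = g u" "v \<in> V"
  shows "f v = g v"
proof -
  obtain u where u: "\<forall>j\<in>{0..int d}. u j \<in> U j" "v = (\<Sum>j\<in>{0..int d}. u j)"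
    using U_decomposition[OF assms(4)] by blast
  then show ?thesis using assms(1-3) by (auto simp: lin_sum intro!: sum.cong)
qed

text \<open>
  \<open>K\<close> is the map with eigenspaces \<open>U j\<close>; the definition of \<open>\<psi>\<close> then determines the other operators,
  and the defining relations of \<open>U\<^sub>q(L(sl\<^sub>2))\<close> are equivalent to those of \<open>\<box>\<^sub>q\<close>.
\<close>

lemma exists_uq_ops:
  "\<exists>K Ki A a B b. uq_ops scale q V K Ki A a B b \<and> (\<forall>i. \<forall>v\<in>V. uq_pre.X scale q K Ki A a B b i v = x i v) \<and>
     (\<forall>j. \<forall>u\<in>U j. K u = scale (q powi (2 * j - int d)) u)"
proof -
  have UV: "U j \<subseteq> V" for j using F_subset_V by (auto simp: S_def)
  have ex: "\<exists>K. lin K \<and> (\<forall>v. K v \<in> V) \<and> (\<forall>j\<in>{0..int d}. \<forall>u\<in>U j. K u = scale (\<theta> j) u)" for \<theta>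
    proof (rule exists_map_with_eigenspaces[where V = V and J = "{0..int d}" and U = U])
      show "u j = 0" if "\<forall>j\<in>{0..int d}. u j \<in> U j" "(\<Sum>j\<in>{0..int d}. u j) = 0" "j \<in> {0..int d}" for u j
        using U_independent that .
    qed (use sub S_subspace UV U_decomposition in auto)
  have everywhere: "\<exists>K. lin K \<and> (\<forall>v. K v \<in> V) \<and> (\<forall>j. \<forall>u\<in>U j. K u = scale (\<theta> j) u)" for \<theta>
  proof -
    obtain K where K: "lin K" "\<forall>v. K v \<in> V" "\<forall>j\<in>{0..int d}. \<forall>u\<in>U j. K u = scale (\<theta> j) u"
      using ex[of \<theta>] by blast
    have "K u = scale (\<theta> j) u" if u: "u \<in> U j" for u j
    proof (cases "j \<in> {0..int d}")
      case False
      then have "u = 0" using u U_zero[of j] by blast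
      then show ?thesis using lin_zero[OF K(1)] by simp
    qed (use K(3) u in blast)
    then show ?thesis using K by blast
  qed
  obtain K where K: "lin K" "\<And>v. K v \<in> V" and KU: "\<And>u j. u \<in> U j \<Longrightarrow> K u = scale (q powi (2 * j - int d)) u"
    using everywhere[of "\<lambda>j. q powi (2 * j - int d)"] by blast
  obtain Ki where Ki: "lin Ki" "\<And>v. Ki v \<in> V" and KiU: "\<And>u j. u \<in> U j \<Longrightarrow> Ki u = scale (q powi (int d - 2 * j)) u"
    using everywhere[of "\<lambda>j. q powi (int d - 2 * j)"] by blast
  define A a B b where "A v = scale (1 / qd) (K v - x 3 v)" and "a v = scale (1 / qd) (Ki v - x 1 v)"
    and "B v = scale (1 / (q * qd)) (K (x 2 v - Ki v))" and "b v = scale (1 / (q * qd)) (Ki (x 0 v - K v))" for v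
  have linops: "lin A" "lin a" "lin B" "lin b"
    unfolding A_def[abs_def] a_def[abs_def] B_def[abs_def] b_def[abs_def]
    by (intro lin_scaled lin_minus K Ki lin lin_comp[OF K(1)] lin_comp[OF Ki(1)])+
  have opsV: "A v \<in> V" "a v \<in> V" "B v \<in> V" "b v \<in> V" for v
    unfolding A_def a_def B_def b_def
    by (intro subspace_scale[OF sub] subspace_diff[OF sub] K(2) Ki(2) inV)+
  have neg: "- w \<in> U j" if "w \<in> U j" for w j using that by (rule subspace_neg[OF S_subspace])
  have shift: "A u \<in> U (j + 1)" "a u \<in> U (j - 1)" "B u \<in> U (j + 1)" "b u \<in> U (j - 1)" if u: "u \<in> U j" for u j
  proof -
    have e: "int d - 2 * (int d - j + 0) = 2 * j - int d" "2 * (int d - j + 0) - int d = int d - 2 * j" by simp_all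
    note st = S_step[OF u, unfolded e add_0]
    show "A u \<in> U (j + 1)"
      using neg[OF st(4)] by (simp add: A_def KU[OF u] subspace_scale[OF S_subspace])
    show "a u \<in> U (j - 1)"
      using neg[OF st(2)] by (simp add: a_def KiU[OF u] subspace_scale[OF S_subspace])
    show "B u \<in> U (j + 1)"
      using KU[OF st(3)] st(3) by (simp add: B_def KiU[OF u] subspace_scale[OF S_subspace])
    show "b u \<in> U (j - 1)"
      using KiU[OF st(1)] st(1) by (simp add: b_def KU[OF u] subspace_scale[OF S_subspace])
  qed
  have KKi: "K (Ki v) = v" "Ki (K v) = v" if "v \<in> V" for v
    using q_nonzero
    by (auto intro!: lin_eq_on_V[OF lin_comp[OF K(1) Ki(1)] lin_ident _ that] lin_eq_on_V[OF lin_comp[OF Ki(1) K(1)] lin_ident _ that]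
        simp: KU KiU lin_scale[OF K(1)] lin_scale[OF Ki(1)] simp flip: power_int_add)
  have up: "K (e v) = scale (q powi 2) (e (K v))"
    if e: "lin e" "\<And>u j. u \<in> U j \<Longrightarrow> e u \<in> U (j + 1)" and v: "v \<in> V" for e v
  proof (rule lin_eq_on_V[OF lin_comp[OF K(1) e(1)] lin_scaled[OF lin_comp[OF e(1) K(1)]] _ v])
    fix j u assume u: "u \<in> U j"
    have "q powi (2 * (j + 1) - int d) = q powi 2 * q powi (2 * j - int d)"
      using q_nonzero by (simp only: power_int_add[symmetric] simp_thms) (simp add: algebra_simps)
    then show "K (e u) = scale (q powi 2) (e (K u))"
      by (simp only: KU[OF u] KU[OF e(2)[OF u]] lin_scale[OF e(1)] scale_scale)
  qed
  have down: "K (e v) = scale (q powi (-2)) (e (K v))"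
    if e: "lin e" "\<And>u j. u \<in> U j \<Longrightarrow> e u \<in> U (j - 1)" and v: "v \<in> V" for e v
  proof (rule lin_eq_on_V[OF lin_comp[OF K(1) e(1)] lin_scaled[OF lin_comp[OF e(1) K(1)]] _ v])
    fix j u assume u: "u \<in> U j"
    have "q powi (2 * (j - 1) - int d) = q powi (-2) * q powi (2 * j - int d)"
      using q_nonzero by (simp only: power_int_add[symmetric] simp_thms) (simp add: algebra_simps)
    then show "K (e u) = scale (q powi (-2)) (e (K u))"
      by (simp only: KU[OF u] KU[OF e(2)[OF u]] lin_scale[OF e(1)] scale_scale)
  qed
  interpret P: uq_pre scale q V K Ki A a B b
  proof unfold_locales
    fix v assume v: "v \<in> V"
    show "K (A v) = scale (q powi 2) (A (K v))" by (rule up[OF linops(1) shift(1) v])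
    show "K (B v) = scale (q powi 2) (B (K v))" by (rule up[OF linops(3) shift(3) v])
    show "K (a v) = scale (q powi (-2)) (a (K v))" by (rule down[OF linops(2) shift(2) v])
    show "K (b v) = scale (q powi (-2)) (b (K v))" by (rule down[OF linops(4) shift(4) v])
  qed (use sub K Ki linops opsV KKi in auto)
  have X: "P.X i v = x i v" if "v \<in> V" for i v
    using exhaust_4[of i] q_nonzero qd_nonzero that inV K(2) Ki(2) sub
    by (auto simp: P.X_simps A_def a_def B_def b_def lin_scale[OF K(1)] lin_scale[OF Ki(1)] KKi subspace_diff)
  have "qweyl V (P.X i) (P.X (i + 1))" "qserre V (P.X i) (P.X (i + 2))" for i
    using weyl[of i] serre[of i] by (simp_all add: qweyl_def qserre_def X inV)
  then have "uq_ops scale q V K Ki A a B b" by (rule P.uq_ops_if_box_relations)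
  then show ?thesis using X KU by blast
qed

lemma F_split: "v \<in> F i j \<Longrightarrow> \<exists>e\<in>E i j. v - e \<in> F i (j - 1)"
proof -
  assume v: "v \<in> F i j"
  let ?Z = "{v. \<exists>e\<in>E i j. v - e \<in> F i (j - 1)}"
  have "subspace ?Z"
    unfolding subspace_def
  proof (intro conjI ballI allI)
    show "0 \<in> ?Z" using subspace_0[OF E_subspace, of i j] subspace_0[OF F_subspace, of i "j - 1"] by force
    show "v + w \<in> ?Z" if vw: "v \<in> ?Z" "w \<in> ?Z" for v w
    proof -
      obtain e e' where e: "e \<in> E i j" "v - e \<in> F i (j - 1)" "e' \<in> E i j" "w - e' \<in> F i (j - 1)" using vw by blast
      have "(v + w) - (e + e') \<in> F i (j - 1)" using subspace_add[OF F_subspace e(2,4)] by (simp add: algebra_simps)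
      then show ?thesis using subspace_add[OF E_subspace e(1,3)] by blast
    qed
    show "scale c v \<in> ?Z" if v: "v \<in> ?Z" for c v
    proof -
      obtain e where e: "e \<in> E i j" "v - e \<in> F i (j - 1)" using v by blast
      have "scale c v - scale c e \<in> F i (j - 1)" using subspace_scale[OF F_subspace e(2), of c] by (simp add: scale_right_diff_distrib)
      then show ?thesis using subspace_scale[OF E_subspace e(1)] by blast
    qed
  qed
  moreover have "E i k \<subseteq> ?Z" if "k \<le> j" for k
  proof (cases "k = j")
    case True
    then show ?thesis using subspace_0[OF F_subspace, of i "j - 1"] by force
  next
    case False
    then have "E i k \<subseteq> F i (j - 1)" using that by (intro E_subset_F) simp
    then show ?thesis using subspace_0[OF E_subspace, of i j] by force
  qed
  ultimately have "F i j \<subseteq> ?Z" unfolding F_def[of i j] by (intro span_minimal) blast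
  then show ?thesis using v by auto
qed

end


section \<open>Triangular operators\<close>

context uq_graded
begin

text \<open>
  Operators that are triangular for the weight decomposition with distinct diagonal entries \<open>\<tau>\<close> are diagonalizable with
  these eigenvalues, and their flags of eigenspaces are the flags of weight spaces. The flags are described
  through kernels of polynomials in the operator, which an isomorphism preserves.
\<close>

definition up :: "int \<Rightarrow> 'b set" where
  "up j = span (\<Union>k\<in>{..j}. wt k)"

lemma up_subspace: "subspace (up j)"
  by (simp add: up_def)

lemma wt_subset_up: "k \<le> j \<Longrightarrow> wt k \<subseteq> up j"
  unfolding up_def by (auto intro!: span_base)

lemma up_V:
  assumes v: "v \<in> V"
  shows "v \<in> up (int d)"
proof -
  have "cmp j v \<in> up (int d)" if "j \<in> {0..int d}" for j
    using cmp_wt[OF v that] wt_subset_up[of j "int d"] that by auto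
  then have "(\<Sum>j\<in>{0..int d}. cmp j v) \<in> up (int d)" by (intro subspace_sum up_subspace)
  then show ?thesis by (simp only: sum_cmp[OF v])
qed

lemma up_induct:
  assumes "lin f" "subspace Z" "\<And>k v. k \<le> j \<Longrightarrow> v \<in> wt k \<Longrightarrow> f v \<in> Z" "v \<in> up j"
  shows "f v \<in> Z"
  using span_image_subset[OF assms(1,2) _ assms(4)[unfolded up_def]] assms(3) by auto

lemma up_negative: "j < 0 \<Longrightarrow> up j = {0}"
proof -
  assume j: "j < 0"
  have "v \<in> {0}" if "v \<in> up j" for v
    by (rule up_induct[OF lin_ident _ _ that]) (use j wt_outside in auto)
  then show ?thesis using subspace_0[OF up_subspace] by auto
qed

lemma cmp_up: "v \<in> up (j - 1) \<Longrightarrow> j \<in> {0..int d} \<Longrightarrow> cmp j v = 0"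
proof -
  assume v: "v \<in> up (j - 1)" and j: "j \<in> {0..int d}"
  have "cmp j v \<in> {0}"
  proof (rule up_induct[OF lin_cmp _ _ v])
    fix k v assume k: "k \<le> j - 1" "v \<in> wt k"
    show "cmp j v \<in> {0}"
      using cmp_eigen[OF k(2)] wt_outside[OF k(2)] k(1) j lin_zero[OF lin_cmp]
      by (cases "k \<in> {0..int d}") auto
  qed simp
  then show ?thesis by simp
qed

lemma up_split:
  assumes j: "j \<in> {0..int d}" and v: "v \<in> up j"
  shows "v - cmp j v \<in> up (j - 1)"
proof (rule up_induct[OF lin_minus[OF lin_ident lin_cmp] up_subspace _ v])
  fix k v assume k: "k \<le> j" "v \<in> wt k"
  show "v - cmp j v \<in> up (j - 1)"
  proof (cases "k \<in> {0..int d}")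
    case True
    then show ?thesis
      using cmp_eigen[OF k(2) True j] k wt_subset_up[of k "j - 1"] subspace_0[OF up_subspace] by auto
  next
    case False
    then have "v = 0" using wt_outside[OF k(2)] by blast
    then show ?thesis using subspace_0[OF up_subspace] by (simp add: lin_zero[OF lin_cmp])
  qed
qed

definition triangular :: "('b \<Rightarrow> 'b) \<Rightarrow> (int \<Rightarrow> 'a) \<Rightarrow> bool" where
  "triangular T \<tau> \<longleftrightarrow> lin T \<and> inj \<tau> \<and> (\<forall>j. \<forall>u\<in>wt j. T u - scale (\<tau> j) u \<in> wt (j - 1))"

lemma triangularD:
  assumes "triangular T \<tau>"
  shows "lin T" "inj_on \<tau> J" "u \<in> wt j \<Longrightarrow> T u - scale (\<tau> j) u \<in> wt (j - 1)"
  using assms by (auto simp: triangular_def inj_on_def)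

lemma triangular_up:
  assumes T: "triangular T \<tau>" and v: "v \<in> up j"
  shows "T v - scale (\<tau> j) v \<in> up (j - 1)"
proof (rule up_induct[OF lin_minus[OF triangularD(1)[OF T] lin_scaled[OF lin_ident]] up_subspace _ v])
  fix k v assume k: "k \<le> j" "v \<in> wt k"
  have 1: "T v - scale (\<tau> k) v \<in> up (j - 1)"
    using triangularD(3)[OF T k(2)] wt_subset_up[of "k - 1" "j - 1"] k(1) by auto
  show "T v - scale (\<tau> j) v \<in> up (j - 1)"
  proof (cases "k = j")
    case True
    then show ?thesis using 1 by simp
  next
    case False
    then have "v \<in> up (j - 1)" using k wt_subset_up[of k "j - 1"] by auto
    then have "(T v - scale (\<tau> k) v) + scale (\<tau> k - \<tau> j) v \<in> up (j - 1)"
      using 1 by (intro subspace_add subspace_scale up_subspace)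
    then show ?thesis by (simp add: scale_left_diff_distrib)
  qed
qed

lemma triangular_root_poly:
  assumes T: "triangular T \<tau>" and v: "v \<in> up (int n - 1)"
  shows "papp T (root_poly {0..<int n} \<tau>) v = 0"
  using v
proof (induction n arbitrary: v)
  case 0
  then have "v = 0" using up_negative[of "-1"] by simp
  then show ?case by (simp add: lin_zero[OF lin_papp[OF triangularD(1)[OF T]]])
next
  case (Suc n)
  have "{0..<int (Suc n)} = insert (int n) {0..<int n}" by auto
  then have "root_poly {0..<int (Suc n)} \<tau> = root_poly {0..<int n} \<tau> * [:- \<tau> (int n), 1:]"
    by (simp add: root_poly_insert mult.commute)
  moreover have "T v - scale (\<tau> (int n)) v \<in> up (int n - 1)"
    using triangular_up[OF T, of v "int n"] Suc.prems by simp
  ultimately show ?case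
    using Suc.IH by (simp only: papp_mult[OF triangularD(1)[OF T]] papp_linear_factor[OF triangularD(1)[OF T]])
qed

lemma triangular_leading:
  assumes T: "triangular T \<tau>" and v: "v \<in> up j" and j: "j \<in> {0..int d}"
  shows "cmp j (papp T p v) = scale (poly p (\<tau> j)) (cmp j v)"
proof -
  have "papp T p v \<in> up j \<and> papp T p v - scale (poly p (\<tau> j)) v \<in> up (j - 1)"
  proof (induction p)
    case 0
    then show ?case using subspace_0[OF up_subspace] by simp
  next
    case (pCons c p)
    let ?w = "papp T p v"
    have 1: "T ?w - scale (\<tau> j) ?w \<in> up (j - 1)" using triangular_up[OF T] pCons.IH by blast
    have 2: "scale (\<tau> j) (?w - scale (poly p (\<tau> j)) v) \<in> up (j - 1)"
      using pCons.IH by (intro subspace_scale up_subspace) blast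
    have "papp T (pCons c p) v - scale (poly (pCons c p) (\<tau> j)) v
        = (T ?w - scale (\<tau> j) ?w) + scale (\<tau> j) (?w - scale (poly p (\<tau> j)) v)"
      by (simp add: papp_pCons[OF triangularD(1)[OF T]] scale_left_distrib scale_right_diff_distrib)
    then have 3: "papp T (pCons c p) v - scale (poly (pCons c p) (\<tau> j)) v \<in> up (j - 1)"
      using subspace_add[OF up_subspace 1 2] by simp
    have "up (j - 1) \<subseteq> up j" unfolding up_def by (intro span_mono UN_mono) auto
    then have "(papp T (pCons c p) v - scale (poly (pCons c p) (\<tau> j)) v) + scale (poly (pCons c p) (\<tau> j)) v \<in> up j"
      using 3 v by (intro subspace_add subspace_scale up_subspace) auto
    then show ?case using 3 by simp
  qed
  then have "cmp j (papp T p v - scale (poly p (\<tau> j)) v) = 0" using cmp_up j by blast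
  then show ?thesis by (simp add: lin_simps[OF lin_cmp])
qed

lemma triangular_kernel:
  assumes T: "triangular T \<tau>" and v: "v \<in> V" and ker: "papp T (root_poly {0..<int n} \<tau>) v = 0"
  shows "v \<in> up (int n - 1)"
proof -
  have "v \<in> up (int n - 1 + int m) \<Longrightarrow> int n - 1 + int m \<le> int d \<Longrightarrow> v \<in> up (int n - 1)" for m
  proof (induction m)
    case (Suc m)
    let ?j = "int n - 1 + int (Suc m)"
    have j: "?j \<in> {0..int d}" using Suc.prems by auto
    have "scale (poly (root_poly {0..<int n} \<tau>) (\<tau> ?j)) (cmp ?j v) = 0"
      using triangular_leading[OF T Suc.prems(1) j, of "root_poly {0..<int n} \<tau>"] ker lin_zero[OF lin_cmp] by simp
    moreover have "poly (root_poly {0..<int n} \<tau>) (\<tau> ?j) \<noteq> 0"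
      using T by (auto simp: poly_root_poly triangular_def inj_eq)
    ultimately have "cmp ?j v = 0" by simp
    then have "v \<in> up (?j - 1)" using up_split[OF j Suc.prems(1)] by simp
    then show ?case using Suc.IH Suc.prems(2) by (simp add: algebra_simps)
  qed simp
  moreover have "v \<in> up j" if "int d \<le> j" for j
    using up_V[OF v] span_mono[of "\<Union>k\<in>{..int d}. wt k" "\<Union>k\<in>{..j}. wt k"] that
    unfolding up_def by (metis (no_types, lifting) UN_mono atMost_subset_iff order_refl subsetD)
  ultimately show ?thesis
  proof (cases "int d \<le> int n - 1")
    case False
    assume step: "\<And>m. v \<in> up (int n - 1 + int m) \<Longrightarrow> int n - 1 + int m \<le> int d \<Longrightarrow> v \<in> up (int n - 1)"
    show ?thesis using step[of "Suc d - n"] up_V[OF v] False by (simp add: of_nat_diff)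
  qed blast
qed

lemma triangular_spectrum:
  assumes T: "triangular T \<tau>" and nonzero: "\<And>j. 0 \<le> j \<Longrightarrow> j \<le> int d \<Longrightarrow> \<exists>v\<in>wt j. v \<noteq> 0"
    and TV: "maps_into V T"
  shows "{c. \<exists>v\<in>V. v \<noteq> 0 \<and> T v = scale c v} = {\<tau> j | j. 0 \<le> j \<and> j \<le> int d}"
proof (intro equalityI subsetI)
  fix c assume "c \<in> {c. \<exists>v\<in>V. v \<noteq> 0 \<and> T v = scale c v}"
  then obtain v where v: "v \<in> V" "v \<noteq> 0" "T v = scale c v" by blast
  have "papp T (root_poly {0..<int (Suc d)} \<tau>) v = 0"
    by (rule triangular_root_poly[OF T]) (use up_V[OF v(1)] in simp)
  then have "poly (root_poly {0..<int (Suc d)} \<tau>) c = 0"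
    using papp_eigen[OF triangularD(1)[OF T] v(3)] v(2) by simp
  then show "c \<in> {\<tau> j | j. 0 \<le> j \<and> j \<le> int d}" by (auto simp: poly_root_poly)
next
  fix c assume "c \<in> {\<tau> j | j. 0 \<le> j \<and> j \<le> int d}"
  then obtain j where j: "c = \<tau> j" "0 \<le> j" "j \<le> int d" by blast
  then obtain u where u: "u \<in> wt j" "u \<noteq> 0" using nonzero by blast
  obtain n where n: "j = int n" using j nonneg_int_cases by blast
  have uj: "u \<in> up j" using u wt_subset_up[of j j] by auto
  define w where "w = papp T (root_poly {0..<j} \<tau>) u"
  have "{0..<int (Suc n)} = insert j {0..<j}" using n by auto
  then have "root_poly {0..<int (Suc n)} \<tau> = [:- \<tau> j, 1:] * root_poly {0..<j} \<tau>"
    by (simp add: root_poly_insert)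
  moreover have "papp T (root_poly {0..<int (Suc n)} \<tau>) u = 0"
    by (rule triangular_root_poly[OF T]) (use uj n in simp)
  ultimately have "T w = scale (\<tau> j) w"
    by (simp add: w_def papp_mult[OF triangularD(1)[OF T]] papp_linear_factor[OF triangularD(1)[OF T]] del: mult_pCons_left)
  moreover have "w \<noteq> 0"
  proof
    assume "w = 0"
    then have "scale (poly (root_poly {0..<j} \<tau>) (\<tau> j)) (cmp j u) = 0"
      using triangular_leading[OF T uj, of "root_poly {0..<j} \<tau>"] j lin_zero[OF lin_cmp] by (simp add: w_def)
    moreover have "poly (root_poly {0..<j} \<tau>) (\<tau> j) \<noteq> 0"
      using T by (auto simp: poly_root_poly triangular_def inj_eq)
    ultimately show False using cmp_eigen[OF u(1), of j] j u(2) by simp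
  qed
  moreover have "w \<in> V"
    unfolding w_def using papp_closed[OF triangularD(1)[OF T] sub TV] wt_V[OF u(1)] by blast
  ultimately show "c \<in> {c. \<exists>v\<in>V. v \<noteq> 0 \<and> T v = scale c v}" using j by blast
qed

lemma X_on_wt:
  assumes v: "v \<in> wt j"
  shows "X 0 v - scale (q powi (2 * j - int d)) v \<in> wt (j - 1)"
    "X 1 v = scale (q powi (int d - 2 * j)) v - scale qd (a v)"
    "X 2 v - scale (q powi (int d - 2 * j)) v \<in> wt (j + 1)"
    "X 3 v = scale (q powi (2 * j - int d)) v - scale qd (A v)"
  using wt_K[OF v] wt_Ki[OF v] wt_K[OF wt_shift(4)[OF v]] wt_Ki[OF wt_shift(2)[OF v]] wt_shift[OF v]
  by (auto simp: X_simps subspace_scale[OF wt_subspace])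

lemma X_triangular:
  "triangular (X 0) (\<lambda>j. q powi (2 * j - int d))" "triangular (X 1) (\<lambda>j. q powi (int d - 2 * j))"
  using X_on_wt(1,2) lin_X wt_shift(3) subspace_neg[OF wt_subspace] subspace_scale[OF wt_subspace]
  by (auto simp: triangular_def inj_on_def powi_inject)

end


section \<open>The Drinfel'd polynomial and irreducibility of the pullback\<close>

lemma root_poly_single: "root_poly {0..<int 1} \<tau> = [:- \<tau> 0, 1:]"
proof -
  have "{0..<int 1} = {0}" by auto
  then show ?thesis by (simp add: root_poly_def)
qed

context uq_irreducible
begin

lemma nonzero_wt: "0 \<le> j \<Longrightarrow> j \<le> int d \<Longrightarrow> \<exists>v\<in>wt j. v \<noteq> 0"
  using nonzero[of j] by (auto simp: wt_def)

lemma X_V: "maps_into V (X i)"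
  by (simp add: maps_into_def X_inV)

lemma box_ops_X: "box_ops scale q V X"
  by unfold_locales (use sub lin_X X_inV box_relations in auto)

lemma spectrum_X: "{c. \<exists>v\<in>V. v \<noteq> 0 \<and> X i v = scale c v} = {q powi (2 * j - int d) | j. 0 \<le> j \<and> j \<le> int d}"
proof -
  have rev: "{q powi (int d - 2 * j) | j. 0 \<le> j \<and> j \<le> int d} = {q powi (2 * j - int d) | j. 0 \<le> j \<and> j \<le> int d}"
  proof -
    have "\<exists>k. q powi (int d - 2 * j) = q powi (2 * k - int d) \<and> 0 \<le> k \<and> k \<le> int d"
      "\<exists>k. q powi (2 * j - int d) = q powi (int d - 2 * k) \<and> 0 \<le> k \<and> k \<le> int d" if "0 \<le> j" "j \<le> int d" for j
      using that by (auto intro!: exI[of _ "int d - j"])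
    then show ?thesis by blast
  qed
  interpret sw: uq_irreducible scale q V Ki K a A b B d by (rule swapped_irreducible)
  show ?thesis
    using exhaust_4[of i]
  proof (elim disjE)
    assume "i = 0"
    then show ?thesis using triangular_spectrum[OF X_triangular(1) nonzero_wt X_V] by simp
  next
    assume "i = 1"
    then show ?thesis using triangular_spectrum[OF X_triangular(2) nonzero_wt X_V] by (simp only: rev)
  next
    assume "i = 2"
    then show ?thesis
      using sw.triangular_spectrum[OF sw.X_triangular(1) sw.nonzero_wt sw.X_V] by (simp add: swapped_X)
  next
    assume "i = 3"
    then show ?thesis
      using sw.triangular_spectrum[OF sw.X_triangular(2) sw.nonzero_wt sw.X_V] by (simp only: rev swapped_X) simp
  qed
qed

text \<open>
  \<open>lead\<close> is the projection onto the lowest weight space along the sum of the eigenspaces of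
  \<open>X 1\<close> for eigenvalues other than \<open>q\<^sup>d\<close>, written out in weight components. \<open>corner u\<close> is the
  eigenvector of \<open>X 3\<close> for the eigenvalue \<open>q\<^sup>-\<^sup>d\<close> with lowest weight component \<open>u\<close>.
\<close>

fun \<mu> :: "nat \<Rightarrow> 'a" where
  "\<mu> 0 = 1" | "\<mu> (Suc i) = \<mu> i * (- (q powi (int (Suc i) - int d)) / qi (int (Suc i)))"

fun \<nu> :: "nat \<Rightarrow> 'a" where
  "\<nu> 0 = 1" | "\<nu> (Suc i) = \<nu> i * (q powi (int d - int (Suc i)) / qi (int (Suc i)))"

lemma \<mu>_\<nu>: "\<mu> i * \<nu> i = (- 1) ^ i / (qfact q i)\<^sup>2"
proof (induction i)
  case 0
  then show ?case by (simp add: qfact_def)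
next
  case (Suc i)
  have p: "q powi (int (Suc i) - int d) * q powi (int d - int (Suc i)) = 1"
    using q_nonzero by (simp only: power_int_add[symmetric] simp_thms) simp
  have f: "qfact q (Suc i) = qfact q i * qi (int (Suc i))" by (simp add: qfact_def qnum_qi mult.commute)
  have "\<mu> (Suc i) * \<nu> (Suc i) = (\<mu> i * \<nu> i) * - (q powi (int (Suc i) - int d) * q powi (int d - int (Suc i))) / (qi (int (Suc i)) * qi (int (Suc i)))"
    by (simp only: \<mu>.simps \<nu>.simps) (simp add: mult_ac)
  then show ?case unfolding p Suc f by (simp add: power2_eq_square mult_ac)
qed

definition lead :: "'b \<Rightarrow> 'b" where
  "lead v = (\<Sum>i\<le>d. scale (\<mu> i) ((a ^^ i) (cmp (int i) v)))"

definition corner :: "'b \<Rightarrow> 'b" where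
  "corner u = (\<Sum>i\<le>d. scale (\<nu> i) ((A ^^ i) u))"

lemma lin_lead: "lin lead"
  unfolding lead_def[abs_def]
  by (intro lin_setsum lin_scaled lin_comp[OF lin_pow[OF lin(4)] lin_cmp])

lemma lead_wt: "v \<in> wt (int n) \<Longrightarrow> n \<le> d \<Longrightarrow> lead v = scale (\<mu> n) ((a ^^ n) v)"
proof -
  assume v: "v \<in> wt (int n)" and n: "n \<le> d"
  have "lead v = (\<Sum>i\<le>d. if i = n then scale (\<mu> n) ((a ^^ n) v) else 0)"
    unfolding lead_def
    by (intro sum.cong) (use n cmp_eigen[OF v] lin_zero[OF lin_pow[OF lin(4)]] in auto)
  then show ?thesis using n by simp
qed

lemma lead_X1:
  assumes v: "v \<in> V"
  shows "lead (X 1 v) = scale (q powi int d) (lead v)"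
proof -
  have wt: "lead (X 1 v) = scale (q powi int d) (lead v)" if v: "v \<in> wt (int n)" and n: "n \<le> d" for v n
  proof (cases n)
    case 0
    then have "a v = 0" using v wt_outside[OF wt_shift(3)[OF v]] by simp
    then show ?thesis using v 0 by (simp add: X_on_wt(2)[OF v] lin_scale[OF lin_lead])
  next
    case (Suc m)
    have av: "a v \<in> wt (int m)" using wt_shift(3)[OF v] Suc by simp
    define Q D where "Q = qi (int n)" and "D = qd"
    have Q: "Q \<noteq> 0" "Q * D = q powi int n - q powi (- int n)"
      using Suc qd_nonzero by (simp_all add: Q_def D_def qi_zero_iff) (simp add: qi_def)
    have p: "q powi (int n - int d) * q powi int d = q powi int n"
      "q powi (int n - int d) * q powi (int d - 2 * int n) = q powi (- int n)"
      using q_nonzero by (simp_all only: power_int_add[symmetric] simp_thms) simp_all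
    have "\<mu> n = \<mu> m * (- (q powi (int n - int d)) / Q)" by (simp only: Suc \<mu>.simps Q_def)
    then have \<mu>: "\<mu> n * Q = - \<mu> m * q powi (int n - int d)" using Q by simp
    have "(q powi (int d - 2 * int n) * \<mu> n - D * \<mu> m) * Q
        = q powi (int d - 2 * int n) * (\<mu> n * Q) - \<mu> m * (Q * D)" by (simp add: algebra_simps)
    also have "\<dots> = - \<mu> m * (q powi (int n - int d) * q powi (int d - 2 * int n)) - \<mu> m * (Q * D)"
      unfolding \<mu> by (simp add: algebra_simps)
    also have "\<dots> = - \<mu> m * (q powi (int n - int d) * q powi int d)"
      unfolding p Q(2) by (simp add: algebra_simps)
    also have "\<dots> = (q powi int d * \<mu> n) * Q"
      unfolding mult.assoc[of "q powi int d"] \<mu> by (simp add: mult_ac)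
    finally have c: "q powi (int d - 2 * int n) * \<mu> n - D * \<mu> m = q powi int d * \<mu> n" using Q(1) by simp
    have "lead (X 1 v) = scale (q powi (int d - 2 * int n)) (lead v) - scale D (lead (a v))"
      unfolding X_on_wt(2)[OF v] D_def by (simp only: lin_simps[OF lin_lead])
    also have "\<dots> = scale (q powi (int d - 2 * int n) * \<mu> n - D * \<mu> m) ((a ^^ n) v)"
      using lead_wt[OF v n] lead_wt[OF av] n Suc
      by (simp add: scale_left_diff_distrib funpow_swap1)
    also have "\<dots> = scale (q powi int d) (lead v)"
      unfolding c lead_wt[OF v n] by simp
    finally show ?thesis .
  qed
  have "lead (X 1 (\<Sum>j\<in>{0..int d}. cmp j v)) = scale (q powi int d) (lead (\<Sum>j\<in>{0..int d}. cmp j v))"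
    unfolding lin_sum[OF lin_X] lin_sum[OF lin_lead] scale_sum_right
  proof (rule sum.cong[OF refl])
    fix j assume j: "j \<in> {0..int d}"
    then obtain n where "j = int n" "n \<le> d" using nonneg_int_cases by (metis atLeastAtMost_iff of_nat_le_iff)
    then show "lead (X 1 (cmp j v)) = scale (q powi int d) (lead (cmp j v))"
      using wt[of "cmp j v" n] cmp_wt[OF v j] by simp
  qed
  then show ?thesis by (simp only: sum_cmp[OF v])
qed

lemma lead_eigenvector: "v \<in> V \<Longrightarrow> X 1 v = scale c v \<Longrightarrow> c \<noteq> q powi int d \<Longrightarrow> lead v = 0"
  using lead_X1[of v] lin_scale[OF lin_lead, of c v] by (metis scale_right_imp_eq)

lemma corner_X3:
  assumes u: "u \<in> wt 0"
  shows "X 3 (corner u) = scale (q powi (- int d)) (corner u)"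
proof -
  have "X 3 (\<Sum>i\<le>n. scale (\<nu> i) ((A ^^ i) u))
      = scale (q powi (- int d)) (\<Sum>i\<le>n. scale (\<nu> i) ((A ^^ i) u)) - scale (qd * \<nu> n) ((A ^^ Suc n) u)" for n
  proof (induction n)
    case 0
    show ?case using X_on_wt(4)[OF u] by simp
  next
    case (Suc n)
    let ?S = "\<Sum>i\<le>n. scale (\<nu> i) ((A ^^ i) u)" and ?w = "(A ^^ Suc n) u"
    have w: "?w \<in> wt (int (Suc n))" using wt_pow(1)[OF u, of "Suc n"] by simp
    define Q D where "Q = qi (int (Suc n))" and "D = qd"
    have Q: "Q \<noteq> 0" "Q * D = q powi int (Suc n) - q powi (- int (Suc n))"
      using qd_nonzero by (simp_all add: Q_def D_def qi_zero_iff del: of_nat_Suc) (simp add: qi_def del: of_nat_Suc)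
    have p: "q powi (int d - int (Suc n)) * q powi (2 * int (Suc n) - int d) = q powi int (Suc n)"
      "q powi (int d - int (Suc n)) * q powi (- int d) = q powi (- int (Suc n))"
      using q_nonzero by (simp_all only: power_int_add[symmetric] simp_thms) simp_all
    have "\<nu> (Suc n) = \<nu> n * (q powi (int d - int (Suc n)) / Q)" by (simp only: \<nu>.simps Q_def)
    then have \<nu>: "\<nu> (Suc n) * Q = \<nu> n * q powi (int d - int (Suc n))"
      using Q(1) by (simp del: \<nu>.simps of_nat_Suc)
    have "(\<nu> (Suc n) * q powi (2 * int (Suc n) - int d) - \<nu> (Suc n) * q powi (- int d)) * Q
        = (\<nu> (Suc n) * Q) * q powi (2 * int (Suc n) - int d) - (\<nu> (Suc n) * Q) * q powi (- int d)"
      by (simp only: algebra_simps)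
    also have "\<dots> = \<nu> n * (q powi (int d - int (Suc n)) * q powi (2 * int (Suc n) - int d)
        - q powi (int d - int (Suc n)) * q powi (- int d))"
      unfolding \<nu> by (simp only: algebra_simps)
    also have "\<dots> = D * \<nu> n * Q" unfolding p Q(2)[symmetric] by (simp only: mult_ac)
    finally have c: "\<nu> (Suc n) * q powi (2 * int (Suc n) - int d) - \<nu> (Suc n) * q powi (- int d) = D * \<nu> n"
      using Q(1) by simp
    have "X 3 (?S + scale (\<nu> (Suc n)) ?w)
        = (scale (q powi (- int d)) ?S - scale (D * \<nu> n) ?w)
          + scale (\<nu> (Suc n)) (scale (q powi (2 * int (Suc n) - int d)) ?w - scale D (A ?w))"
      unfolding lin_add[OF lin_X] lin_scale[OF lin_X] X_on_wt(4)[OF w] D_def using Suc by simp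
    also have "\<dots> = scale (q powi (- int d)) ?S + scale (\<nu> (Suc n) * q powi (- int d)) ?w - scale (D * \<nu> (Suc n)) (A ?w)"
      unfolding c[symmetric] by (simp add: scale_right_diff_distrib scale_left_diff_distrib mult.commute)
    finally show ?case
      by (simp add: D_def scale_right_distrib mult.commute)
  qed
  moreover have "(A ^^ Suc d) u = 0" by (rule wt_outside[OF wt_pow(1)[OF u]]) auto
  ultimately show ?thesis by (simp only: corner_def scale_zero_right diff_zero)
qed

lemma corner_V: "u \<in> wt 0 \<Longrightarrow> corner u \<in> V"
  unfolding corner_def using wt_V[OF wt_pow(1)] by (intro subspace_sum subspace_scale sub) auto

lemma cmp_corner: "u \<in> wt 0 \<Longrightarrow> cmp 0 (corner u) = u"
proof -
  assume u: "u \<in> wt 0"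
  have "cmp 0 (corner u) = (\<Sum>i\<le>d. scale (\<nu> i) (cmp 0 ((A ^^ i) u)))"
    by (simp add: corner_def lin_simps[OF lin_cmp])
  also have "\<dots> = (\<Sum>i\<le>d. if i = 0 then u else 0)"
  proof (rule sum.cong[OF refl])
    fix i assume "i \<in> {..d}"
    then show "scale (\<nu> i) (cmp 0 ((A ^^ i) u)) = (if i = 0 then u else 0)"
      using cmp_eigen[OF wt_pow(1)[OF u, of i], of 0] by (cases i) auto
  qed
  finally show ?thesis by simp
qed

text \<open>The scalar \<open>drinfeld_at_1 s\<close> is \<open>P\<^sub>V(1)\<close> when \<open>s j\<close> is the eigenvalue of \<open>a\<^sup>jA\<^sup>j\<close> on the lowest weight space.\<close>

definition drinfeld_at_1 :: "(nat \<Rightarrow> 'a) \<Rightarrow> 'a" where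
  "drinfeld_at_1 s = (\<Sum>i\<le>d. (- 1) ^ i * s i / (qfact q i)\<^sup>2)"

lemma lead_corner:
  assumes u: "u \<in> wt 0" and s: "\<And>j. \<sigma> j u = scale (s j) u"
  shows "lead (corner u) = scale (drinfeld_at_1 s) u"
proof -
  have "lead (corner u) = (\<Sum>i\<le>d. scale (\<nu> i) (lead ((A ^^ i) u)))"
    by (simp add: corner_def lin_simps[OF lin_lead])
  also have "\<dots> = (\<Sum>i\<le>d. scale (\<mu> i * \<nu> i * s i) u)"
  proof (rule sum.cong[OF refl])
    fix i assume "i \<in> {..d}"
    then have "lead ((A ^^ i) u) = scale (\<mu> i) (\<sigma> i u)"
      using lead_wt[OF wt_pow(1)[OF u, of i, unfolded add_0]] by (simp add: \<sigma>_def)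
    then show "scale (\<nu> i) (lead ((A ^^ i) u)) = scale (\<mu> i * \<nu> i * s i) u"
      by (simp add: s mult_ac)
  qed
  also have "\<dots> = scale (drinfeld_at_1 s) u"
    by (simp add: drinfeld_at_1_def scale_sum_left \<mu>_\<nu>)
  finally show ?thesis .
qed

text \<open>
  On weight vectors, \<open>X 1\<close> and \<open>X 3\<close> differ from multiples of \<open>a\<close> and \<open>A\<close> by a scalar. So the weight
  vectors in a submodule of the pullback span a subspace that is stable under \<open>K\<close>, \<open>A\<close> and \<open>a\<close>.
\<close>

lemma X_stable_homogeneous:
  assumes W: "subspace W" "W \<subseteq> V" "\<And>i. maps_into W (X i)"
  shows "span (\<Union>j. W \<inter> wt j) = {0} \<or> span (\<Union>j. W \<inter> wt j) = V"
proof (cases "span (\<Union>j. W \<inter> wt j) = {0}")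
  case False
  let ?Z = "span (\<Union>j. W \<inter> wt j)"
  have op: "f v \<in> W" if "scale c v - scale qd (f v) \<in> W" "v \<in> W" for f c v
  proof -
    have "scale (inverse qd) (scale c v - (scale c v - scale qd (f v))) \<in> W"
      by (rule subspace_scale[OF W(1) subspace_diff[OF W(1) subspace_scale[OF W(1) that(2)] that(1)]])
    then show ?thesis
      by (simp only: diff_diff_eq2 add_diff_cancel_left' scale_scale left_inverse[OF qd_nonzero] scale_one)
  qed
  have XW: "X i v \<in> W" if "v \<in> W" for i v using W(3) that by (auto simp: maps_into_def)
  have gen: "maps_into ?Z f" if f: "lin f" "\<And>v j. v \<in> W \<Longrightarrow> v \<in> wt j \<Longrightarrow> \<exists>i. f v \<in> W \<inter> wt i" for f
  proof (rule maps_into_span_Union[OF f(1)])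
    fix j v assume "v \<in> W \<inter> wt j"
    then obtain i where "f v \<in> W \<inter> wt i" using f(2) by blast
    then show "\<exists>\<alpha> i. f v - scale \<alpha> v \<in> W \<inter> wt i" by (intro exI[of _ 0] exI[of _ i]) simp
  qed
  have "maps_into ?Z K"
  proof (rule gen[OF lin(1)])
    fix v j assume v: "v \<in> W" "v \<in> wt j"
    then show "\<exists>i. K v \<in> W \<inter> wt i"
      using wt_K[OF v(2)] W(1) by (intro exI[of _ j]) (auto intro: subspace_scale wt_subspace)
  qed
  moreover have "maps_into ?Z A"
  proof (rule gen[OF lin(3)])
    fix v j assume v: "v \<in> W" "v \<in> wt j"
    have "A v \<in> W" using op[of _ v A] XW[OF v(1), of 3] v(1) unfolding X_on_wt(4)[OF v(2)] by blast
    then show "\<exists>i. A v \<in> W \<inter> wt i" using wt_shift(1)[OF v(2)] by blast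
  qed
  moreover have "maps_into ?Z a"
  proof (rule gen[OF lin(4)])
    fix v j assume v: "v \<in> W" "v \<in> wt j"
    have "a v \<in> W" using op[of _ v a] XW[OF v(1), of 1] v(1) unfolding X_on_wt(2)[OF v(2)] by blast
    then show "\<exists>i. a v \<in> W \<inter> wt i" using wt_shift(3)[OF v(2)] by blast
  qed
  moreover have "?Z \<subseteq> V" using W(2) by (intro span_minimal[OF _ sub]) auto
  ultimately show ?thesis using irreducible_under_raising[OF subspace_span _ _ _ _ False] by blast
qed simp

lemma X_stable_containing_lowest:
  assumes W: "subspace W" "W \<subseteq> V" "\<And>i. maps_into W (X i)" and u: "u \<in> W" "u \<in> wt 0" "u \<noteq> 0"
  shows "W = V"
proof -
  have "u \<in> span (\<Union>j. W \<inter> wt j)" using u by (intro span_base) blast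
  then have "span (\<Union>j. W \<inter> wt j) = V" using X_stable_homogeneous[OF W] u(3) by auto
  moreover have "span (\<Union>j. W \<inter> wt j) \<subseteq> W" using W(1) by (intro span_minimal) auto
  ultimately show ?thesis using W(2) by auto
qed

lemma up_0: "up 0 = wt 0"
proof
  have "v \<in> wt 0" if "v \<in> up 0" for v
  proof (rule up_induct[OF lin_ident wt_subspace _ that])
    fix k v assume k: "k \<le> 0" "v \<in> wt k"
    show "v \<in> wt 0"
      using k wt_outside[OF k(2)] subspace_0[OF wt_subspace] by (cases "k = 0") auto
  qed
  then show "up 0 \<subseteq> wt 0" by blast
qed (simp add: wt_subset_up)

text \<open>
  If \<open>lead w\<close> is nonzero, then \<open>w\<close> has a nonzero component in the eigenspace of \<open>X 1\<close> for \<open>q\<^sup>d\<close>. This eigenspace is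
  \<open>wt 0\<close>, and a submodule that contains a nonzero vector of this line is everything.
\<close>

lemma lead_vanishes_on_proper:
  assumes W: "subspace W" "W \<subseteq> V" "\<And>i. maps_into W (X i)" and proper: "W \<noteq> V"
    and line: "wt 0 = span {u}" and w: "w \<in> W"
  shows "lead w = 0"
proof (rule ccontr)
  assume "lead w \<noteq> 0"
  let ?\<tau> = "\<lambda>j. q powi (int d - 2 * j)"
  let ?p = "root_poly {1..int d} ?\<tau>"
  define r where "r = papp (X 1) ?p w"
  have rW: "r \<in> W" unfolding r_def by (rule papp_closed[OF lin_X W(1,3) w])
  have "lead r = papp (\<lambda>v. scale (q powi int d) v) ?p (lead w)"
    unfolding r_def using w W(2)
    by (intro papp_intertwine[OF lin_X lin_scaled[OF lin_ident] X_V])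
       (auto simp: lin_simps[OF lin_lead] lead_X1 sub)
  also have "\<dots> = scale (poly ?p (q powi int d)) (lead w)"
    by (rule papp_eigen[OF lin_scaled[OF lin_ident] refl])
  finally have lr: "lead r = scale (poly ?p (q powi int d)) (lead w)" .
  moreover have "poly ?p (q powi int d) \<noteq> 0"
    unfolding poly_root_poly by (auto simp: powi_inject simp del: power_int_of_nat)
  ultimately have "lead r \<noteq> 0" using \<open>lead w \<noteq> 0\<close> by simp
  then have r0: "r \<noteq> 0" using lin_zero[OF lin_lead] by auto
  have eq: "{0..<int (Suc d)} = insert 0 {1..int d}" by auto
  have "root_poly {0..<int (Suc d)} ?\<tau> = [:- ?\<tau> 0, 1:] * ?p"
    unfolding eq by (rule root_poly_insert) auto
  moreover have "root_poly {0..<int 1} ?\<tau> = [:- ?\<tau> 0, 1:]" by (rule root_poly_single)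
  ultimately have "root_poly {0..<int (Suc d)} ?\<tau> = root_poly {0..<int 1} ?\<tau> * ?p" by (simp only:)
  moreover have "papp (X 1) (root_poly {0..<int (Suc d)} ?\<tau>) w = 0"
    using up_V[of w] w W(2) by (intro triangular_root_poly[OF X_triangular(2)]) auto
  ultimately have "papp (X 1) (root_poly {0..<int 1} ?\<tau>) r = 0"
    by (simp only: r_def papp_mult[OF lin_X])
  then have "r \<in> wt 0"
    using triangular_kernel[OF X_triangular(2), of r 1] rW W(2) by (auto simp: up_0)
  then show False using X_stable_containing_lowest[OF W rW _ r0] proper by blast
qed

text \<open>
  Write \<open>corner u\<close> as \<open>e\<close> plus eigenvectors of \<open>X 1\<close> for eigenvalues other than \<open>q\<^sup>d\<close>, with \<open>e\<close> an eigenvector for \<open>q\<^sup>d\<close>. If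
  \<open>lead (corner u)\<close> vanishes, then \<open>e = lead e = 0\<close>, and \<open>corner u\<close> lies in members of the flags of \<open>X 1\<close> and \<open>X 3\<close> that
  meet in zero.
\<close>

lemma drinfeld_nonzero_if_X_irreducible:
  assumes irr: "\<And>W. subspace W \<Longrightarrow> W \<subseteq> V \<Longrightarrow> (\<And>i. maps_into W (X i)) \<Longrightarrow> W = {0} \<or> W = V"
    and u: "u \<in> wt 0" "u \<noteq> 0" and s: "\<And>j. \<sigma> j u = scale (s j) u"
  shows "drinfeld_at_1 s \<noteq> 0"
proof
  assume zero: "drinfeld_at_1 s = 0"
  interpret bx: box_ops scale q V X d by (rule box_ops_X)
  interpret bi: box_irreducible scale q V X d
  proof unfold_locales
    show "W = {0} \<or> W = V" if "subspace W" "W \<subseteq> V" "\<And>i. maps_into W (X i)" for W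
      by (rule irr[OF that])
    show "{c. \<exists>v\<in>V. v \<noteq> 0 \<and> X i v = scale c v} = {q powi (2 * j - int d) | j. 0 \<le> j \<and> j \<le> int d}" for i
      by (rule spectrum_X)
  qed
  have e3: "corner u \<in> bx.E 3 0" using corner_X3[OF u(1)] corner_V[OF u(1)] by (simp add: bx.E_def)
  have "corner u \<in> bx.F 1 (int d)" using bi.F_full[of "int d" 1] corner_V[OF u(1)] by simp
  then obtain e where e: "e \<in> bx.E 1 (int d)" "corner u - e \<in> bx.F 1 (int d - 1)"
    using bi.F_split by blast
  have "lead v \<in> {0}" if "v \<in> bx.F 1 (int d - 1)" for v
  proof (rule bx.F_induct[OF lin_lead _ _ that])
    fix k v assume k: "k \<le> int d - 1" "v \<in> bx.E 1 k"
    then have "q powi (2 * k - int d) \<noteq> q powi int d" by (simp only: powi_inject)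
    then show "lead v \<in> {0}" using k lead_eigenvector[of v] by (auto simp: bx.E_def)
  qed simp
  then have "lead (corner u) = lead e" using e(2) lin_diff[OF lin_lead, of "corner u" e] by simp
  then have "lead e = 0" using lead_corner[OF u(1) s] zero by simp
  moreover have "e \<in> wt 0"
  proof -
    have "papp (X 1) (root_poly {0..<int 1} (\<lambda>j. q powi (int d - 2 * j))) e = 0"
      using e(1) by (simp only: root_poly_single papp_linear_factor[OF lin_X] bx.E_def) simp
    then show ?thesis
      using triangular_kernel[OF X_triangular(2), of e 1] e(1) by (simp add: up_0 bx.E_def)
  qed
  then have "lead e = e" using lead_wt[of e 0] by simp
  ultimately have c1: "corner u \<in> bx.F 1 (int d - 1)" using e(2) by simp
  have c3: "corner u \<in> bx.F 3 0" using e3 bx.E_subset_F[of 0 0 3] by auto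
  have "(3::4) + 2 = 1" by simp
  then have "bx.F 3 0 \<inter> bx.F 1 (int d - 1) = {0}" using bi.opposite_flags[of 3 0] by (simp only: diff_0_right)
  then have "corner u \<in> {0}" using c1 c3 by blast
  then show False using cmp_corner[OF u(1)] u(2) lin_zero[OF lin_cmp] by auto
qed

text \<open>
  Let \<open>Y\<close> be the largest submodule annihilated by \<open>lead\<close>; it contains every proper submodule. The members of the
  ascending and the descending flag of weight spaces that would be complementary without \<open>Y\<close> still meet only in \<open>Y\<close>
  after \<open>Y\<close> is added to both, because the intersections span a submodule that is proper: it does not contain \<open>corner u\<close>.
  Hence \<open>Y\<close> contains the weight components of its elements, and is therefore a submodule for \<open>U\<^sub>q(L(sl\<^sub>2))\<close>.
\<close>

lemma X_irreducible_if_drinfeld_nonzero: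
  assumes W: "subspace W" "W \<subseteq> V" "\<And>i. maps_into W (X i)"
    and u: "u \<in> wt 0" "u \<noteq> 0" "wt 0 = span {u}" and s: "\<And>j. \<sigma> j u = scale (s j) u"
    and nz: "drinfeld_at_1 s \<noteq> 0"
  shows "W = {0} \<or> W = V"
proof (cases "W = V")
  case False
  define Y where "Y = {v\<in>V. \<forall>p. lead (ev X p v) = 0}"
  have evX: "lin (ev X p)" for p by (rule lin_ev[OF lin_X])
  have Ysub: "subspace Y"
    using sub by (auto simp: Y_def subspace_def lin_simps[OF evX] lin_simps[OF lin_lead])
  have YV: "Y \<subseteq> V" by (auto simp: Y_def)
  have YX: "X i v \<in> Y" if "v \<in> Y" for i v
  proof -
    have "lead (ev X p (X i v)) = 0" for p
    proof -
      have "ev X p (X i v) = ev X (p * free_gen i) v" by (simp add: ev_mult[OF lin_X] ev_free_gen)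
      then show ?thesis using that by (simp add: Y_def)
    qed
    then show ?thesis using X_inV by (simp add: Y_def)
  qed
  have largest: "Z \<subseteq> Y" if Z: "subspace Z" "Z \<subseteq> V" "\<And>i. maps_into Z (X i)" "Z \<noteq> V" for Z
  proof
    fix z assume z: "z \<in> Z"
    have "lead (ev X p z) = 0" for p
    proof -
      have "ev X p z \<in> Z" by (rule ev_closed[OF Z(1)]) (use Z(3) z in auto)
      then show ?thesis by (rule lead_vanishes_on_proper[OF Z u(3)])
    qed
    then show "z \<in> Y" using z Z(2) by (auto simp: Y_def)
  qed
  have corner: "corner u \<notin> Y"
  proof
    assume "corner u \<in> Y"
    then have "lead (ev X 1 (corner u)) = 0" by (auto simp: Y_def)
    then show False using lead_corner[OF u(1) s] nz u(2) by (simp add: ev_1)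
  qed
  define P Q where "P j = span ((\<Union>k\<in>{..j}. wt k) \<union> Y)" and "Q j = span ((\<Union>k\<in>{j..}. wt k) \<union> Y)" for j
  have PQsub: "subspace (P j)" "subspace (Q j)" for j by (simp_all add: P_def Q_def)
  have YPQ: "Y \<subseteq> P j" "Y \<subseteq> Q j" for j by (auto simp: P_def Q_def intro: span_base)
  have wtP: "wt k \<subseteq> P j" if "k \<le> j" for k j using that by (auto simp: P_def intro!: span_base)
  have wtQ: "wt k \<subseteq> Q j" if "j \<le> k" for k j using that by (auto simp: Q_def intro!: span_base)
  have Pmono: "P j \<subseteq> P j'" if "j \<le> j'" for j j' unfolding P_def using that by (intro span_mono Un_mono UN_mono) auto
  have Qmono: "Q j' \<subseteq> Q j" if "j \<le> j'" for j j' unfolding Q_def using that by (intro span_mono Un_mono UN_mono) auto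
  have Pind: "f v \<in> Z" if "lin f" "subspace Z" "\<And>k v. k \<le> j \<Longrightarrow> v \<in> wt k \<Longrightarrow> f v \<in> Z" "\<And>v. v \<in> Y \<Longrightarrow> f v \<in> Z" "v \<in> P j" for f Z j v
    using span_image_subset[OF that(1,2) _ that(5)[unfolded P_def]] that(3,4) by auto
  have Qind: "f v \<in> Z" if "lin f" "subspace Z" "\<And>k v. j \<le> k \<Longrightarrow> v \<in> wt k \<Longrightarrow> f v \<in> Z" "\<And>v. v \<in> Y \<Longrightarrow> f v \<in> Z" "v \<in> Q j" for f Z j v
    using span_image_subset[OF that(1,2) _ that(5)[unfolded Q_def]] that(3,4) by auto
  have XY: "X i v - scale c v \<in> Y" if "v \<in> Y" for i c v
    using YX[OF that] that by (intro subspace_diff subspace_scale Ysub)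
  have XYPQ: "X i v - scale c v \<in> P j" "X i v - scale c v \<in> Q j" if "v \<in> Y" for i c v j
    using XY[OF that] YPQ by blast+
  have lin_shift: "lin (\<lambda>v. X i v - scale c v)" for i c by (intro lin_minus lin_X lin_scaled lin_ident)
  \<comment> \<open>the effect of a triangular operator on the two flags\<close>
  have lower: "X i v - scale (\<tau> j) v \<in> P (j - 1) \<inter> Q j"
    if T: "\<And>k v. v \<in> wt k \<Longrightarrow> X i v - scale (\<tau> k) v \<in> wt (k - 1)" and v: "v \<in> P j \<inter> Q (j + 1)" for i \<tau> j v
  proof
    show "X i v - scale (\<tau> j) v \<in> P (j - 1)"
    proof (rule Pind[OF lin_shift PQsub(1)])
      fix k v assume k: "k \<le> j" "v \<in> wt k"
      show "X i v - scale (\<tau> j) v \<in> P (j - 1)"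
      proof (cases "k = j")
        case True
        then show ?thesis using T[OF k(2)] wtP[of "j - 1" "j - 1"] by auto
      next
        case False
        then have "v \<in> P (j - 1)" "X i v - scale (\<tau> k) v \<in> P (j - 1)"
          using k T[OF k(2)] wtP[of k "j - 1"] wtP[of "k - 1" "j - 1"] by auto
        then have "(X i v - scale (\<tau> k) v) + scale (\<tau> k - \<tau> j) v \<in> P (j - 1)"
          by (intro subspace_add subspace_scale PQsub)
        then show ?thesis by (simp add: scale_left_diff_distrib)
      qed
    qed (use v XYPQ in blast)+
    show "X i v - scale (\<tau> j) v \<in> Q j"
    proof (rule Qind[OF lin_shift PQsub(2), of "j + 1"])
      fix k v assume k: "j + 1 \<le> k" "v \<in> wt k"
      then have "v \<in> Q j" "X i v - scale (\<tau> k) v \<in> Q j"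
        using T[OF k(2)] wtQ[of j k] wtQ[of j "k - 1"] by auto
      then have "(X i v - scale (\<tau> k) v) + scale (\<tau> k - \<tau> j) v \<in> Q j"
        by (intro subspace_add subspace_scale PQsub)
      then show "X i v - scale (\<tau> j) v \<in> Q j" by (simp add: scale_left_diff_distrib)
    qed (use v XYPQ in blast)+
  qed
  have raise: "X i v - scale (\<tau> (j + 1)) v \<in> P (j + 1) \<inter> Q (j + 2)"
    if T: "\<And>k v. v \<in> wt k \<Longrightarrow> X i v - scale (\<tau> k) v \<in> wt (k + 1)" and v: "v \<in> P j \<inter> Q (j + 1)" for i \<tau> j v
  proof
    show "X i v - scale (\<tau> (j + 1)) v \<in> Q (j + 2)"
    proof (rule Qind[OF lin_shift PQsub(2), of "j + 1"])
      fix k v assume k: "j + 1 \<le> k" "v \<in> wt k"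
      show "X i v - scale (\<tau> (j + 1)) v \<in> Q (j + 2)"
      proof (cases "k = j + 1")
        case True
        then show ?thesis using T[OF k(2)] wtQ[of "j + 2" "j + 2"] by (auto simp: add.assoc)
      next
        case False
        then have "v \<in> Q (j + 2)" "X i v - scale (\<tau> k) v \<in> Q (j + 2)"
          using k T[OF k(2)] wtQ[of "j + 2" k] wtQ[of "j + 2" "k + 1"] by auto
        then have "(X i v - scale (\<tau> k) v) + scale (\<tau> k - \<tau> (j + 1)) v \<in> Q (j + 2)"
          by (intro subspace_add subspace_scale PQsub)
        then show ?thesis by (simp add: scale_left_diff_distrib)
      qed
    qed (use v XYPQ in blast)+
    show "X i v - scale (\<tau> (j + 1)) v \<in> P (j + 1)"
    proof (rule Pind[OF lin_shift PQsub(1), of j])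
      fix k v assume k: "k \<le> j" "v \<in> wt k"
      then have "v \<in> P (j + 1)" "X i v - scale (\<tau> k) v \<in> P (j + 1)"
        using T[OF k(2)] wtP[of k "j + 1"] wtP[of "k + 1" "j + 1"] by auto
      then have "(X i v - scale (\<tau> k) v) + scale (\<tau> k - \<tau> (j + 1)) v \<in> P (j + 1)"
        by (intro subspace_add subspace_scale PQsub)
      then show "X i v - scale (\<tau> (j + 1)) v \<in> P (j + 1)" by (simp add: scale_left_diff_distrib)
    qed (use v XYPQ in blast)+
  qed
  let ?S = "\<lambda>j. P j \<inter> Q (j + 1)"
  have X1: "X 1 v - scale (q powi (int d - 2 * k)) v \<in> wt (k - 1)" if "v \<in> wt k" for k v
    using X_triangular(2) that by (auto simp: triangular_def)
  have X3: "X 3 v - scale (q powi (2 * k - int d)) v \<in> wt (k + 1)" if v: "v \<in> wt k" for k v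
    using X_on_wt(4)[OF v] wt_shift(1)[OF v] by (auto intro: subspace_neg subspace_scale wt_subspace)
  have stable: "maps_into (span (\<Union>j. ?S j)) (X i)" for i
  proof (rule maps_into_span_Union[OF lin_X])
    fix j v assume v: "v \<in> ?S j"
    have j: "Q (j - 1 + 1) = Q j" "Q (j + 1 + 1) = Q (j + 2)" by (simp_all add: add.assoc)
    show "\<exists>\<alpha> k. X i v - scale \<alpha> v \<in> ?S k"
      using exhaust_4[of i]
    proof (elim disjE)
      assume "i = 0"
      then show ?thesis
        using lower[of 0 "\<lambda>k. q powi (2 * k - int d)", OF X_on_wt(1) v] by (intro exI[of _ "q powi (2 * j - int d)"] exI[of _ "j - 1"]) (simp only: j)
    next
      assume "i = 1"
      then show ?thesis
        using lower[of 1 "\<lambda>k. q powi (int d - 2 * k)", OF X1 v] by (intro exI[of _ "q powi (int d - 2 * j)"] exI[of _ "j - 1"]) (simp only: j)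
    next
      assume "i = 2"
      then show ?thesis
        using raise[of 2 "\<lambda>k. q powi (int d - 2 * k)", OF X_on_wt(3) v]
        by (intro exI[of _ "q powi (int d - 2 * (j + 1))"] exI[of _ "j + 1"]) (simp only: j)
    next
      assume "i = 3"
      then show ?thesis
        using raise[of 3 "\<lambda>k. q powi (2 * k - int d)", OF X3 v]
        by (intro exI[of _ "q powi (2 * (j + 1) - int d)"] exI[of _ "j + 1"]) (simp only: j)
    qed
  qed
  have top: "?S j \<subseteq> P (int d - 1)" for j
  proof (cases "j \<le> int d - 1")
    case True
    then show ?thesis using Pmono by blast
  next
    case False
    have "v \<in> P (int d - 1)" if "v \<in> Q (j + 1)" for v
      by (rule Qind[OF lin_ident PQsub(1) _ _ that])
         (use False wt_outside subspace_0[OF PQsub(1)] YPQ in \<open>fastforce+\<close>)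
    then show ?thesis by blast
  qed
  have X0_corner: "X 0 (corner u) = scale (q powi int d) (corner u)"
  proof -
    interpret bx: box_ops scale q V X d by (rule box_ops_X)
    have "corner u \<in> bx.E 3 0" using corner_X3[OF u(1)] corner_V[OF u(1)] by (simp add: bx.E_def)
    from bx.next_E[OF this] have w: "X 0 (corner u) - scale (q powi int d) (corner u) \<in> bx.E 3 (- 1)"
      by (simp add: four_eq_zero)
    have "v = 0" if v: "v \<in> bx.E 3 (- 1)" for v
    proof (rule ccontr)
      assume "v \<noteq> 0"
      then have "q powi (2 * (- 1) - int d) \<in> {q powi (2 * j - int d) | j. 0 \<le> j \<and> j \<le> int d}"
        using v spectrum_X[of 3] unfolding bx.E_def by blast
      then show False by (auto simp: powi_inject)
    qed
    then show ?thesis using w by fastforce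
  qed
  have "corner u \<notin> P (int d - 1)"
  proof
    assume c: "corner u \<in> P (int d - 1)"
    let ?\<theta> = "\<lambda>k. q powi (2 * k - int d)"
    let ?f = "papp (X 0) (root_poly {0..<int d} ?\<theta>)"
    have lf: "lin ?f" by (rule lin_papp[OF lin_X])
    have "?f (corner u) \<in> Y"
    proof (rule Pind[OF lf Ysub _ _ c])
      fix k v assume k: "k \<le> int d - 1" "v \<in> wt k"
      then have "v \<in> up (int d - 1)" using wt_subset_up by blast
      then have "?f v = 0" by (rule triangular_root_poly[OF X_triangular(1)])
      then show "?f v \<in> Y" using subspace_0[OF Ysub] by simp
    next
      fix v assume "v \<in> Y"
      then show "?f v \<in> Y" using YX by (intro papp_closed[OF lin_X Ysub]) (auto simp: maps_into_def)
    qed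
    moreover have "?f (corner u) = scale (poly (root_poly {0..<int d} ?\<theta>) (q powi int d)) (corner u)"
      by (rule papp_eigen[OF lin_X X0_corner])
    moreover have c0: "poly (root_poly {0..<int d} ?\<theta>) (q powi int d) \<noteq> 0"
      unfolding poly_root_poly by (auto simp: powi_inject simp del: power_int_of_nat)
    ultimately have "scale (inverse (poly (root_poly {0..<int d} ?\<theta>) (q powi int d))) (?f (corner u)) = corner u"
      by simp
    then show False using corner subspace_scale[OF Ysub \<open>?f (corner u) \<in> Y\<close>] by metis
  qed
  then have "corner u \<notin> span (\<Union>j. ?S j)"
    using span_minimal[OF _ PQsub(1), of "\<Union>j. ?S j" "int d - 1"] top by blast
  then have ne: "span (\<Union>j. ?S j) \<noteq> V" using corner_V[OF u(1)] by blast
  have "P j \<subseteq> V" for j unfolding P_def using YV wt_V by (intro span_minimal[OF _ sub]) blast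
  then have "span (\<Union>j. ?S j) \<subseteq> V" by (intro span_minimal[OF _ sub]) blast
  then have "span (\<Union>j. ?S j) \<subseteq> Y" using largest[OF subspace_span _ stable ne] by blast
  then have SY: "?S j \<subseteq> Y" for j using span_superset[of "\<Union>j. ?S j"] by blast
  have comps: "(\<Sum>j\<in>{0..<int n}. f j) \<in> Y \<Longrightarrow> (\<And>j. f j \<in> wt j) \<Longrightarrow> \<forall>j\<in>{0..<int n}. f j \<in> Y" for f n
  proof (induction n)
    case (Suc n)
    have set: "{0..<int (Suc n)} = insert (int n) {0..<int n}" by auto
    have sum: "(\<Sum>j\<in>{0..<int (Suc n)}. f j) = f (int n) + (\<Sum>j\<in>{0..<int n}. f j)" unfolding set by simp
    have "(\<Sum>j\<in>{0..<int n}. f j) \<in> P (int n - 1)"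
    proof (rule subspace_sum[OF PQsub(1)])
      fix j assume "j \<in> {0..<int n}"
      then show "f j \<in> P (int n - 1)" using wtP[of j "int n - 1"] Suc.prems(2)[of j] by auto
    qed
    moreover have "(\<Sum>j\<in>{0..<int (Suc n)}. f j) \<in> P (int n - 1)" using Suc.prems(1) YPQ(1) by blast
    moreover have "f (int n) = (\<Sum>j\<in>{0..<int (Suc n)}. f j) - (\<Sum>j\<in>{0..<int n}. f j)" unfolding sum by simp
    ultimately have "f (int n) \<in> P (int n - 1)" by (simp only: subspace_diff[OF PQsub(1)])
    moreover have "f (int n) \<in> Q (int n - 1 + 1)" using wtQ[of "int n" "int n"] Suc.prems(2)[of "int n"] by auto
    ultimately have top: "f (int n) \<in> Y" using SY[of "int n - 1"] by blast
    have "(\<Sum>j\<in>{0..<int n}. f j) = (\<Sum>j\<in>{0..<int (Suc n)}. f j) - f (int n)" unfolding sum by simp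
    then have "(\<Sum>j\<in>{0..<int n}. f j) \<in> Y" using Suc.prems(1) top subspace_diff[OF Ysub] by metis
    then show ?case unfolding set using Suc.IH Suc.prems(2) top by blast
  qed simp
  have "Y \<subseteq> span (\<Union>j. Y \<inter> wt j)"
  proof
    fix y assume y: "y \<in> Y"
    then have yV: "y \<in> V" using YV by blast
    define f where "f j = (if j \<in> {0..int d} then cmp j y else 0)" for j
    have f: "f j \<in> wt j" for j using cmp_wt[OF yV] subspace_0[OF wt_subspace] by (simp add: f_def)
    have eq: "{0..<int (Suc d)} = {0..int d}" by auto
    have sum: "(\<Sum>j\<in>{0..<int (Suc d)}. f j) = y"
      unfolding eq using sum_cmp[OF yV] by (simp add: f_def)
    then have "\<forall>j\<in>{0..<int (Suc d)}. f j \<in> Y" using comps[of f "Suc d"] f y by metis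
    then have "(\<Sum>j\<in>{0..<int (Suc d)}. f j) \<in> span (\<Union>j. Y \<inter> wt j)"
      using f by (intro span_sum span_base) blast
    then show "y \<in> span (\<Union>j. Y \<inter> wt j)" by (simp only: sum)
  qed
  moreover have "span (\<Union>j. Y \<inter> wt j) = {0} \<or> span (\<Union>j. Y \<inter> wt j) = V"
    using X_stable_homogeneous[OF Ysub YV] YX by (auto simp: maps_into_def)
  moreover have "span (\<Union>j. Y \<inter> wt j) \<subseteq> Y" using Ysub by (intro span_minimal) auto
  ultimately have "Y \<subseteq> {0}" using corner corner_V[OF u(1)] by blast
  then show ?thesis using largest[OF W False] subspace_0[OF W(1)] by blast
qed simp

end


section \<open>The operators of an irreducible \<open>U\<^sub>q(L(sl\<^sub>2))\<close>-module of type 1\<close>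

context q_space
begin

lemma gen_ops_uq_relations:
  assumes g: "gen_ops g V" and lin: "\<And>x. lin (g x)" and inV: "\<And>x v. g x v \<in> V"
    and r: "r \<in> uq_rels q" and v: "v \<in> V"
  shows "ev g r v = 0"
proof -
  interpret U: uq_ops scale q V "g (KGen 0)" "g (KGen 1)" "g (EPlus 0)" "g (EPlus 1)" "g (EMinus 1)" "g (EMinus 0)"
    using g by (simp add: gen_ops_def)
  have KInv: "g (KInv 0) w = g (KGen 1) w" "g (KInv 1) w = g (KGen 0) w" if "w \<in> V" for w
    using g that by (auto simp: gen_ops_def)
  note E = ev_simps ev_mult[of g, OF lin] ev_power[of g, OF lin]
  have K0: "g (KGen 0) (g (KGen 1) v) = v" and K1: "g (KGen 1) (g (KGen 0) v) = v" using U.KKi v by auto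
  have w: "g (KGen 1) v \<in> V" "g (KGen 0) v \<in> V" by (rule inV)+
  have moves: "g (KGen 0) (g (EPlus 0) (g (KGen 1) v)) = scale (q powi 2) (g (EPlus 0) v)"
    "g (KGen 0) (g (EMinus 1) (g (KGen 1) v)) = scale (q powi 2) (g (EMinus 1) v)"
    "g (KGen 0) (g (EPlus 1) (g (KGen 1) v)) = scale (q powi (-2)) (g (EPlus 1) v)"
    "g (KGen 0) (g (EMinus 0) (g (KGen 1) v)) = scale (q powi (-2)) (g (EMinus 0) v)"
    unfolding U.KA[OF w(1)] U.KB[OF w(1)] U.Ka[OF w(1)] U.Kb[OF w(1)] K0 by simp_all
  interpret sw: uq_ops scale q V "g (KGen 1)" "g (KGen 0)" "g (EPlus 1)" "g (EPlus 0)" "g (EMinus 0)" "g (EMinus 1)"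
    by (rule U.swapped)
  have moves': "g (KGen 1) (g (EPlus 1) (g (KGen 0) v)) = scale (q powi 2) (g (EPlus 1) v)"
    "g (KGen 1) (g (EMinus 0) (g (KGen 0) v)) = scale (q powi 2) (g (EMinus 0) v)"
    "g (KGen 1) (g (EPlus 0) (g (KGen 0) v)) = scale (q powi (-2)) (g (EPlus 0) v)"
    "g (KGen 1) (g (EMinus 1) (g (KGen 0) v)) = scale (q powi (-2)) (g (EMinus 1) v)"
    unfolding sw.KA[OF w(2)] sw.KB[OF w(2)] sw.Ka[OF w(2)] sw.Kb[OF w(2)] K1 by simp_all
  have serre_ev: "ev g (serre q (free_gen x) (free_gen y)) v = 0" if "qserre V (g x) (g y)" for x y
    using that v by (simp add: serre_def qserre_def ev_simps ev_mult[of g, OF lin] power3_eq_cube power2_eq_square)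
  have i01: "i = 0 \<or> i = 1" for i :: 2 by (rule exhaust_2)
  from r consider i where "r = kk i * ki i - 1" | i where "r = ki i * kk i - 1"
    | "r = kk 0 * kk 1 - 1" | "r = kk 1 * kk 0 - 1"
    | i where "r = kk i * ep i * ki i - free_const (q powi 2) * ep i"
    | i where "r = kk i * em i * ki i - free_const (q powi (-2)) * em i"
    | i j where "i \<noteq> j" "r = kk i * ep j * ki i - free_const (q powi (-2)) * ep j"
    | i j where "i \<noteq> j" "r = kk i * em j * ki i - free_const (q powi 2) * em j"
    | i where "r = ep i * em i - em i * ep i - free_const (1 / qd) * (kk i - ki i)"
    | "r = ep 0 * em 1 - em 1 * ep 0" | "r = em 0 * ep 1 - ep 1 * em 0"
    | i j where "i \<noteq> j" "r = serre q (ep i) (ep j)" | i j where "i \<noteq> j" "r = serre q (em i) (em j)"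
    unfolding uq_rels_def Un_iff mem_Collect_eq insert_iff empty_iff by metis
  then show ?thesis
  proof cases
    case (1 i) then show ?thesis using i01[of i] by (auto simp: E KInv[OF v] K0 K1)
  next
    case (2 i) then show ?thesis using i01[of i] by (auto simp: E KInv[OF w(1)] KInv[OF w(2)] K0 K1)
  next
    case 3 then show ?thesis by (simp add: E K0)
  next
    case 4 then show ?thesis by (simp add: E K1)
  next
    case (5 i) then show ?thesis using i01[of i] moves(1) moves'(1) by (auto simp: E KInv[OF v])
  next
    case (6 i) then show ?thesis using i01[of i] moves(4) moves'(4) by (auto simp: E KInv[OF v])
  next
    case (7 i j) then show ?thesis using i01[of i] i01[of j] moves(3) moves'(3) by (auto simp: E KInv[OF v])
  next
    case (8 i j) then show ?thesis using i01[of i] i01[of j] moves(2) moves'(2) by (auto simp: E KInv[OF v])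
  next
    case (9 i) then show ?thesis using i01[of i] U.Ab[OF v] U.aB[OF v] by (auto simp: E KInv[OF v])
  next
    case 10 then show ?thesis using U.AB[OF v] by (simp add: E)
  next
    case 11 then show ?thesis using U.ab[OF v] by (simp add: E)
  next
    case (12 i j) then show ?thesis using i01[of i] i01[of j] serre_ev U.serres(1,2) by auto
  next
    case (13 i j) then show ?thesis using i01[of i] i01[of j] serre_ev U.serres(3,4) by auto
  qed
qed

lemma gen_ops_maps_into:
  assumes g: "gen_ops g V" and W: "W \<subseteq> V" "maps_into W (g (KGen 0))" "maps_into W (g (KGen 1))"
    "maps_into W (g (EPlus 0))" "maps_into W (g (EPlus 1))" "maps_into W (g (EMinus 1))" "maps_into W (g (EMinus 0))"
  shows "maps_into W (g x)"
proof -
  have "g (KInv 0) v = g (KGen 1) v" "g (KInv 1) v = g (KGen 0) v" if "v \<in> W" for v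
    using g W(1) that by (auto simp: gen_ops_def)
  then have "maps_into W (g (KInv 0))" "maps_into W (g (KInv 1))" using W by (auto simp: maps_into_def)
  then show ?thesis
    using W exhaust_2 by (cases x) metis+
qed

abbreviation uq_irr :: "(uq_gen \<Rightarrow> 'b \<Rightarrow> 'b) \<Rightarrow> 'b set \<Rightarrow> nat \<Rightarrow> bool" where
  "uq_irr g V d \<equiv> uq_irreducible scale q V (g (KGen 0)) (g (KGen 1)) (g (EPlus 0)) (g (EPlus 1)) (g (EMinus 1)) (g (EMinus 0)) d"

lemma sum_nat_int: "(\<Sum>j\<in>{0..int d}. f (nat j)) = (\<Sum>i\<le>d. f i)"
  by (rule sum.reindex_bij_witness[of _ int nat]) auto

text \<open>
  The decomposition in the definition of type 1 consists of the eigenspaces of \<open>K\<^sub>0\<close>, so it is unique.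
\<close>

lemma uq_irr_if_decomp:
  assumes M: "acts_by (uq_rels q) M g" and irr: "irreducible_module (uq_alg q) M" and fin: "fin_dim M"
    and dec: "uq_decomp q M d U"
  shows "uq_irr g (fst M) d" and "U i = (if i \<le> d then uq_graded.wt scale q (fst M) (g (KGen 0)) d (int i) else {0})"
proof -
  note D = acts_byD[OF M]
  have g: "gen_ops g (fst M)" by (rule acts_by_gen_ops[OF M])
  interpret O: uq_ops scale q "fst M" "g (KGen 0)" "g (KGen 1)" "g (EPlus 0)" "g (EPlus 1)" "g (EMinus 1)" "g (EMinus 0)"
    using g by (simp add: gen_ops_def)
  have kk: "snd M (uq_class q (kk i)) v = g (KGen i) v" if "v \<in> fst M" for i v
    using D(6)[OF that, of "kk i"] by (simp add: uq_class_def ev_free_gen)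
  have UM: "U i \<subseteq> fst M" and U0: "i \<le> d \<Longrightarrow> U i \<noteq> {0}" "i > d \<Longrightarrow> U i = {0}" "subspace (U i)" for i
    using dec unfolding uq_decomp_def by simp_all
  have Uex: "\<exists>u. (\<forall>i. u i \<in> U i) \<and> v = (\<Sum>i\<le>d. u i)" if "v \<in> fst M" for v
    using dec that unfolding uq_decomp_def by (meson ex1_implies_ex)
  have UK: "g (KGen 0) u = scale (q powi (2 * int i - int d)) u" if "i \<le> d" "u \<in> U i" for i u
  proof -
    have "u \<in> fst M" using UM that(2) by blast
    moreover have "snd M (uq_class q (kk 0)) u = scale (q powi (2 * int i - int d)) u"
      using dec that unfolding uq_decomp_def by blast
    ultimately show ?thesis using kk by simp
  qed
  interpret G: uq_graded scale q "fst M" "g (KGen 0)" "g (KGen 1)" "g (EPlus 0)" "g (EPlus 1)" "g (EMinus 1)" "g (EMinus 0)" d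
  proof unfold_locales
    show "\<exists>S. finite S \<and> fst M \<subseteq> span S" using fin by (auto simp: fin_dim_def)
    fix v assume "v \<in> fst M"
    then obtain u where u: "\<And>i. u i \<in> U i" "v = (\<Sum>i\<le>d. u i)" using Uex by blast
    have "u (nat j) \<in> fst M \<and> g (KGen 0) (u (nat j)) = scale (q powi (2 * j - int d)) (u (nat j))"
      if "j \<in> {0..int d}" for j
      using that u(1)[of "nat j"] UM[of "nat j"] UK[of "nat j" "u (nat j)"] by auto
    then show "\<exists>u. (\<forall>j\<in>{0..int d}. u j \<in> fst M \<and> g (KGen 0) (u j) = scale (q powi (2 * j - int d)) (u j)) \<and> v = (\<Sum>j\<in>{0..int d}. u j)"
      by (intro exI[of _ "\<lambda>j. u (nat j)"] conjI ballI) (simp_all only: u(2) sum_nat_int)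
  qed
  have Uwt: "U i \<subseteq> G.wt (int i)" if "i \<le> d" for i
    using UK[OF that] UM by (auto simp: G.wt_def)
  show "U i = (if i \<le> d then G.wt (int i) else {0})"
  proof (cases "i \<le> d")
    case True
    have "v \<in> U i" if v: "v \<in> G.wt (int i)" for v
    proof -
      obtain u where u: "\<And>i. u i \<in> U i" "v = (\<Sum>i\<le>d. u i)" using Uex[OF G.wt_V[OF v]] by blast
      have uw: "u (nat j) \<in> G.wt j" if "j \<in> {0..int d}" for j
      proof -
        have "nat j \<le> d" "int (nat j) = j" using that by auto
        then show ?thesis using Uwt[of "nat j"] u(1)[of "nat j"] by auto
      qed
      have "G.cmp (int i) v = G.cmp (int i) (\<Sum>j\<in>{0..int d}. u (nat j))" by (simp only: u(2) sum_nat_int)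
      also have "\<dots> = u i" using G.cmp_sum[of "\<lambda>j. u (nat j)" "int i"] uw True by simp
      finally show ?thesis using G.cmp_eigen[OF v, of "int i"] True u(1)[of i] by simp
    qed
    then show ?thesis using Uwt[OF True] True by auto
  qed (use U0 in simp)
  have irr': "fst M \<noteq> {0} \<and> (\<forall>W. subspace W \<and> W \<subseteq> fst M \<and> (\<forall>x. maps_into W (g x)) \<longrightarrow> W = {0} \<or> W = fst M)"
    using irr irreducible_iff[OF M] by (simp add: uq_alg_def)
  show "uq_irr g (fst M) d"
  proof unfold_locales
    show "W = {0} \<or> W = fst M"
      if "subspace W" "W \<subseteq> fst M" "maps_into W (g (KGen 0))" "maps_into W (g (KGen 1))" "maps_into W (g (EPlus 0))"
        "maps_into W (g (EPlus 1))" "maps_into W (g (EMinus 1))" "maps_into W (g (EMinus 0))" for W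
      using irr' gen_ops_maps_into[OF g that(2-8)] that(1,2) by blast
    show "\<exists>v\<in>fst M. v \<noteq> 0 \<and> g (KGen 0) v = scale (q powi (2 * j - int d)) v" if "0 \<le> j" "j \<le> int d" for j
    proof -
      have "U (nat j) \<noteq> {0}" "nat j \<le> d" using U0(1)[of "nat j"] that by auto
      then obtain v where v: "v \<in> U (nat j)" "v \<noteq> 0" using subspace_0[OF U0(3), of "nat j"] by blast
      then show ?thesis using UK[of "nat j" v] UM[of "nat j"] that \<open>nat j \<le> d\<close> by auto
    qed
  qed
qed

lemma spectrum_determines_diameter:
  assumes "{q powi (2 * j - int d) | j. 0 \<le> j \<and> j \<le> int d} = {q powi (2 * j - int d') | j. 0 \<le> j \<and> j \<le> int d'}"
  shows "d = d'"
proof -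
  have "d \<le> d'" if "{q powi (2 * j - int d) | j. 0 \<le> j \<and> j \<le> int d} = {q powi (2 * j - int d') | j. 0 \<le> j \<and> j \<le> int d'}" for d d'
  proof -
    have "\<exists>j. q powi (2 * int d - int d) = q powi (2 * j - int d) \<and> 0 \<le> j \<and> j \<le> int d"
      by (rule exI[of _ "int d"]) simp
    then have "q powi (2 * int d - int d) \<in> {q powi (2 * j - int d') | j. 0 \<le> j \<and> j \<le> int d'}"
      unfolding that[symmetric] by (rule CollectI)
    then obtain j where "q powi (2 * int d - int d) = q powi (2 * j - int d')" "j \<le> int d'"
      by (elim CollectE exE conjE)
    then have "2 * int d - int d = 2 * j - int d'" by (simp only: powi_inject)
    then show "d \<le> d'" using \<open>j \<le> int d'\<close> by linarith
  qed
  from this[OF assms] this[OF assms[symmetric]] show ?thesis by (rule antisym)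
qed

lemma (in uq_irreducible) spectrum_K:
  "{c. \<exists>v\<in>V. v \<noteq> 0 \<and> K v = scale c v} = {q powi (2 * j - int d) | j. 0 \<le> j \<and> j \<le> int d}"
proof -
  have "triangular K (\<lambda>j. q powi (2 * j - int d))"
    unfolding triangular_def
  proof (intro conjI allI ballI lin(1))
    show "inj (\<lambda>j. q powi (2 * j - int d))" by (rule injI) (simp add: powi_inject)
    show "K u - scale (q powi (2 * j - int d)) u \<in> wt (j - 1)" if "u \<in> wt j" for j u
      unfolding wt_K[OF that] by (simp add: subspace_0[OF wt_subspace])
  qed
  from triangular_spectrum[OF this nonzero_wt maps_into_V(1)] show ?thesis .
qed

text \<open>
  The description of the diameter, of the lowest weight space and of the \<open>\<sigma>\<^sub>j\<close> as unique objects is justified by the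
  uniqueness of the decomposition and by \<open>lowest_weight_line\<close>.
\<close>

lemma uq_drinfeld:
  assumes M: "acts_by (uq_rels q) M g" and irr: "irreducible_module (uq_alg q) M" and fin: "fin_dim M"
    and type: "uq_type1 q M"
  shows "\<exists>d u s. uq_irr g (fst M) d \<and> u \<in> uq_graded.wt scale q (fst M) (g (KGen 0)) d 0 \<and> u \<noteq> 0 \<and>
    uq_graded.wt scale q (fst M) (g (KGen 0)) d 0 = span {u} \<and>
    (\<forall>j. uq_graded.\<sigma> (g (EPlus 0)) (g (EPlus 1)) j u = scale (s j) u) \<and>
    poly (drinfeld_poly q M) 1 = uq_irreducible.drinfeld_at_1 q d s"
proof -
  note D = acts_byD[OF M]
  obtain d U where dec: "uq_decomp q M d U" using type by (auto simp: uq_type1_def)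
  note irr_d = uq_irr_if_decomp(1)[OF M irr fin] and U_eq = uq_irr_if_decomp(2)[OF M irr fin]
  interpret I: uq_irreducible scale q "fst M" "g (KGen 0)" "g (KGen 1)" "g (EPlus 0)" "g (EPlus 1)" "g (EMinus 1)" "g (EMinus 0)" d
    by (rule irr_d[OF dec])
  have "d' = d" if dec': "uq_decomp q M d' U'" for d' U'
  proof -
    interpret J: uq_irreducible scale q "fst M" "g (KGen 0)" "g (KGen 1)" "g (EPlus 0)" "g (EPlus 1)" "g (EMinus 1)" "g (EMinus 0)" d'
      by (rule irr_d[OF dec'])
    show ?thesis using I.spectrum_K J.spectrum_K by (intro spectrum_determines_diameter) simp
  qed
  then have diam: "uq_diam q M = d" unfolding uq_diam_def using dec by (intro the_equality) blast+
  have "U' = U" if "uq_decomp q M d U'" for U' using U_eq[OF that] U_eq[OF dec] by auto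
  then have "uq_wt q M = U" unfolding uq_wt_def diam using dec by (intro the_equality) blast+
  then have wt: "uq_wt q M 0 = I.wt 0" using U_eq[OF dec, of 0] by simp
  obtain u where u: "u \<in> I.wt 0" "u \<noteq> 0" "I.wt 0 = span {u}" "\<forall>j. \<exists>s. I.\<sigma> j u = scale s u"
    using I.lowest_weight_line by blast
  then obtain s where s: "\<And>j. I.\<sigma> j u = scale (s j) u" by metis
  have act: "snd M (uq_class q (ep 1 ^ j * ep 0 ^ j)) w = I.\<sigma> j w" if "w \<in> fst M" for j w
  proof -
    have "ev g (free_gen x) = g x" for x by (rule ext) (rule ev_free_gen)
    then show ?thesis
      using D(6)[OF that, of "ep 1 ^ j * ep 0 ^ j"]
      by (simp add: uq_class_def ev_mult[of g, OF D(2)] ev_power[of g, OF D(2)] I.\<sigma>_def)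
  qed
  have sig: "drinfeld_sigma q M j = s j" for j
    unfolding drinfeld_sigma_def wt
  proof (rule the_equality)
    show "\<forall>w\<in>I.wt 0. snd M (uq_class q (ep 1 ^ j * ep 0 ^ j)) w = scale (s j) w"
    proof
      fix w assume w: "w \<in> I.wt 0"
      then obtain c where "w = scale c u" using u(3) by (auto simp: span_singleton)
      then show "snd M (uq_class q (ep 1 ^ j * ep 0 ^ j)) w = scale (s j) w"
        using act[OF I.wt_V[OF w]] s by (simp add: lin_scale[OF I.lin_\<sigma>] mult.commute)
    qed
    fix t assume "\<forall>w\<in>I.wt 0. snd M (uq_class q (ep 1 ^ j * ep 0 ^ j)) w = scale t w"
    then have "scale (s j) u = scale t u" using act[OF I.wt_V[OF u(1)]] s u(1) by metis
    then show "t = s j" using u(2) by (metis scale_right_imp_eq)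
  qed
  have "poly (drinfeld_poly q M) 1 = I.drinfeld_at_1 s"
    by (simp add: drinfeld_poly_def diam sig poly_sum poly_monom I.drinfeld_at_1_def)
  then show ?thesis using I.uq_irreducible_axioms u(1-3) s irr_d[OF dec] by blast
qed


section \<open>Pulling back along \<open>\<psi>\<close>\<close>

lemma spectrum_reindex:
  "{q powi (int d - 2 * int n) | n. n \<le> d} = {q powi (2 * j - int d) | j. 0 \<le> j \<and> j \<le> int d}"
proof -
  have "\<exists>j. q powi (int d - 2 * int n) = q powi (2 * j - int d) \<and> 0 \<le> j \<and> j \<le> int d" if "n \<le> d" for n
    using that by (intro exI[of _ "int d - int n"]) simp
  moreover have "\<exists>n. q powi (2 * j - int d) = q powi (int d - 2 * int n) \<and> n \<le> d" if "0 \<le> j" "j \<le> int d" for j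
    using that by (intro exI[of _ "nat (int d - j)"]) auto
  ultimately show ?thesis by blast
qed

lemma box_type_diam_1:
  "box_type_diam q N 1 d \<longleftrightarrow> (\<forall>i. eigenvalues_on N (box_x q i) = {q powi (2 * j - int d) | j. 0 \<le> j \<and> j \<le> int d})"
proof -
  have "(\<forall>i. P i) \<longleftrightarrow> (\<forall>i\<in>{0,2}. P i) \<and> (\<forall>i\<in>{1,3}. P i)" for P :: "4 \<Rightarrow> bool"
    using exhaust_4 by (metis insertCI)
  then show ?thesis unfolding box_type_diam_def by (simp only: spectrum_reindex mult_1_left inverse_1)
qed

lemma eigenvalues_acts_by:
  assumes "acts_by (box_rels q) N x"
  shows "eigenvalues_on N (box_x q i) = {c. \<exists>v\<in>fst N. v \<noteq> 0 \<and> x i v = scale c v}"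
proof -
  have "snd N (box_x q i) v = x i v" if "v \<in> fst N" for v
    using acts_byD(6)[OF assms that, of "xg i"] by (simp add: box_x_def ev_free_gen)
  then show ?thesis by (auto simp: eigenvalues_on_def)
qed

lemma pullback_in_box_modules:
  assumes M: "M \<in> uq_modules q"
  shows "pullback (psi q) M \<in> box_modules q"
proof -
  have irr: "irreducible_module (uq_alg q) M" and fin: "fin_dim M" and type: "uq_type1 q M"
    and nz: "poly (drinfeld_poly q M) 1 \<noteq> 0" using M by (auto simp: uq_modules_def)
  obtain g where g: "acts_by (uq_rels q) M g"
    using alg_module_imp_acts_by[of "uq_rels q" M] irr by (auto simp: irreducible_module_def uq_alg_def split: prod.splits)
  obtain d u s where I: "uq_irr g (fst M) d"
    and u: "u \<in> uq_graded.wt scale q (fst M) (g (KGen 0)) d 0" "u \<noteq> 0"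
      "uq_graded.wt scale q (fst M) (g (KGen 0)) d 0 = span {u}"
    and s: "\<And>j. uq_graded.\<sigma> (g (EPlus 0)) (g (EPlus 1)) j u = scale (s j) u"
    and P: "poly (drinfeld_poly q M) 1 = uq_irreducible.drinfeld_at_1 q d s"
    using uq_drinfeld[OF g irr fin type] by blast
  interpret I: uq_irreducible scale q "fst M" "g (KGen 0)" "g (KGen 1)" "g (EPlus 0)" "g (EPlus 1)" "g (EMinus 1)" "g (EMinus 0)" d
    by (rule I)
  have pb: "acts_by (box_rels q) (pullback (psi q) M) I.X" by (rule pullback_acts_by[OF g])
  have fst: "fst (pullback (psi q) M) = fst M" by (simp add: pullback_def)
  have "W = {0} \<or> W = fst M" if "subspace W" "W \<subseteq> fst M" "\<forall>i. maps_into W (I.X i)" for W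
    using I.X_irreducible_if_drinfeld_nonzero[OF that(1,2) _ u s] that(3) nz P by simp
  then have "irreducible_module (box_alg q) (pullback (psi q) M)"
    unfolding box_alg_def irreducible_iff[OF pb] fst using u(2) I.wt_V[OF u(1)] by blast
  moreover have "fin_dim (pullback (psi q) M)" using fin by (simp add: fin_dim_def fst)
  moreover have "box_type_diam q (pullback (psi q) M) 1 d"
    unfolding box_type_diam_1 eigenvalues_acts_by[OF pb] fst by (simp only: I.spectrum_X simp_thms)
  ultimately show ?thesis unfolding box_modules_def box_type_def by auto
qed

text \<open>
  The module is irreducible over \<open>U\<^sub>q(L(sl\<^sub>2))\<close> because it already is over \<open>\<box>\<^sub>q\<close>; that \<open>P(1) \<noteq> 0\<close> is another consequence of irreducibility over \<open>\<box>\<^sub>q\<close>.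
\<close>

lemma box_module_is_pullback:
  assumes N: "N \<in> box_modules q"
  shows "\<exists>M\<in>uq_modules q. module_iso (box_alg q) (pullback (psi q) M) N"
proof -
  have irr: "irreducible_module (box_alg q) N" and fin: "fin_dim N" and type: "box_type q N 1"
    using N by (auto simp: box_modules_def)
  obtain x where x: "acts_by (box_rels q) N x"
    using alg_module_imp_acts_by[of "box_rels q" N] irr by (auto simp: irreducible_module_def box_alg_def split: prod.splits)
  note D = acts_byD[OF x]
  obtain d where d: "box_type_diam q N 1 d" using type by (auto simp: box_type_def)
  define V where "V = fst N"
  have rels: "qweyl V (x i) (x (i + 1))" "qserre V (x i) (x (i + 2))" for i
    using ev_box_relations[of x V, OF D(2) D(5)] by (auto simp: V_def)
  interpret B: box_irreducible scale q V x d
  proof unfold_locales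
    show "{c. \<exists>v\<in>V. v \<noteq> 0 \<and> x i v = scale c v} = {q powi (2 * j - int d) | j. 0 \<le> j \<and> j \<le> int d}" for i
      using d unfolding box_type_diam_1 eigenvalues_acts_by[OF x] V_def by blast
    show "W = {0} \<or> W = V" if "subspace W" "W \<subseteq> V" "\<And>i. maps_into W (x i)" for W
      using irr that unfolding box_alg_def irreducible_iff[OF x] V_def by blast
  qed (use D(1,2,3) rels in \<open>auto simp: V_def\<close>)
  obtain K Ki A a B' b where ops: "uq_ops scale q V K Ki A a B' b"
    and X: "\<And>i v. v \<in> V \<Longrightarrow> uq_pre.X scale q K Ki A a B' b i v = x i v"
    and KU: "\<And>j u. u \<in> B.U j \<Longrightarrow> K u = scale (q powi (2 * j - int d)) u"
    using B.exists_uq_ops by blast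
  interpret O: uq_ops scale q V K Ki A a B' b by (rule ops)
  define g where "g y = (case y of EPlus i \<Rightarrow> if i = 0 then A else a | EMinus i \<Rightarrow> if i = 0 then b else B'
      | KGen i \<Rightarrow> if i = 0 then K else Ki | KInv i \<Rightarrow> if i = 0 then Ki else K)" for y
  have g: "g (KGen 0) = K" "g (KGen 1) = Ki" "g (EPlus 0) = A" "g (EPlus 1) = a" "g (EMinus 1) = B'" "g (EMinus 0) = b"
    "g (KInv 0) = Ki" "g (KInv 1) = K"
    by (simp_all add: g_def)
  have ling: "lin (g y)" and gV: "g y v \<in> V" for y v
    using O.lin O.inV by (auto simp: g_def split: uq_gen.splits)
  have go: "gen_ops g V" using ops by (simp add: gen_ops_def g)
  have relg: "ev g r v = 0" if "r \<in> uq_rels q" "v \<in> V" for r v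
    by (rule gen_ops_uq_relations[OF go ling gV that])
  define M where "M = (V, \<lambda>c. ev g (SOME p. c = rel_class (uq_rels q) p))"
  have fM: "fst M = V" by (simp add: M_def)
  have M: "acts_by (uq_rels q) M g"
    unfolding acts_by_def fM
  proof (intro conjI allI ballI B.sub ling gV relg)
    fix p v assume v: "v \<in> V"
    let ?p = "SOME r. rel_class (uq_rels q) p = rel_class (uq_rels q) r"
    have "rel_class (uq_rels q) p = rel_class (uq_rels q) ?p" by (rule someI) (rule refl)
    then have "p - ?p \<in> Idl\<^bsub>free_ring\<^esub> (uq_rels q)" by (simp only: rel_class_eq_iff)
    then have "ev g (p - ?p) v = 0"
      by (intro ev_Idl[OF B.sub ling _ relg _ v]) (use gV in \<open>auto simp: maps_into_def\<close>)
    then show "snd M (rel_class (uq_rels q) p) v = ev g p v" by (simp add: M_def ev_diff)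
  qed
  have pb: "acts_by (box_rels q) (pullback (psi q) M) O.X"
    using pullback_acts_by[OF M] by (simp only: g)
  have fP: "fst (pullback (psi q) M) = V" by (simp add: pullback_def fM)
  have iso: "module_iso (box_alg q) (pullback (psi q) M) N"
    unfolding box_alg_def module_iso_iff[OF pb x] fP
    by (intro exI[of _ "\<lambda>v. v"]) (auto simp: bij_betw_def V_def[symmetric] X)
  have X_inv: "maps_into W (O.X i)" if "subspace W" "\<And>y. maps_into W (g y)" for W i
    using exhaust_4[of i] that(2)[of "KGen 0"] that(2)[of "KGen 1"] that(2)[of "EPlus 0"] that(2)[of "EPlus 1"]
      that(2)[of "EMinus 0"] that(2)[of "EMinus 1"]
    unfolding g maps_into_def
    by (auto simp: O.X_simps intro!: subspace_add[OF that(1)] subspace_diff[OF that(1)] subspace_scale[OF that(1)])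
  have V0: "V \<noteq> {0}" and irrX: "\<And>W. subspace W \<Longrightarrow> W \<subseteq> V \<Longrightarrow> (\<And>i. maps_into W (O.X i)) \<Longrightarrow> W = {0} \<or> W = V"
  proof -
    show "V \<noteq> {0}" using irr unfolding box_alg_def irreducible_iff[OF x] V_def by blast
    fix W assume W: "subspace W" "W \<subseteq> V" "\<And>i. maps_into W (O.X i)"
    have "maps_into W (x i)" for i using W(2) W(3)[of i] X by (auto simp: maps_into_def subset_iff)
    then show "W = {0} \<or> W = V" using B.irred W(1,2) by blast
  qed
  have irrM: "irreducible_module (uq_alg q) M"
    unfolding uq_alg_def irreducible_iff[OF M] fM using V0 irrX X_inv by blast
  have finM: "fin_dim M" using fin by (simp add: fin_dim_def fM V_def)
  define U where "U i = (if i \<le> d then B.U (int i) else {0})" for i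
  have UV: "B.U j \<subseteq> V" for j using B.F_subset_V by (auto simp: B.S_def)
  have kk: "snd M (uq_class q (kk i)) v = g (KGen i) v" if "v \<in> V" for i v
    using acts_byD(6)[OF M, of v "kk i"] that by (simp add: fM uq_class_def ev_free_gen)
  have "uq_decomp q M d U"
    unfolding uq_decomp_def fM
  proof (intro conjI allI ballI impI)
    fix i
    show "subspace (U i)" by (simp add: U_def B.S_subspace)
    show "U i \<subseteq> V" using UV subspace_0[OF B.sub] by (auto simp: U_def)
    show "U i \<noteq> {0}" if "i \<le> d" using B.U_nonzero[of "int i"] that by (simp add: U_def)
    show "U i = {0}" if "d < i" using that by (simp add: U_def)
    fix u assume i: "i \<le> d" and u: "u \<in> U i"
    then have uU: "u \<in> B.U (int i)" and uV: "u \<in> V" using UV by (auto simp: U_def)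
    show "snd M (uq_class q (kk 0)) u = scale (q powi (2 * int i - int d)) u"
      using KU[OF uU] by (simp add: kk[OF uV] g)
    have "Ki (K u) = u" using O.KKi(2)[OF uV] .
    then have "u = scale (q powi (2 * int i - int d)) (Ki u)" by (simp add: KU[OF uU] lin_scale[OF O.lin(2)])
    then have "scale (q powi (int d - 2 * int i)) u = scale (q powi (int d - 2 * int i) * q powi (2 * int i - int d)) (Ki u)"
      by (metis scale_scale)
    then show "snd M (uq_class q (kk 1)) u = scale (q powi (int d - 2 * int i)) u"
      using q_nonzero by (simp add: kk[OF uV] g flip: power_int_add)
  next
    fix v assume v: "v \<in> V"
    obtain w where w: "\<forall>j\<in>{0..int d}. w j \<in> B.U j" "v = (\<Sum>j\<in>{0..int d}. w j)" using B.U_decomposition[OF v] by blast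
    define u where "u i = (if i \<le> d then w (int i) else 0)" for i
    have sum_int: "(\<Sum>j\<in>{0..int d}. h j) = (\<Sum>i\<le>d. h (int i))" for h :: "int \<Rightarrow> 'b"
      by (rule sum.reindex_bij_witness[of _ int nat]) auto
    show "\<exists>!u. (\<forall>i. u i \<in> U i) \<and> v = (\<Sum>i\<le>d. u i)"
    proof (rule ex1I[of _ u])
      show "(\<forall>i. u i \<in> U i) \<and> v = (\<Sum>i\<le>d. u i)"
        using w by (auto simp: u_def U_def sum_int)
      fix u' assume u': "(\<forall>i. u' i \<in> U i) \<and> v = (\<Sum>i\<le>d. u' i)"
      have "(\<Sum>j\<in>{0..int d}. u' (nat j) - w j) = 0"
        using u' w(2) by (simp add: sum_subtractf sum_nat_int)
      moreover have "\<forall>j\<in>{0..int d}. u' (nat j) - w j \<in> B.U j"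
      proof
        fix j assume j: "j \<in> {0..int d}"
        have "u' (nat j) \<in> U (nat j)" using u' by blast
        then have "u' (nat j) \<in> B.U j" using j by (simp add: U_def split: if_splits)
        then show "u' (nat j) - w j \<in> B.U j" using w(1) j by (intro subspace_diff[OF B.S_subspace]) auto
      qed
      ultimately have z: "u' (nat j) - w j = 0" if "j \<in> {0..int d}" for j
        using B.U_independent[of "\<lambda>j. u' (nat j) - w j"] that by blast
      show "u' = u"
      proof
        fix i show "u' i = u i"
          using z[of "int i"] conjunct1[OF u', rule_format, of i] by (cases "i \<le> d") (auto simp: u_def U_def)
      qed
    qed
  qed
  then have typeM: "uq_type1 q M" by (auto simp: uq_type1_def)
  obtain d' u s where I: "uq_irr g (fst M) d'"
    and u: "u \<in> uq_graded.wt scale q (fst M) (g (KGen 0)) d' 0" "u \<noteq> 0"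
    and s: "\<And>j. uq_graded.\<sigma> (g (EPlus 0)) (g (EPlus 1)) j u = scale (s j) u"
    and P: "poly (drinfeld_poly q M) 1 = uq_irreducible.drinfeld_at_1 q d' s"
    using uq_drinfeld[OF M irrM finM typeM] by blast
  interpret I: uq_irreducible scale q V K Ki A a B' b d' using I by (simp only: g fM)
  have "poly (drinfeld_poly q M) 1 \<noteq> 0"
    unfolding P by (rule I.drinfeld_nonzero_if_X_irreducible[OF irrX]) (use u s in \<open>simp_all add: g fM\<close>)
  then have "M \<in> uq_modules q" using irrM finM typeM by (simp add: uq_modules_def)
  then show ?thesis using iso by blast
qed

lemma psi_carrier: "c \<in> carrier (box_alg q) \<Longrightarrow> psi q c \<in> carrier (uq_alg q)"
  by (auto simp: box_alg_def uq_alg_def carrier_presented psi_rel_class uq_class_def)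

lemma pullback_iso: "module_iso (uq_alg q) M M' \<Longrightarrow> module_iso (box_alg q) (pullback (psi q) M) (pullback (psi q) M')"
  unfolding module_iso_def pullback_def using psi_carrier by auto

end

context uq_irreducible
begin

lemma cmp_up_less: "v \<in> up m \<Longrightarrow> m < i \<Longrightarrow> i \<in> {0..int d} \<Longrightarrow> cmp i v = 0"
proof -
  assume v: "v \<in> up m" "m < i" and i: "i \<in> {0..int d}"
  have "up m \<subseteq> up (i - 1)" using v(2) unfolding up_def by (intro span_mono UN_mono) auto
  then show ?thesis using cmp_up[OF _ i] v(1) by blast
qed

text \<open>The weight spaces are determined by \<open>X 0\<close> and \<open>X 2\<close>.\<close>

lemma wt_iff_X:
  assumes v: "v \<in> V" and n: "n \<le> d"
  shows "v \<in> wt (int n) \<longleftrightarrow>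
      papp (X 0) (root_poly {0..<int (Suc n)} (\<lambda>j. q powi (2 * j - int d))) v = 0 \<and>
      papp (X 2) (root_poly {0..<int (Suc (d - n))} (\<lambda>j. q powi (2 * j - int d))) v = 0"
proof -
  interpret sw: uq_irreducible scale q V Ki K a A b B d by (rule swapped_irreducible)
  have X2: "sw.X 0 = X 2" by (simp add: swapped_X)
  show ?thesis
  proof
    assume w: "v \<in> wt (int n)"
    have "v \<in> up (int n)" using w wt_subset_up[of "int n" "int n"] by auto
    moreover have "v \<in> sw.wt (int (d - n))" using w n by (simp add: swapped_wt of_nat_diff)
    then have "v \<in> sw.up (int (d - n))" using sw.wt_subset_up[of "int (d - n)" "int (d - n)"] by auto
    ultimately show "papp (X 0) (root_poly {0..<int (Suc n)} (\<lambda>j. q powi (2 * j - int d))) v = 0 \<and>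
      papp (X 2) (root_poly {0..<int (Suc (d - n))} (\<lambda>j. q powi (2 * j - int d))) v = 0"
      using triangular_root_poly[OF X_triangular(1), of v "Suc n"]
        sw.triangular_root_poly[OF sw.X_triangular(1), of v "Suc (d - n)"] by (simp add: X2)
  next
    assume "papp (X 0) (root_poly {0..<int (Suc n)} (\<lambda>j. q powi (2 * j - int d))) v = 0 \<and>
      papp (X 2) (root_poly {0..<int (Suc (d - n))} (\<lambda>j. q powi (2 * j - int d))) v = 0"
    then have 1: "v \<in> up (int n)" and 2: "v \<in> sw.up (int (d - n))"
      using triangular_kernel[OF X_triangular(1) v, of "Suc n"]
        sw.triangular_kernel[OF sw.X_triangular(1) v, of "Suc (d - n)"] by (simp_all add: X2)
    have low: "cmp i v = 0" if "i < int n" "i \<in> {0..int d}" for i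
    proof -
      have "cmp i v \<in> {0}"
      proof (rule sw.up_induct[OF lin_cmp _ _ 2])
        fix k v assume k: "k \<le> int (d - n)" "v \<in> sw.wt k"
        then have vw: "v \<in> wt (int d - k)" and "i \<noteq> int d - k" using that n by (auto simp: swapped_wt)
        then show "cmp i v \<in> {0}"
          using cmp_eigen[OF vw _ that(2)] wt_outside[OF vw] lin_zero[OF lin_cmp]
          by (cases "int d - k \<in> {0..int d}") auto
      qed simp
      then show ?thesis by simp
    qed
    have other: "cmp x v = (if x = int n then cmp (int n) v else 0)" if "x \<in> {0..int d}" for x
      using low[of x] cmp_up_less[OF 1, of x] that by (cases x "int n" rule: linorder_cases) auto
    have "v = (\<Sum>i\<in>{0..int d}. cmp i v)" using sum_cmp[OF v] by simp
    also have "\<dots> = (\<Sum>i\<in>{0..int d}. if i = int n then cmp (int n) v else 0)"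
      by (rule sum.cong[OF refl other])
    also have "\<dots> = cmp (int n) v" using n by simp
    finally show "v \<in> wt (int n)" using cmp_wt[OF v, of "int n"] n by simp
  qed
qed

end

context q_space
begin

lemma additive_sum:
  assumes "subspace V" "\<And>u v. u \<in> V \<Longrightarrow> v \<in> V \<Longrightarrow> f (u + v) = f u + f v" "\<And>i. i \<in> I \<Longrightarrow> h i \<in> V" "f 0 = 0"
  shows "f (\<Sum>i\<in>I. h i) = (\<Sum>i\<in>I. f (h i))"
  using assms(3) by (induction I rule: infinite_finite_induct) (auto simp: assms subspace_sum[OF assms(1)])

text \<open>
  An isomorphism of pullbacks preserves the weight spaces, hence commutes with \<open>K\<close>; the other operators are
  combinations of \<open>K\<close>, \<open>Ki\<close> and the \<open>X i\<close>.
\<close>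

lemma iso_of_pullbacks:
  assumes M: "M \<in> uq_modules q" and M': "M' \<in> uq_modules q"
    and iso: "module_iso (box_alg q) (pullback (psi q) M) (pullback (psi q) M')"
  shows "module_iso (uq_alg q) M M'"
proof -
  have gex: "\<exists>g d. acts_by (uq_rels q) M g \<and> uq_irr g (fst M) d" if "M \<in> uq_modules q" for M
  proof -
    have irr: "irreducible_module (uq_alg q) M" and fin: "fin_dim M" and type: "uq_type1 q M"
      using that by (auto simp: uq_modules_def)
    obtain g where "acts_by (uq_rels q) M g"
      using alg_module_imp_acts_by[of "uq_rels q" M] irr by (auto simp: irreducible_module_def uq_alg_def split: prod.splits)
    then show ?thesis using uq_drinfeld[OF _ irr fin type] by blast
  qed
  obtain g d where g: "acts_by (uq_rels q) M g" "uq_irr g (fst M) d" using gex[OF M] by blast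
  obtain g' d' where g': "acts_by (uq_rels q) M' g'" "uq_irr g' (fst M') d'" using gex[OF M'] by blast
  interpret I: uq_irreducible scale q "fst M" "g (KGen 0)" "g (KGen 1)" "g (EPlus 0)" "g (EPlus 1)" "g (EMinus 1)" "g (EMinus 0)" d
    by (rule g(2))
  interpret J: uq_irreducible scale q "fst M'" "g' (KGen 0)" "g' (KGen 1)" "g' (EPlus 0)" "g' (EPlus 1)" "g' (EMinus 1)" "g' (EMinus 0)" d'
    by (rule g'(2))
  have pb: "acts_by (box_rels q) (pullback (psi q) M) I.X" "acts_by (box_rels q) (pullback (psi q) M') J.X"
    by (rule pullback_acts_by[OF g(1)], rule pullback_acts_by[OF g'(1)])
  have fst: "fst (pullback (psi q) N) = fst N" for N :: "((uq_gen list \<Rightarrow>\<^sub>0 'a) set, 'b) alg_mod"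
    by (simp add: pullback_def)
  obtain f where f: "bij_betw f (fst M) (fst M')"
    and add: "\<And>u v. u \<in> fst M \<Longrightarrow> v \<in> fst M \<Longrightarrow> f (u + v) = f u + f v"
    and sc: "\<And>c v. v \<in> fst M \<Longrightarrow> f (scale c v) = scale c (f v)"
    and com: "\<And>i v. v \<in> fst M \<Longrightarrow> f (I.X i v) = J.X i (f v)"
    using iso unfolding box_alg_def module_iso_iff[OF pb] fst by blast
  have fV: "f v \<in> fst M'" if "v \<in> fst M" for v using f that by (auto simp: bij_betw_def)
  have f0: "f 0 = 0" using sc[OF subspace_0[OF I.sub], of 0] by simp
  have finj: "f v = 0 \<longleftrightarrow> v = 0" if "v \<in> fst M" for v
    using f that f0 subspace_0[OF I.sub] by (auto simp: bij_betw_def inj_on_def)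
  have fdiff: "f (u - v) = f u - f v" if "u \<in> fst M" "v \<in> fst M" for u v
    using add[OF that(1) subspace_scale[OF I.sub that(2), of "-1"]] sc[OF that(2), of "-1"] by simp
  have "{c. \<exists>v\<in>fst M. v \<noteq> 0 \<and> I.X 0 v = scale c v} = {c. \<exists>v\<in>fst M'. v \<noteq> 0 \<and> J.X 0 v = scale c v}"
  proof (intro equalityI subsetI)
    fix c assume "c \<in> {c. \<exists>v\<in>fst M. v \<noteq> 0 \<and> I.X 0 v = scale c v}"
    then obtain v where "v \<in> fst M" "v \<noteq> 0" "I.X 0 v = scale c v" by blast
    then show "c \<in> {c. \<exists>v\<in>fst M'. v \<noteq> 0 \<and> J.X 0 v = scale c v}"
      using com[of v 0] sc[of v c] finj[of v] fV[of v] by (intro CollectI bexI[of _ "f v"]) auto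
  next
    fix c assume "c \<in> {c. \<exists>v\<in>fst M'. v \<noteq> 0 \<and> J.X 0 v = scale c v}"
    then obtain w where w: "w \<in> fst M'" "w \<noteq> 0" "J.X 0 w = scale c w" by blast
    then obtain v where v: "v \<in> fst M" "w = f v" using f by (auto simp: bij_betw_def)
    have "f (I.X 0 v) = f (scale c v)" using com[OF v(1)] sc[OF v(1)] w(3) v(2) by simp
    then have "I.X 0 v = scale c v"
      using f I.X_inV subspace_scale[OF I.sub v(1)] by (auto simp: bij_betw_def inj_on_def)
    then show "c \<in> {c. \<exists>v\<in>fst M. v \<noteq> 0 \<and> I.X 0 v = scale c v}"
      using v w(2) f0 by (intro CollectI bexI[of _ v]) auto
  qed
  then have dd: "d' = d"
    using spectrum_determines_diameter[of d d'] I.spectrum_X[of 0] J.spectrum_X[of 0] by simp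
  have wt: "f v \<in> J.wt j" if v: "v \<in> I.wt j" and j: "j \<in> {0..int d}" for v j
  proof -
    obtain n where n: "j = int n" "n \<le> d" using j nonneg_int_cases by (metis atLeastAtMost_iff of_nat_le_iff)
    have vV: "v \<in> fst M" by (rule I.wt_V[OF v])
    have P: "f (papp (I.X i) p v) = papp (J.X i) p (f v)" for i p
      by (rule papp_intertwine[where f = f, OF I.lin_X J.lin_X I.X_V vV _ _ _ I.sub]) (erule (1) add, erule sc, erule com)
    have "n \<le> d'" using n(2) dd by simp
    note J.wt_iff_X[OF fV[OF vV] this]
    moreover note v[unfolded n(1) I.wt_iff_X[OF vV n(2)]]
    ultimately show ?thesis by (simp only: n(1) dd P[symmetric] f0 simp_thms)
  qed
  have on_wt: "h v = h' v" if "\<And>j v. v \<in> I.wt j \<Longrightarrow> j \<in> {0..int d} \<Longrightarrow> h v = h' v"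
    "\<And>u. (\<And>j. u j \<in> fst M) \<Longrightarrow> h (\<Sum>j\<in>{0..int d}. u j) = (\<Sum>j\<in>{0..int d}. h (u j))"
    "\<And>u. (\<And>j. u j \<in> fst M) \<Longrightarrow> h' (\<Sum>j\<in>{0..int d}. u j) = (\<Sum>j\<in>{0..int d}. h' (u j))"
    "v \<in> fst M" for h h' :: "'b \<Rightarrow> 'b" and v
  proof -
    have cV: "I.cmp j v \<in> fst M" for j by (rule I.cmp_closed[OF I.sub I.maps_into_V(1) that(4)])
    have "h (\<Sum>j\<in>{0..int d}. I.cmp j v) = h' (\<Sum>j\<in>{0..int d}. I.cmp j v)"
      unfolding that(2)[of "\<lambda>j. I.cmp j v", OF cV] that(3)[of "\<lambda>j. I.cmp j v", OF cV]
      using that(1)[OF I.cmp_wt[OF that(4)]] by (intro sum.cong) auto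
    then show ?thesis by (simp only: I.sum_cmp[OF that(4)])
  qed
  have fsum: "f (\<Sum>j\<in>{0..int d}. u j) = (\<Sum>j\<in>{0..int d}. f (u j))" if "\<And>j. u j \<in> fst M" for u
    by (rule additive_sum[OF I.sub add _ f0]) (use that in auto)
  have K: "f (g (KGen 0) v) = g' (KGen 0) (f v)" if v: "v \<in> fst M" for v
  proof (rule on_wt[OF _ _ _ v])
    fix j v assume v: "v \<in> I.wt j" "j \<in> {0..int d}"
    show "f (g (KGen 0) v) = g' (KGen 0) (f v)"
      using J.wt_K[OF wt[OF v]] I.wt_K[OF v(1)] sc[OF I.wt_V[OF v(1)]] by (simp add: dd)
  qed (simp_all add: fsum I.inV lin_sum[OF I.lin(1)] lin_sum[OF J.lin(1)])
  have Ki: "f (g (KGen 1) v) = g' (KGen 1) (f v)" if v: "v \<in> fst M" for v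
  proof -
    have "g' (KGen 1) (f (g (KGen 0) (g (KGen 1) v))) = g' (KGen 1) (g' (KGen 0) (f (g (KGen 1) v)))"
      using K I.inV by simp
    then show ?thesis using I.KKi(1)[OF v] J.KKi(2) fV I.inV by simp
  qed
  have cancel: "f w = w'" if "w \<in> fst M" "c \<noteq> 0" "scale c (f w) = scale c w'" for w w' c
    using that scale_left_imp_eq by blast
  have a: "f (g (EPlus 1) v) = g' (EPlus 1) (f v)" if v: "v \<in> fst M" for v
  proof (rule cancel[OF I.inV(4) qd_nonzero])
    have "scale qd (g (EPlus 1) v) = g (KGen 1) v - I.X 1 v" by (simp add: I.X_simps)
    then have "scale qd (f (g (EPlus 1) v)) = f (g (KGen 1) v) - f (I.X 1 v)"
      using sc[OF I.inV(4), of qd v] fdiff[OF I.inV(2) I.X_inV] by simp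
    then show "scale qd (f (g (EPlus 1) v)) = scale qd (g' (EPlus 1) (f v))"
      by (simp only: Ki[OF v] com[OF v]) (simp add: J.X_simps)
  qed
  have A: "f (g (EPlus 0) v) = g' (EPlus 0) (f v)" if v: "v \<in> fst M" for v
  proof (rule cancel[OF I.inV(3) qd_nonzero])
    have "scale qd (g (EPlus 0) v) = g (KGen 0) v - I.X 3 v" by (simp add: I.X_simps)
    then have "scale qd (f (g (EPlus 0) v)) = f (g (KGen 0) v) - f (I.X 3 v)"
      using sc[OF I.inV(3), of qd v] fdiff[OF I.inV(1) I.X_inV] by simp
    then show "scale qd (f (g (EPlus 0) v)) = scale qd (g' (EPlus 0) (f v))"
      by (simp only: K[OF v] com[OF v]) (simp add: J.X_simps)
  qed
  have qqd: "q * qd \<noteq> 0" using q_nonzero qd_nonzero by (simp only: mult_eq_0_iff) simp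
  have b: "f (g (EMinus 0) v) = g' (EMinus 0) (f v)" if v: "v \<in> fst M" for v
  proof -
    have "scale (q * qd) (f (g (KGen 0) (g (EMinus 0) v))) = f (I.X 0 v) - f (g (KGen 0) v)"
    proof -
      have "scale (q * qd) (g (KGen 0) (g (EMinus 0) v)) = I.X 0 v - g (KGen 0) v" by (simp only: I.X_simps add_diff_cancel_left')
      then show ?thesis using sc[OF I.inV(1), of "q * qd"] fdiff[OF I.X_inV I.inV(1)] by metis
    qed
    also have "\<dots> = scale (q * qd) (g' (KGen 0) (g' (EMinus 0) (f v)))"
      by (simp only: K[OF v] com[OF v] J.X_simps add_diff_cancel_left')
    finally have "f (g (KGen 0) (g (EMinus 0) v)) = g' (KGen 0) (g' (EMinus 0) (f v))"
      by (rule cancel[OF I.inV(1) qqd])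
    then have "g' (KGen 1) (g' (KGen 0) (f (g (EMinus 0) v))) = g' (KGen 1) (g' (KGen 0) (g' (EMinus 0) (f v)))"
      using K[OF I.inV(6)] by simp
    then show ?thesis using J.KKi(2) fV I.inV J.inV by simp
  qed
  have B: "f (g (EMinus 1) v) = g' (EMinus 1) (f v)" if v: "v \<in> fst M" for v
  proof -
    have "scale (q * qd) (f (g (KGen 1) (g (EMinus 1) v))) = f (I.X 2 v) - f (g (KGen 1) v)"
    proof -
      have "scale (q * qd) (g (KGen 1) (g (EMinus 1) v)) = I.X 2 v - g (KGen 1) v" by (simp only: I.X_simps add_diff_cancel_left')
      then show ?thesis using sc[OF I.inV(2), of "q * qd"] fdiff[OF I.X_inV I.inV(2)] by metis
    qed
    also have "\<dots> = scale (q * qd) (g' (KGen 1) (g' (EMinus 1) (f v)))"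
      by (simp only: Ki[OF v] com[OF v] J.X_simps add_diff_cancel_left')
    finally have "f (g (KGen 1) (g (EMinus 1) v)) = g' (KGen 1) (g' (EMinus 1) (f v))"
      by (rule cancel[OF I.inV(2) qqd])
    then have "g' (KGen 0) (g' (KGen 1) (f (g (EMinus 1) v))) = g' (KGen 0) (g' (KGen 1) (g' (EMinus 1) (f v)))"
      using Ki[OF I.inV(5)] by simp
    then show ?thesis using J.KKi(1) fV I.inV J.inV by simp
  qed
  have Kinv: "f (g (KInv i) v) = g' (KInv i) (f v)" if v: "v \<in> fst M" for v i
    using exhaust_2[of i] acts_by_gen_ops[OF g(1)] acts_by_gen_ops[OF g'(1)] v fV[OF v] K[OF v] Ki[OF v]
    unfolding gen_ops_def by metis
  have "f (g y v) = g' y (f v)" if v: "v \<in> fst M" for y v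
  proof (cases y)
    case (EPlus i)
    then show ?thesis using exhaust_2[of i] a[OF v] A[OF v] by auto
  next
    case (EMinus i)
    then show ?thesis using exhaust_2[of i] b[OF v] B[OF v] by auto
  next
    case (KGen i)
    then show ?thesis using exhaust_2[of i] K[OF v] Ki[OF v] by auto
  next
    case (KInv i)
    then show ?thesis using Kinv[OF v] by simp
  qed
  then show ?thesis
    unfolding uq_alg_def module_iso_iff[OF g(1) g'(1)] using f add sc by blast
qed

end

lemma bij_betw_quotients:
  assumes E: "equiv S E" and F: "equiv T F" and h: "\<And>M. M \<in> S \<Longrightarrow> h M \<in> T"
    and compat: "\<And>M N. M \<in> S \<Longrightarrow> N \<in> S \<Longrightarrow> (M, N) \<in> E \<longleftrightarrow> (h M, h N) \<in> F"
    and onto: "\<And>N. N \<in> T \<Longrightarrow> \<exists>M\<in>S. (h M, N) \<in> F"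
  shows "bij_betw (\<lambda>C. F `` (h ` C)) (S // E) (T // F)"
proof -
  have ES: "E `` {M} \<subseteq> S" for M using equiv_type[OF E] by auto
  have cl: "F `` (h ` (E `` {M})) = F `` {h M}" if M: "M \<in> S" for M
  proof
    show "F `` (h ` (E `` {M})) \<subseteq> F `` {h M}"
    proof
      fix y assume "y \<in> F `` (h ` (E `` {M}))"
      then obtain N where N: "(M, N) \<in> E" "(h N, y) \<in> F" by blast
      then have "(h M, h N) \<in> F" using compat[OF M, of N] ES[of M] by auto
      then show "y \<in> F `` {h M}" using N(2) equivE[OF F] by (auto dest: transD)
    qed
    have "M \<in> E `` {M}" using equiv_class_self[OF E M] .
    then show "F `` {h M} \<subseteq> F `` (h ` (E `` {M}))" by blast
  qed
  show ?thesis
    unfolding bij_betw_def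
  proof
    show "inj_on (\<lambda>C. F `` (h ` C)) (S // E)"
    proof (rule inj_onI)
      fix C D assume "C \<in> S // E" "D \<in> S // E" and eq: "F `` (h ` C) = F `` (h ` D)"
      then obtain M N where MN: "M \<in> S" "N \<in> S" "C = E `` {M}" "D = E `` {N}" by (auto elim!: quotientE)
      then have "F `` {h M} = F `` {h N}" using eq cl by simp
      then have "(h M, h N) \<in> F" using eq_equiv_class[OF _ F h] MN by blast
      then have "(M, N) \<in> E" using compat MN by blast
      then show "C = D" using equiv_class_eq[OF E] MN by blast
    qed
    show "(\<lambda>C. F `` (h ` C)) ` (S // E) = T // F"
    proof (intro equalityI subsetI)
      fix D assume "D \<in> (\<lambda>C. F `` (h ` C)) ` (S // E)"
      then obtain M where "M \<in> S" "D = F `` {h M}" using cl by (auto elim!: quotientE)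
      then show "D \<in> T // F" using h by (auto intro: quotientI)
    next
      fix D assume "D \<in> T // F"
      then obtain N where N: "N \<in> T" "D = F `` {N}" by (auto elim!: quotientE)
      then obtain M where M: "M \<in> S" "(h M, N) \<in> F" using onto by blast
      then have "D = F `` (h ` (E `` {M}))" using cl N(2) equiv_class_eq[OF F] by simp
      then show "D \<in> (\<lambda>C. F `` (h ` C)) ` (S // E)" using quotientI[OF M(1), of E] by blast
    qed
  qed
qed

theorem theorem8p5:
  fixes q :: "'f::{alg_closed_field, field_char_0}"
    and scale :: "'f \<Rightarrow> 'v::ab_group_add \<Rightarrow> 'v"
  assumes "q \<noteq> 0" and "\<forall>n>0. q ^ n \<noteq> 1"
    and "vector_space scale"
  shows "bij_betw (ambient_space.psi_sharp scale q)
           (ambient_space.uq_modules scale q //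
              ambient_space.iso_rel scale (uq_alg q) (ambient_space.uq_modules scale q))
           (ambient_space.box_modules scale q //
              ambient_space.iso_rel scale (box_alg q) (ambient_space.box_modules scale q))"
proof -
  interpret ambient_space scale by (simp add: ambient_space_def assms(3))
  interpret q_space scale q
    by unfold_locales (use assms alg_closed_imp_poly_has_root in auto)
  have "equiv (uq_modules q) (iso_rel (uq_alg q) (uq_modules q))"
    by (rule equiv_iso_rel) (auto simp: uq_modules_def irreducible_module_def)
  moreover have "equiv (box_modules q) (iso_rel (box_alg q) (box_modules q))"
    by (rule equiv_iso_rel) (auto simp: box_modules_def irreducible_module_def)
  ultimately have "bij_betw (\<lambda>C. iso_rel (box_alg q) (box_modules q) `` (pullback (psi q) ` C))
      (uq_modules q // iso_rel (uq_alg q) (uq_modules q)) (box_modules q // iso_rel (box_alg q) (box_modules q))"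
  proof (rule bij_betw_quotients[OF _ _ pullback_in_box_modules])
    fix M N assume MN: "M \<in> uq_modules q" "N \<in> uq_modules q"
    show "(M, N) \<in> iso_rel (uq_alg q) (uq_modules q) \<longleftrightarrow>
        (pullback (psi q) M, pullback (psi q) N) \<in> iso_rel (box_alg q) (box_modules q)"
      unfolding iso_rel_def mem_Collect_eq prod.case
      using pullback_iso[of M N] iso_of_pullbacks[of M N] MN MN[THEN pullback_in_box_modules] by metis
  next
    fix N assume N: "N \<in> box_modules q"
    then show "\<exists>M\<in>uq_modules q. (pullback (psi q) M, N) \<in> iso_rel (box_alg q) (box_modules q)"
      using box_module_is_pullback[OF N] pullback_in_box_modules by (auto simp: iso_rel_def)
  qed
  then show ?thesis by (simp only: psi_sharp_def[abs_def])
qed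

end
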